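(* Let $k\ge 1$ be an integer and let $\bm\delta=(\delta_1,\dots,\delta_k)$ be a fixed sequence of positive reals. Then \[C^2_k(n)=\tilde{\Theta}\left(n^{\lfloor (k+1)/3\rfloor+1}\right)\quad\text{if } k\equiv 0 \text{ or } 2 \pmod 3,\] and, if $k\equiv 1\pmod 3$, then \[C^2_k(n)=\Omega\left(n^{(k-1)/3}\,u_2(n)\right),\] and for every $\varepsilon>0$, \[C^2_k(n)=O\left(n^{(k-1)/3+\varepsilon}\,u_2(n)\right).\]
   Context: For a fixed sequence $\bm\delta=(\delta_1,\dots,\delta_k)$ of positive reals, a $(k+1)$-tuple $(p_1,\dots,p_{k+1})$ of pairwise distinct points of $\mathbb{R}^d$ is a $k$-chain if $\|p_j-p_{j+1}\|=\delta_j$ for every $1\le j\le k$. $C^d_k(n)$ denotes the maximum number of $k$-chains spanned by a set of $n$ points in $\mathbb{R}^d$. $u_2(n)$ denotes the maximum number of pairs of points at distance exactly $1$ in a set of $n$ points in $\mathbb{R}^2$. Notation: $f(n)=\tilde O(g(n))$ means there are positive constants $c,C$ with $f(n)/g(n)\le C\log^c n$ for all sufficiently large $n$; $f=\tilde\Omega(g)$ means $g=\tilde O(f)$; $f=\tilde\Theta(g)$ means both $f=\tilde O(g)$ and $g=\tilde O(f)$. Implicit constants may depend on $k$, $\bm\delta$ and $\varepsilon$. *)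

theory Defs
  imports "HOL-Analysis.Analysis" "HOL-Library.Landau_Symbols"
begin

type_synonym point2 = "real ^ 2"

definition chains :: "(nat \<Rightarrow> real) \<Rightarrow> nat \<Rightarrow> point2 set \<Rightarrow> point2 list set" where
  "chains \<delta> k P = {ps. length ps = Suc k \<and> distinct ps \<and> set ps \<subseteq> P \<and>
      (\<forall>j<k. dist (ps ! j) (ps ! Suc j) = \<delta> j)}"

definition C2 :: "(nat \<Rightarrow> real) \<Rightarrow> nat \<Rightarrow> nat \<Rightarrow> nat" where
  "C2 \<delta> k n = Max {card (chains \<delta> k P) | P. finite P \<and> card P = n}"

definition u2 :: "nat \<Rightarrow> nat" where
  "u2 n = Max {card {{p, q} | p q. p \<in> P \<and> q \<in> P \<and> dist p q = 1} | P :: point2 set.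
                 finite P \<and> card P = n}"

definition soft_O :: "(nat \<Rightarrow> real) \<Rightarrow> (nat \<Rightarrow> real) \<Rightarrow> bool" where
  "soft_O f g \<longleftrightarrow> (\<exists>c Cc. c > 0 \<and> Cc > 0 \<and>
      (\<forall>\<^sub>F n in at_top. f n / g n \<le> Cc * (ln (real n)) powr c))"

definition soft_Theta :: "(nat \<Rightarrow> real) \<Rightarrow> (nat \<Rightarrow> real) \<Rightarrow> bool" where
  "soft_Theta f g \<longleftrightarrow> soft_O f g \<and> soft_O g f"

end

theory Submission
  imports Defs "HOL-Library.Discrete_Functions" "HOL-Real_Asymp.Real_Asymp"
begin

text \<open>
  Upper bound. Upper halves of circles of equal radius pairwise meet at most once, and two points lie on at
  most one of them, so Szekely's crossing argument gives the Szemeredi--Trotter bound for circles of radius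
  \<open>\<delta>\<close>; the arcs are graphs of functions, hence the required bound on the number of edges of a planar drawing
  follows from visibility in the vertical direction instead of Euler's formula. Consider the chains ending in
  \<open>a, b, c, q\<close> and split them into dyadic classes according to the number of chains ending in \<open>a\<close> and to the
  degrees of \<open>b\<close> and \<open>c\<close>. The incidence bound for the classes, together with the fact that the two neighbours
  of an inner vertex determine it up to two choices, turns bounds for the number of chains of length \<open>3j + 1\<close>
  ending in a given set into such bounds for \<open>3j + 4\<close>. Only polylogarithmically many classes occur, so every
  step costs a polylogarithmic factor.

  Lower bound. Fix every third point of a zigzag. The second neighbour of a fixed point moves freely on a
  circle, and the next point follows it like the joint of a linkage. If \<open>k mod 3 = 1\<close>, the last edge of the
  chain is taken from a configuration with many unit distances that has been concentrated near two points.
\<close>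

section \<open>Incidences between points and circles of equal radius\<close>

text \<open>The total number of chains is too coarse to be carried from one length to the next,
  because all chains might end in few points. What reproduces itself is a bound for every end set
  \<open>Q\<close> with the shape of the incidence bound times \<open>n ^ j\<close>; the shape
  returns after three edges, hence the period 3. For \<open>Q = P\<close> it gives
  \<open>n ^ (j + 4 / 3)\<close>, which need not be as small as \<open>n ^ j * u2 n\<close>, so a
  second clause bounds the total count by \<open>u2\<close>. Counting a class in four ways, by
  choosing different points among \<open>a\<close>, \<open>b\<close>, \<open>c\<close>,
  \<open>q\<close> first, makes the estimates close: in logarithms everything becomes a finite case
  distinction over linear inequalities.

  The constant 4096 is \<open>64 * 8 * 8\<close>: 64 comes from sampling vertices at rate
  \<open>4 * v / e\<close>, one factor 8 is the cube of the doubling for the last point on an arc,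
  the other is the cube of the doubling for the lower half circles.

  In the lower bound the points at one position must avoid those at all other positions. Every
  ingredient is therefore kept near one base point per position, and this is why the unit distances
  have to be concentrated.\<close>

locale x_monotone_drawing =
  fixes V :: "point2 set" and E :: "'e set"
    and src tgt :: "'e \<Rightarrow> point2" and arc :: "'e \<Rightarrow> real \<Rightarrow> real"
  assumes finite_V: "finite V" and finite_E: "finite E"
    and src_in: "e \<in> E \<Longrightarrow> src e \<in> V" and tgt_in: "e \<in> E \<Longrightarrow> tgt e \<in> V"
    and left_right: "e \<in> E \<Longrightarrow> src e $ 1 < tgt e $ 1"
    and arc_src: "e \<in> E \<Longrightarrow> arc e (src e $ 1) = src e $ 2"
    and arc_tgt: "e \<in> E \<Longrightarrow> arc e (tgt e $ 1) = tgt e $ 2"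
    and arc_cont: "e \<in> E \<Longrightarrow> continuous_on {src e $ 1..tgt e $ 1} (arc e)"
    and vertex_free: "\<lbrakk>e \<in> E; v \<in> V; src e $ 1 < v $ 1; v $ 1 < tgt e $ 1\<rbrakk> \<Longrightarrow> v $ 2 \<noteq> arc e (v $ 1)"
    and simple: "\<lbrakk>e \<in> E; e' \<in> E; src e = src e'; tgt e = tgt e'\<rbrakk> \<Longrightarrow> e = e'"
begin

definition inside :: "'e \<Rightarrow> real \<Rightarrow> bool" where
  "inside e x \<longleftrightarrow> src e $ 1 < x \<and> x < tgt e $ 1"

text \<open>Touching in an interior point counts as a crossing too, so edges that do not cross are
  strictly ordered wherever both are interior.\<close>

definition crossing :: "'e \<Rightarrow> 'e \<Rightarrow> bool" where
  "crossing e e' \<longleftrightarrow> e \<noteq> e' \<and> (\<exists>x. inside e x \<and> inside e' x \<and> arc e x = arc e' x)"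

text \<open>By the intermediate value theorem a change of order produces a common interior point.
  Only the weak order survives at \<open>x'\<close>, which may be a common end point.\<close>

lemma arc_order:
  assumes "e \<in> E" "g \<in> E" "e \<noteq> g" "\<not> crossing e g"
    and x: "x \<in> {src e $ 1..tgt e $ 1}" "x \<in> {src g $ 1..tgt g $ 1}"
    and x': "x' \<in> {src e $ 1..tgt e $ 1}" "x' \<in> {src g $ 1..tgt g $ 1}"
    and less: "arc e x < arc g x"
  shows "arc e x' \<le> arc g x'"
proof (rule ccontr)
  assume neg: "\<not> arc e x' \<le> arc g x'"
  define h where "h t = arc g t - arc e t" for t
  have hx: "h x > 0" "h x' < 0" using less neg by (auto simp: h_def)
  have cont: "continuous_on S h" if "S \<subseteq> {src e $ 1..tgt e $ 1}" "S \<subseteq> {src g $ 1..tgt g $ 1}" for S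
    unfolding h_def
    by (intro continuous_intros continuous_on_subset[OF arc_cont] assms that)
  have "\<exists>t. h t = 0 \<and> (x < t \<and> t < x' \<or> x' < t \<and> t < x)"
  proof (cases "x \<le> x'")
    case True
    have "\<exists>t\<ge>x. t \<le> x' \<and> h t = 0"
      by (rule IVT2') (use True hx x x' in \<open>auto intro!: cont\<close>)
    then obtain t where "t \<ge> x" "t \<le> x'" "h t = 0" by blast
    with hx show ?thesis by (intro exI[of _ t]) (auto simp: less_le)
  next
    case False
    have "\<exists>t\<ge>x'. t \<le> x \<and> h t = 0"
      by (rule IVT') (use False hx x x' in \<open>auto intro!: cont\<close>)
    then obtain t where "t \<ge> x'" "t \<le> x" "h t = 0" by blast
    with hx show ?thesis by (intro exI[of _ t]) (auto simp: less_le)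
  qed
  then obtain t where t: "h t = 0" "x < t \<and> t < x' \<or> x' < t \<and> t < x" by blast
  then have "inside e t" "inside g t" using x x' by (auto simp: inside_def)
  moreover have "arc e t = arc g t" using t by (simp add: h_def)
  ultimately show False using assms unfolding crossing_def by blast
qed

text \<open>An edge that is neither the topmost edge leaving its left end nor the topmost edge entering
  its right end is visible from some vertex vertically above it. Each of the three properties
  is charged to a vertex, and each vertex is charged at most once for each of them.\<close>
lemma planar_edge_bound:
  assumes nc: "\<And>e e'. e \<in> E \<Longrightarrow> e' \<in> E \<Longrightarrow> \<not> crossing e e'"
  shows "card E \<le> 3 * card V"
proof -
  define up where "up e g \<longleftrightarrow> (\<exists>x. inside e x \<and> inside g x \<and> arc e x < arc g x)" for e g
  define sees where "sees (v::point2) e \<longleftrightarrow> inside e (v $ 1) \<and> arc e (v $ 1) < v $ 2 \<and>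
    (\<forall>h\<in>E. inside h (v $ 1) \<and> arc h (v $ 1) < v $ 2 \<longrightarrow> arc h (v $ 1) \<le> arc e (v $ 1))" for v e
  define T1 where "T1 = {e \<in> E. \<not> (\<exists>g\<in>E. src g = src e \<and> up e g)}"
  define T2 where "T2 = {e \<in> E. \<not> (\<exists>g\<in>E. tgt g = tgt e \<and> up e g)}"
  define T3 where "T3 = {e \<in> E. \<exists>v\<in>V. sees v e}"
  have neq: "arc e x \<noteq> arc g x" if "e \<in> E" "g \<in> E" "e \<noteq> g" "inside e x" "inside g x" for e g x
    using nc[OF that(1,2)] that unfolding crossing_def by blast
  have ord: "arc e x' \<le> arc g x'" if "e \<in> E" "g \<in> E" "e \<noteq> g"
      "x \<in> {src e $ 1..tgt e $ 1}" "x \<in> {src g $ 1..tgt g $ 1}"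
      "x' \<in> {src e $ 1..tgt e $ 1}" "x' \<in> {src g $ 1..tgt g $ 1}" "arc e x < arc g x" for e g x x'
    using arc_order[OF that(1,2,3) nc[OF that(1,2)] that(4-)] .
  have pt_eq: "v = w" if "v $ 1 = w $ 1" "v $ 2 = w $ 2" for v w :: point2
    using that by (simp add: vec_eq_iff forall_2)
  have c1: "card T1 \<le> card V"
  proof (rule card_inj_on_le[of src])
    show "inj_on src T1"
    proof (rule inj_onI, rule ccontr)
      fix e g assume eg: "e \<in> T1" "g \<in> T1" "src e = src g" "e \<noteq> g"
      define x where "x = (src e $ 1 + min (tgt e $ 1) (tgt g $ 1)) / 2"
      have E: "e \<in> E" "g \<in> E" using eg by (auto simp: T1_def)
      have "inside e x" "inside g x"
        using left_right[OF E(1)] left_right[OF E(2)] eg(3)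
        unfolding inside_def x_def by (auto simp: min_def field_simps)
      then have "up e g \<or> up g e"
        using neq[OF E eg(4), of x] unfolding up_def by (meson linorder_neqE_linordered_idom)
      then show False using eg E by (auto simp: T1_def)
    qed
  qed (use src_in finite_V in \<open>auto simp: T1_def\<close>)
  have c2: "card T2 \<le> card V"
  proof (rule card_inj_on_le[of tgt])
    show "inj_on tgt T2"
    proof (rule inj_onI, rule ccontr)
      fix e g assume eg: "e \<in> T2" "g \<in> T2" "tgt e = tgt g" "e \<noteq> g"
      define x where "x = (tgt e $ 1 + max (src e $ 1) (src g $ 1)) / 2"
      have E: "e \<in> E" "g \<in> E" using eg by (auto simp: T2_def)
      have "inside e x" "inside g x"
        using left_right[OF E(1)] left_right[OF E(2)] eg(3)
        unfolding inside_def x_def by (auto simp: max_def field_simps)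
      then have "up e g \<or> up g e"
        using neq[OF E eg(4), of x] unfolding up_def by (meson linorder_neqE_linordered_idom)
      then show False using eg E by (auto simp: T2_def)
    qed
  qed (use tgt_in finite_V in \<open>auto simp: T2_def\<close>)
  have c3: "card T3 \<le> card V"
  proof -
    define w where "w e = (SOME v. v \<in> V \<and> sees v e)" for e
    have w: "w e \<in> V \<and> sees (w e) e" if "e \<in> T3" for e
      using that someI_ex[of "\<lambda>v. v \<in> V \<and> sees v e"] unfolding w_def T3_def by blast
    show ?thesis
    proof (rule card_inj_on_le[of w])
      show "inj_on w T3"
      proof (rule inj_onI, rule ccontr)
        fix e g assume eg: "e \<in> T3" "g \<in> T3" "w e = w g" "e \<noteq> g"
        then have E: "e \<in> E" "g \<in> E" by (auto simp: T3_def)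
        have s: "sees (w e) e" "sees (w e) g" using w[OF eg(1)] w[OF eg(2)] eg(3) by auto
        then have "arc e (w e $ 1) = arc g (w e $ 1)"
          using E unfolding sees_def by (meson order_antisym)
        then show False using neq[OF E eg(4)] s unfolding sees_def by blast
      qed
    qed (use w finite_V in auto)
  qed
  have "E \<subseteq> T1 \<union> T2 \<union> T3"
  proof
    fix e assume e: "e \<in> E"
    show "e \<in> T1 \<union> T2 \<union> T3"
    proof (rule ccontr)
      assume "e \<notin> T1 \<union> T2 \<union> T3"
      then have n1: "\<exists>g\<in>E. src g = src e \<and> up e g" and n2: "\<exists>g\<in>E. tgt g = tgt e \<and> up e g"
        and n3: "\<And>v. v \<in> V \<Longrightarrow> \<not> sees v e"
        using e by (auto simp: T1_def T2_def T3_def)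
      define a where "a = src e"
      define b where "b = tgt e"
      have ab: "a $ 1 < b $ 1" using left_right[OF e] by (simp add: a_def b_def)
      define G where "G = {g \<in> E. src g = a \<and> up e g}"
      have G: "finite G" "G \<noteq> {}" using n1 finite_E by (auto simp: G_def a_def)
      define m where "m = Min ((\<lambda>g. tgt g $ 1) ` insert e G)"
      have m_le: "m \<le> tgt g $ 1" if "g \<in> insert e G" for g
        unfolding m_def using G that by (intro Min_le) auto
      have "m \<in> (\<lambda>g. tgt g $ 1) ` insert e G" unfolding m_def using G by (intro Min_in) auto
      then have m_gt: "a $ 1 < m" using e left_right by (auto simp: G_def a_def) (metis left_right)
      \<comment> \<open>\<open>m\<close> is the leftmost right end among \<open>e\<close> and the
        edges of \<open>G\<close>, so all of these edges live over \<open>x0\<close> and their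
        heights can be compared there.\<close>
      define x0 where "x0 = (a $ 1 + m) / 2"
      have x0: "a $ 1 < x0" "x0 < m" using m_gt by (auto simp: x0_def)
      have in0: "inside g x0" if "g \<in> insert e G" for g
        using that x0 m_le[OF that] by (auto simp: inside_def G_def a_def)
      obtain e' where e': "e' \<in> G" "\<And>g. g \<in> G \<Longrightarrow> arc e' x0 \<le> arc g x0"
        using ex_is_arg_min_if_finite[OF G, of "\<lambda>g. arc g x0"]
        by (auto simp: is_arg_min_linorder)
      have e'E: "e' \<in> E" and e's: "src e' = a" and upe': "up e e'" using e'(1) by (auto simp: G_def)
      have ee': "e \<noteq> e'" using upe' by (auto simp: up_def)
      have e_le_e': "arc e x \<le> arc e' x"
        if "x \<in> {a $ 1..b $ 1}" "x \<in> {a $ 1..tgt e' $ 1}" for x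
      proof -
        obtain t where t: "inside e t" "inside e' t" "arc e t < arc e' t" using upe' by (auto simp: up_def)
        show ?thesis by (rule ord[OF e e'E ee', of t]) (use t that e's in \<open>auto simp: inside_def a_def b_def\<close>)
      qed
      \<comment> \<open>\<open>e'\<close> is the lowest edge leaving \<open>a\<close> above
        \<open>e\<close>. The set \<open>W\<close> collects the vertices in the wedge between the
        two edges.\<close>
      define W where "W = {w \<in> V. inside e (w $ 1) \<and> w $ 1 \<le> tgt e' $ 1 \<and> arc e (w $ 1) < w $ 2 \<and> w $ 2 \<le> arc e' (w $ 1)}"
      have finW: "finite W" using finite_V by (auto simp: W_def)
      have aV: "a \<in> V" "b \<in> V" using src_in tgt_in e by (auto simp: a_def b_def)
      \<comment> \<open>An edge coming from further left through \<open>a\<close> would have a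
        vertex in its interior.\<close>
      have touch: False if h: "h \<in> E" "h \<noteq> e" "h \<noteq> e'" and s1: "src h $ 1 < a $ 1" "a $ 1 < tgt h $ 1"
        and eq: "arc h (a $ 1) = a $ 2" for h
        using vertex_free[OF h(1) aV(1)] s1 eq by simp
      show False
      proof (cases "W = {}")
        case False
        \<comment> \<open>The leftmost vertex \<open>w\<close> of the wedge does not see
          \<open>e\<close>, so an edge \<open>h\<close> runs between them. Its left end is either a
          vertex of the wedge further left, or it is \<open>a\<close>, and then \<open>h\<close>
          lies below \<open>e'\<close> and contradicts the choice of \<open>e'\<close>.\<close>
        obtain w where w: "w \<in> W" "\<And>v. v \<in> W \<Longrightarrow> w $ 1 \<le> v $ 1"
          using ex_is_arg_min_if_finite[OF finW False, of "\<lambda>g. g $ 1"]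
          by (auto simp: is_arg_min_linorder)
        have wV: "w \<in> V" and wi: "inside e (w $ 1)" and wt: "w $ 1 \<le> tgt e' $ 1"
          and w2: "arc e (w $ 1) < w $ 2" "w $ 2 \<le> arc e' (w $ 1)" using w(1) by (auto simp: W_def)
        from n3[OF wV] wi w2 obtain h where h: "h \<in> E" "inside h (w $ 1)" "arc h (w $ 1) < w $ 2"
          "arc e (w $ 1) < arc h (w $ 1)" unfolding sees_def by force
        have he: "h \<noteq> e" using h by auto
        have he': "h \<noteq> e'" using h w2 by auto
        have wrange: "w $ 1 \<in> {src e $ 1..tgt e $ 1}" "w $ 1 \<in> {src h $ 1..tgt h $ 1}"
            "w $ 1 \<in> {src e' $ 1..tgt e' $ 1}"
          using wi h(2) wt e's by (auto simp: inside_def a_def)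
        have eh: "arc e x \<le> arc h x" if "x \<in> {src e $ 1..tgt e $ 1}" "x \<in> {src h $ 1..tgt h $ 1}" for x
          by (rule ord[OF e h(1) he[symmetric] wrange(1,2) that h(4)])
        have he'_le: "arc h x \<le> arc e' x" if "x \<in> {src h $ 1..tgt h $ 1}" "x \<in> {src e' $ 1..tgt e' $ 1}" for x
          by (rule ord[OF h(1) e'E he' wrange(2,3) that]) (use h w2 in auto)
        show False
        proof (cases "src h $ 1 \<le> a $ 1")
          case False
          have "src h \<in> V" by (rule src_in[OF h(1)])
          moreover have in_s: "inside e (src h $ 1)"
            using False h(2) wi by (auto simp: inside_def a_def)
          moreover have "src h $ 1 \<le> tgt e' $ 1" using h(2) wt by (auto simp: inside_def)
          moreover have "arc e (src h $ 1) < src h $ 2"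
          proof -
            have "arc e (src h $ 1) \<le> arc h (src h $ 1)"
              by (rule eh) (use in_s left_right[OF h(1)] in \<open>auto simp: inside_def\<close>)
            moreover have "src h $ 2 \<noteq> arc e (src h $ 1)"
              by (rule vertex_free[OF e src_in[OF h(1)]]) (use in_s in \<open>auto simp: inside_def\<close>)
            ultimately show ?thesis using arc_src[OF h(1)] by simp
          qed
          moreover have "src h $ 2 \<le> arc e' (src h $ 1)"
            using he'_le[of "src h $ 1"] arc_src[OF h(1)] False h(2) wt e's left_right[OF h(1)]
            by (auto simp: inside_def)
          ultimately have "src h \<in> W" by (auto simp: W_def)
          from w(2)[OF this] h(2) show False by (simp add: inside_def)
        next
          case True
          have a_in: "a $ 1 \<in> {src e $ 1..tgt e $ 1}" "a $ 1 \<in> {src h $ 1..tgt h $ 1}"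
            "a $ 1 \<in> {src e' $ 1..tgt e' $ 1}"
            using True wi h(2) left_right[OF e] left_right[OF e'E] e's by (auto simp: inside_def a_def)
          have "arc h (a $ 1) = a $ 2"
            using eh[OF a_in(1,2)] he'_le[OF a_in(2,3)] arc_src[OF e] arc_src[OF e'E] e's
            by (simp add: a_def)
          moreover have "a $ 1 < tgt h $ 1" using wi h(2) by (auto simp: inside_def a_def)
          ultimately have s1: "src h $ 1 = a $ 1" using touch[OF h(1) he he'] True by force
          have "src h = a"
            by (rule pt_eq[OF s1]) (use arc_src[OF h(1)] s1 \<open>arc h (a $ 1) = a $ 2\<close> in simp)
          then have hG: "h \<in> G" using h wi by (auto simp: G_def up_def)
          have "arc h x0 \<le> arc e' x0"
            by (rule he'_le) (use in0[of h] in0[of e'] hG e'(1) in \<open>auto simp: inside_def\<close>)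
          with e'(2)[OF hG] have "arc h x0 = arc e' x0" by simp
          then show False using neq[OF h(1) e'E he' in0 in0] hG e'(1) by auto
        qed
      next
        case True
        \<comment> \<open>If \<open>e'\<close> stopped before \<open>b\<close>, its right end would
          be a vertex of the wedge.\<close>
        have t'1: "b $ 1 \<le> tgt e' $ 1"
        proof (rule ccontr)
          assume "\<not> b $ 1 \<le> tgt e' $ 1"
          then have i: "inside e (tgt e' $ 1)"
            using left_right[OF e'E] e's by (auto simp: inside_def a_def b_def)
          have "arc e (tgt e' $ 1) \<le> arc e' (tgt e' $ 1)"
            by (rule e_le_e') (use i in \<open>auto simp: inside_def a_def b_def\<close>)
          moreover have "tgt e' $ 2 \<noteq> arc e (tgt e' $ 1)"
            by (rule vertex_free[OF e tgt_in[OF e'E]]) (use i in \<open>auto simp: inside_def\<close>)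
          ultimately have "tgt e' \<in> W"
            using i tgt_in[OF e'E] arc_tgt[OF e'E] by (auto simp: W_def)
          then show False using True by simp
        qed
        \<comment> \<open>The edge \<open>g\<close> enters \<open>b\<close> above \<open>e\<close>
          and is trapped in the empty wedge, so it must start at \<open>a\<close>. It is then
          parallel to \<open>e\<close>, which \<open>simple\<close> forbids.\<close>
        obtain g where g: "g \<in> E" "tgt g = b" "up e g" using n2 by (auto simp: b_def)
        have ge: "g \<noteq> e" using g by (auto simp: up_def)
        have e'_tgt: "tgt e' \<noteq> b" using simple[OF e e'E] e's ee' by (auto simp: a_def b_def)
        have ge': "g \<noteq> e'" using e'_tgt g by auto
        have b2: "b $ 2 < arc e' (b $ 1)"
        proof -
          have "arc e (b $ 1) \<le> arc e' (b $ 1)" by (rule e_le_e') (use ab t'1 in auto)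
          then have le: "b $ 2 \<le> arc e' (b $ 1)" using arc_tgt[OF e] by (simp add: b_def)
          moreover have "b $ 2 \<noteq> arc e' (b $ 1)"
          proof (cases "b $ 1 = tgt e' $ 1")
            case True
            then show ?thesis using pt_eq[of "tgt e'" b] e'_tgt arc_tgt[OF e'E] by metis
          next
            case False
            then show ?thesis using vertex_free[OF e'E aV(2)] t'1 ab e's by simp
          qed
          ultimately show ?thesis by simp
        qed
        obtain t where t: "inside e t" "inside g t" "arc e t < arc g t" using g(3) by (auto simp: up_def)
        have eg: "arc e x \<le> arc g x" if "x \<in> {src e $ 1..tgt e $ 1}" "x \<in> {src g $ 1..tgt g $ 1}" for x
          by (rule ord[OF e g(1) ge[symmetric], of t]) (use t that in \<open>auto simp: inside_def\<close>)
        have ge'_le: "arc g x \<le> arc e' x" if "x \<in> {src g $ 1..tgt g $ 1}" "x \<in> {src e' $ 1..tgt e' $ 1}" for x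
          by (rule ord[OF g(1) e'E ge', of "b $ 1"])
            (use that b2 arc_tgt[OF g(1)] g(2) left_right[OF g(1)] t'1 ab e's in auto)
        show False
        proof (cases "src g $ 1 \<le> a $ 1")
          case False
          have in_s: "inside e (src g $ 1)"
            using False t by (auto simp: inside_def a_def)
          have "arc e (src g $ 1) \<le> arc g (src g $ 1)"
            by (rule eg) (use in_s left_right[OF g(1)] in \<open>auto simp: inside_def\<close>)
          moreover have "src g $ 2 \<noteq> arc e (src g $ 1)"
            by (rule vertex_free[OF e src_in[OF g(1)]]) (use in_s in \<open>auto simp: inside_def\<close>)
          moreover have "src g $ 2 \<le> arc e' (src g $ 1)"
            using ge'_le[of "src g $ 1"] arc_src[OF g(1)] False t'1 e's left_right[OF g(1)] g(2)
            by auto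
          ultimately have "src g \<in> W"
            using in_s arc_src[OF g(1)] src_in[OF g(1)] left_right[OF g(1)] g(2) t'1 by (auto simp: W_def)
          then show False using True by simp
        next
          case le: True
          have a_in: "a $ 1 \<in> {src e $ 1..tgt e $ 1}" "a $ 1 \<in> {src g $ 1..tgt g $ 1}"
            "a $ 1 \<in> {src e' $ 1..tgt e' $ 1}"
            using le ab left_right[OF e] left_right[OF e'E] e's g(2) by (auto simp: a_def)
          have eq: "arc g (a $ 1) = a $ 2"
            using eg[OF a_in(1,2)] ge'_le[OF a_in(2,3)] arc_src[OF e] arc_src[OF e'E] e's
            by (simp add: a_def)
          then have s1: "src g $ 1 = a $ 1" using touch[OF g(1) ge ge'] le ab g(2) by force
          have "src g = a"
            by (rule pt_eq[OF s1]) (use arc_src[OF g(1)] s1 eq in simp)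
          then have "g = e" using simple[OF g(1) e] g(2) by (simp add: a_def b_def)
          then show False using ge by simp
        qed
      qed
    qed
  qed
  then have "card E \<le> card (T1 \<union> T2 \<union> T3)"
    using finite_E by (intro card_mono) (auto simp: T1_def T2_def T3_def)
  also have "\<dots> \<le> card T1 + card T2 + card T3"
    using card_Un_le[of "T1 \<union> T2" T3] card_Un_le[of T1 T2] by linarith
  finally show ?thesis using c1 c2 c3 by simp
qed

end

section \<open>Random vertex sets and the crossing lemma\<close>

lemma sum_Pow_weights:
  fixes p :: real
  assumes "finite D"
  shows "(\<Sum>T\<in>Pow D. p ^ card T * (1 - p) ^ (card D - card T)) = 1"
proof -
  have "(\<Sum>T\<in>Pow D. p ^ card T * (1 - p) ^ (card D - card T)) = (\<Sum>T\<in>Pow D. (\<Prod>x\<in>T. p) * (\<Prod>x\<in>D - T. 1 - p))"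
    using assms by (intro sum.cong refl) (auto simp: card_Diff_subset finite_subset)
  also have "\<dots> = (\<Prod>x\<in>D. p + (1 - p))" by (rule prod_add[OF assms, symmetric])
  finally show ?thesis by simp
qed

text \<open>The left-hand side is the probability that a random subset of \<open>V\<close> contains
  \<open>S\<close>, each point being kept independently with probability \<open>p\<close>. As a
  polynomial identity it holds for every real \<open>p\<close>.\<close>

lemma sum_Pow_superset_weights:
  fixes p :: real
  assumes "finite V" "S \<subseteq> V"
  shows "(\<Sum>U\<in>{U \<in> Pow V. S \<subseteq> U}. p ^ card U * (1 - p) ^ (card V - card U)) = p ^ card S"
proof -
  have fS: "finite S" using assms finite_subset by blast
  have "(\<Sum>U\<in>{U \<in> Pow V. S \<subseteq> U}. p ^ card U * (1 - p) ^ (card V - card U))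
      = (\<Sum>T\<in>Pow (V - S). p ^ card S * (p ^ card T * (1 - p) ^ (card (V - S) - card T)))"
  proof (rule sum.reindex_bij_witness[of _ "\<lambda>T. T \<union> S" "\<lambda>U. U - S"])
    fix U assume U: "U \<in> {U \<in> Pow V. S \<subseteq> U}"
    then have fU: "finite U" using assms finite_subset by auto
    have "card (U - S) = card U - card S" "card (V - S) = card V - card S"
      using U fS assms by (auto intro!: card_Diff_subset)
    moreover have "card S \<le> card U" using U fU by (auto intro: card_mono)
    ultimately show "p ^ card S * (p ^ card (U - S) * (1 - p) ^ (card (V - S) - card (U - S))) = p ^ card U * (1 - p) ^ (card V - card U)"
      by (simp flip: power_add mult.assoc)
  qed (use assms in auto)
  also have "\<dots> = p ^ card S"
    using sum_Pow_weights[of "V - S" p] assms by (simp flip: sum_distrib_left)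
  finally show ?thesis .
qed

text \<open>Linearity of expectation for the number of indices whose set \<open>S i\<close> survives
  the sampling.\<close>

lemma sum_Pow_count:
  fixes p :: real
  assumes "finite V" "finite I" "\<And>i. i \<in> I \<Longrightarrow> S i \<subseteq> V" "\<And>i. i \<in> I \<Longrightarrow> card (S i) = k"
  shows "(\<Sum>U\<in>Pow V. p ^ card U * (1 - p) ^ (card V - card U) * real (card {i \<in> I. S i \<subseteq> U}))
    = p ^ k * real (card I)"
proof -
  let ?w = "\<lambda>U. p ^ card U * (1 - p) ^ (card V - card U)"
  have "(\<Sum>U\<in>Pow V. ?w U * real (card {i \<in> I. S i \<subseteq> U}))
      = (\<Sum>U\<in>Pow V. \<Sum>i\<in>I. if S i \<subseteq> U then ?w U else 0)"
    using assms(2) by (intro sum.cong refl) (simp add: sum.If_cases Int_def)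
  also have "\<dots> = (\<Sum>i\<in>I. \<Sum>U\<in>Pow V. if S i \<subseteq> U then ?w U else 0)" by (rule sum.swap)
  also have "\<dots> = (\<Sum>i\<in>I. p ^ k)"
  proof (rule sum.cong[OF refl])
    fix i assume i: "i \<in> I"
    have "(\<Sum>U\<in>Pow V. if S i \<subseteq> U then ?w U else 0) = (\<Sum>U\<in>{U \<in> Pow V. S i \<subseteq> U}. ?w U)"
      using assms(1) by (simp add: sum.If_cases Int_def)
    then show "(\<Sum>U\<in>Pow V. if S i \<subseteq> U then ?w U else 0) = p ^ k"
      using sum_Pow_superset_weights[OF assms(1) assms(3)[OF i], of p] assms(4)[OF i] by simp
  qed
  finally show ?thesis by simp
qed

context x_monotone_drawing
begin

lemma subdrawing:
  assumes "U \<subseteq> V" "E' \<subseteq> E" "\<And>e. e \<in> E' \<Longrightarrow> src e \<in> U \<and> tgt e \<in> U"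
  shows "x_monotone_drawing U E' src tgt arc"
proof
  show "finite U" "finite E'" using assms finite_V finite_E finite_subset by blast+
next
  fix e e' assume "e \<in> E'" "e' \<in> E'" "src e = src e'" "tgt e = tgt e'"
  then show "e = e'" using simple assms by blast
next
  fix e v assume "e \<in> E'" "v \<in> U" "src e $ 1 < v $ 1" "v $ 1 < tgt e $ 1"
  then show "v $ 2 \<noteq> arc e (v $ 1)" using vertex_free assms by blast
qed (use assms left_right arc_src arc_tgt arc_cont in blast)+

text \<open>Ordered pairs are collected, so two crossing edges contribute twice. This suits the
  later count by ordered pairs of centres.\<close>

definition crossings :: "('e \<times> 'e) set" where
  "crossings = {(e, e'). e \<in> E \<and> e' \<in> E \<and> crossing e e'}"

lemma finite_crossings: "finite crossings"
  by (rule finite_subset[of _ "E \<times> E"]) (auto simp: crossings_def finite_E)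

text \<open>Deleting the first edge of every crossing pair leaves a drawing without
  crossings.\<close>

lemma edge_bound: "card E \<le> 3 * card V + card crossings"
proof -
  define E' where "E' = E - fst ` crossings"
  interpret D: x_monotone_drawing V E' src tgt arc
    by (rule subdrawing) (use src_in tgt_in in \<open>auto simp: E'_def\<close>)
  have "card E' \<le> 3 * card V"
    by (rule D.planar_edge_bound) (force simp: E'_def crossings_def)
  moreover have "card E \<le> card E' + card (fst ` crossings)"
    unfolding E'_def using diff_card_le_card_Diff[of "fst ` crossings" E] finite_crossings
    by auto
  moreover have "card (fst ` crossings) \<le> card crossings"
    by (rule card_image_le[OF finite_crossings])
  ultimately show ?thesis by simp
qed

definition ends :: "'e \<Rightarrow> point2 set" where "ends e = {src e, tgt e}"

text \<open>This is the expectation of \<open>edge_bound\<close> over the drawing induced by a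
  random vertex set. An edge survives with probability \<open>p ^ 2\<close>, a crossing with
  probability \<open>p ^ 4\<close>, because \<open>disj\<close> gives it four distinct ends.\<close>

lemma sampled_edge_bound:
  fixes p :: real
  assumes p: "0 \<le> p" "p \<le> 1"
    and disj: "\<And>e e'. (e, e') \<in> crossings \<Longrightarrow> ends e \<inter> ends e' = {}"
  shows "p ^ 2 * card E \<le> 3 * p * card V + p ^ 4 * card crossings"
proof -
  let ?w = "\<lambda>U. p ^ card U * (1 - p) ^ (card V - card U)"
  let ?E = "\<lambda>U. {e \<in> E. ends e \<subseteq> U}"
  let ?X = "\<lambda>U. {c \<in> crossings. ends (fst c) \<union> ends (snd c) \<subseteq> U}"
  let ?V = "\<lambda>U. {v \<in> V. {v} \<subseteq> U}"
  have card_ends: "card (ends e) = 2" if "e \<in> E" for e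
    using left_right[OF that] by (auto simp: ends_def card_insert_if)
  have le: "?w U * real (card (?E U)) \<le> 3 * (?w U * real (card (?V U))) + ?w U * real (card (?X U))" if U: "U \<in> Pow V" for U
  proof -
    interpret D: x_monotone_drawing U "?E U" src tgt arc
      by (rule subdrawing) (use U in \<open>auto simp: ends_def\<close>)
    have "D.crossings = ?X U" by (auto simp: D.crossings_def crossings_def)
    moreover have "?V U = U" using U by auto
    ultimately have "card (?E U) \<le> 3 * card (?V U) + card (?X U)" using D.edge_bound by simp
    then have "real (card (?E U)) \<le> 3 * card (?V U) + card (?X U)" by linarith
    then have "?w U * real (card (?E U)) \<le> ?w U * (3 * card (?V U) + card (?X U))"
      by (intro mult_left_mono) (use p in auto)
    then show ?thesis by (simp add: algebra_simps)
  qed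
  have "(\<Sum>U\<in>Pow V. ?w U * real (card (?E U)))
      \<le> (\<Sum>U\<in>Pow V. 3 * (?w U * real (card (?V U))) + ?w U * real (card (?X U)))"
    by (rule sum_mono) (rule le)
  also have "\<dots> = 3 * (\<Sum>U\<in>Pow V. ?w U * real (card (?V U))) + (\<Sum>U\<in>Pow V. ?w U * real (card (?X U)))"
    by (simp add: sum.distrib sum_distrib_left)
  also have "(\<Sum>U\<in>Pow V. ?w U * real (card (?V U))) = p ^ 1 * card V"
    by (rule sum_Pow_count) (use finite_V in auto)
  also have "(\<Sum>U\<in>Pow V. ?w U * real (card (?X U))) = p ^ 4 * card crossings"
  proof (rule sum_Pow_count[OF finite_V finite_crossings])
    fix c assume c: "c \<in> crossings"
    then have E: "fst c \<in> E" "snd c \<in> E" by (auto simp: crossings_def)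
    show "ends (fst c) \<union> ends (snd c) \<subseteq> V" using E src_in tgt_in by (auto simp: ends_def)
    show "card (ends (fst c) \<union> ends (snd c)) = 4"
      using card_ends[OF E(1)] card_ends[OF E(2)] disj[of "fst c" "snd c"] c
      by (subst card_Un_disjoint) (auto simp: ends_def)
  qed
  also have "(\<Sum>U\<in>Pow V. ?w U * real (card (?E U))) = p ^ 2 * card E"
    by (rule sum_Pow_count[OF finite_V finite_E])
      (use card_ends src_in tgt_in in \<open>auto simp: ends_def\<close>)
  finally show ?thesis by simp
qed

lemma crossing_lemma:
  assumes disj: "\<And>e e'. (e, e') \<in> crossings \<Longrightarrow> ends e \<inter> ends e' = {}"
  shows "card E \<le> 4 * card V \<or> card E ^ 3 \<le> 64 * card V ^ 2 * card crossings"
proof (cases "card E \<le> 4 * card V")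
  case False
  then have eV: "real (card E) > 4 * card V" by linarith
  then have e0: "real (card E) > 0" by linarith
  define v e x where vex: "v = real (card V)" "e = real (card E)" "x = real (card crossings)"
  have "v > 0"
    using False finite_V src_in unfolding vex by (metis card.empty card_gt_0_iff equals0I le0 of_nat_0_less_iff empty_iff)
  \<comment> \<open>This value is below 1 in the present case, and it makes the vertex term
    \<open>12 * v ^ 2 / e\<close> smaller than the edge term \<open>16 * v ^ 2 / e\<close>. The
    remaining quarter yields \<open>256 / 4 = 64\<close>.\<close>
  define p where "p = 4 * v / e"
  have "p ^ 2 * e \<le> 3 * p * v + p ^ 4 * x"
    using sampled_edge_bound[OF _ _ disj, of p] e0 eV unfolding p_def vex by simp
  then have "16 * v ^ 2 / e \<le> 12 * v ^ 2 / e + 256 * v ^ 4 * x / e ^ 4"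
    using e0 unfolding p_def vex(2)[symmetric] by (simp add: power2_eq_square power_divide power_mult_distrib field_simps)
  then have "4 * v ^ 2 / e \<le> 256 * v ^ 4 * x / e ^ 4" by (simp only: times_divide_eq_right [symmetric])
  then have "4 * v ^ 2 * e ^ 3 \<le> 256 * v ^ 4 * x"
    using e0 unfolding vex(2)[symmetric] by (simp add: field_simps power4_eq_xxxx power3_eq_cube)
  then have "(4 * v ^ 2) * e ^ 3 \<le> (4 * v ^ 2) * (64 * v ^ 2 * x)" by (simp add: power4_eq_xxxx power2_eq_square)
  then have "e ^ 3 \<le> 64 * v ^ 2 * x" using \<open>v > 0\<close> by (subst (asm) mult_le_cancel_left_pos) auto
  then have "real (card E ^ 3) \<le> real (64 * card V ^ 2 * card crossings)" by (simp add: vex)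
  then show ?thesis by linarith
qed simp

end

section \<open>Upper half circles as a drawing and the incidence bound\<close>

definition inc :: "real \<Rightarrow> point2 set \<Rightarrow> point2 set \<Rightarrow> nat" where
  "inc \<delta> A B = card {(a, b). a \<in> A \<and> b \<in> B \<and> dist a b = \<delta>}"

definition upper :: "real \<Rightarrow> point2 \<Rightarrow> point2 \<Rightarrow> bool" where
  "upper \<delta> c p \<longleftrightarrow> dist c p = \<delta> \<and> c $ 2 \<le> p $ 2"

text \<open>Beyond the circle the radicand is negative; there \<open>sqrt\<close> continues as an
  odd function, so the arc is continuous on the whole line.\<close>

definition upper_arc :: "real \<Rightarrow> point2 \<Rightarrow> real \<Rightarrow> real" where
  "upper_arc \<delta> c x = c $ 2 + sqrt (\<delta>\<^sup>2 - (x - c $ 1)\<^sup>2)"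

lemma dist_point2: "dist p q = sqrt ((p $ 1 - q $ 1)\<^sup>2 + (p $ 2 - q $ 2)\<^sup>2)" for p q :: point2
  by (simp add: dist_vec_def L2_set_def sum_2 dist_real_def)

lemma dist_point2_eq_iff:
  "\<delta> > 0 \<Longrightarrow> dist p q = \<delta> \<longleftrightarrow> (p $ 1 - q $ 1)\<^sup>2 + (p $ 2 - q $ 2)\<^sup>2 = \<delta>\<^sup>2" for p q :: point2
  unfolding dist_point2 by (metis less_eq_real_def real_sqrt_abs abs_of_pos real_sqrt_eq_iff)

lemma point2_eqI: "p $ 1 = q $ 1 \<Longrightarrow> p $ 2 = q $ 2 \<Longrightarrow> p = q" for p q :: point2
  by (simp add: vec_eq_iff forall_2)

lemma upper_iff_arc:
  assumes "\<delta> > 0"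
  shows "upper \<delta> c p \<longleftrightarrow> \<bar>p $ 1 - c $ 1\<bar> \<le> \<delta> \<and> p $ 2 = upper_arc \<delta> c (p $ 1)"
proof
  assume u: "upper \<delta> c p"
  then have eq: "(c $ 1 - p $ 1)\<^sup>2 + (c $ 2 - p $ 2)\<^sup>2 = \<delta>\<^sup>2" and ge: "c $ 2 \<le> p $ 2"
    using dist_point2_eq_iff[OF assms] by (auto simp: upper_def)
  have "\<delta>\<^sup>2 - (p $ 1 - c $ 1)\<^sup>2 = (p $ 2 - c $ 2)\<^sup>2"
    using eq by (simp add: power2_commute)
  then have "sqrt (\<delta>\<^sup>2 - (p $ 1 - c $ 1)\<^sup>2) = p $ 2 - c $ 2" using ge by simp
  moreover have "(p $ 1 - c $ 1)\<^sup>2 \<le> \<delta>\<^sup>2"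
    using \<open>\<delta>\<^sup>2 - (p $ 1 - c $ 1)\<^sup>2 = (p $ 2 - c $ 2)\<^sup>2\<close> zero_le_power2[of "p $ 2 - c $ 2"] by linarith
  then have "\<bar>p $ 1 - c $ 1\<bar> \<le> \<delta>" using assms by (simp add: abs_le_square_iff[symmetric])
  ultimately show "\<bar>p $ 1 - c $ 1\<bar> \<le> \<delta> \<and> p $ 2 = upper_arc \<delta> c (p $ 1)"
    by (simp add: upper_arc_def)
next
  assume a: "\<bar>p $ 1 - c $ 1\<bar> \<le> \<delta> \<and> p $ 2 = upper_arc \<delta> c (p $ 1)"
  then have nn: "\<delta>\<^sup>2 - (p $ 1 - c $ 1)\<^sup>2 \<ge> 0"
    using assms by (simp add: abs_le_square_iff[symmetric])
  have "p $ 2 - c $ 2 = sqrt (\<delta>\<^sup>2 - (p $ 1 - c $ 1)\<^sup>2)" using a by (simp add: upper_arc_def)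
  then have "(p $ 2 - c $ 2)\<^sup>2 = \<delta>\<^sup>2 - (p $ 1 - c $ 1)\<^sup>2" "p $ 2 \<ge> c $ 2"
    using real_sqrt_ge_zero[OF nn] nn by (simp, linarith)
  then show "upper \<delta> c p" unfolding upper_def dist_point2_eq_iff[OF assms] by (simp add: power2_commute)
qed

text \<open>The two common points of two circles of equal radius are symmetric about the midpoint of
  the centres, so at most one of them lies on both upper halves.\<close>
lemma upper_unique:
  assumes "\<delta> > 0" "upper \<delta> c p" "upper \<delta> c q" "upper \<delta> c' p" "upper \<delta> c' q" "p \<noteq> q"
  shows "c = c'"
proof (rule ccontr)
  assume "c \<noteq> c'"
  define u1 u2 where "u1 = p $ 1 - q $ 1" "u2 = p $ 2 - q $ 2"
  define d1 d2 where "d1 = c $ 1 - c' $ 1" "d2 = c $ 2 - c' $ 2"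
  define s1 s2 where "s1 = p $ 1 + q $ 1 - c $ 1 - c' $ 1" "s2 = p $ 2 + q $ 2 - c $ 2 - c' $ 2"
  have e: "(c $ 1 - p $ 1)\<^sup>2 + (c $ 2 - p $ 2)\<^sup>2 = \<delta>\<^sup>2" "(c $ 1 - q $ 1)\<^sup>2 + (c $ 2 - q $ 2)\<^sup>2 = \<delta>\<^sup>2"
     "(c' $ 1 - p $ 1)\<^sup>2 + (c' $ 2 - p $ 2)\<^sup>2 = \<delta>\<^sup>2" "(c' $ 1 - q $ 1)\<^sup>2 + (c' $ 2 - q $ 2)\<^sup>2 = \<delta>\<^sup>2"
    and ge: "c $ 2 \<le> p $ 2" "c $ 2 \<le> q $ 2" "c' $ 2 \<le> p $ 2" "c' $ 2 \<le> q $ 2"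
    using assms dist_point2_eq_iff[OF assms(1)] by (auto simp: upper_def)
  have "2 * (s1 * u1 + s2 * u2) = 0" "2 * (s1 * d1 + s2 * d2) = 0" "2 * (u1 * d1 + u2 * d2) = 0"
    using e unfolding u1_u2_def d1_d2_def s1_s2_def by (simp_all add: power2_eq_square algebra_simps)
  then have orth: "s1 * u1 + s2 * u2 = 0" "s1 * d1 + s2 * d2 = 0" "u1 * d1 + u2 * d2 = 0" by simp_all
  have un: "u1\<^sup>2 + u2\<^sup>2 > 0" using \<open>p \<noteq> q\<close> point2_eqI[of p q] by (auto simp: sum_power2_gt_zero_iff u1_u2_def)
  have dn: "d1\<^sup>2 + d2\<^sup>2 > 0" using \<open>c \<noteq> c'\<close> point2_eqI[of c c'] by (auto simp: sum_power2_gt_zero_iff d1_d2_def)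
  \<comment> \<open>\<open>D\<close> is the determinant of the perpendicular non-zero vectors
    \<open>u\<close> and \<open>d\<close>. Hence \<open>s\<close>, being orthogonal to both,
    vanishes, and the midpoints of \<open>p, q\<close> and of \<open>c, c'\<close> coincide. The
    height conditions then put all four points on one horizontal line, where both centres are the
    midpoint of \<open>p\<close> and \<open>q\<close>.\<close>
  define D where "D = u1 * d2 - u2 * d1"
  have "D\<^sup>2 = (u1\<^sup>2 + u2\<^sup>2) * (d1\<^sup>2 + d2\<^sup>2) - (u1 * d1 + u2 * d2)\<^sup>2"
    unfolding D_def by (simp add: power2_eq_square algebra_simps)
  then have D0: "D \<noteq> 0" using orth(3) un dn by auto
  have "s1 * D = 0" "s2 * D = 0"
    using orth(1,2) unfolding D_def by algebra+
  then have s0: "s1 = 0" "s2 = 0" using D0 by auto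
  then have y: "p $ 2 = c $ 2" "q $ 2 = c $ 2" "c' $ 2 = c $ 2" using ge by (auto simp: s1_s2_def)
  have "d1 \<noteq> 0" "u1 \<noteq> 0" using un dn y by (auto simp: u1_u2_def d1_d2_def)
  have sq: "(c $ 1 - p $ 1)\<^sup>2 = (c $ 1 - q $ 1)\<^sup>2" "(c' $ 1 - p $ 1)\<^sup>2 = (c' $ 1 - q $ 1)\<^sup>2"
    using e y by auto
  then have "c $ 1 - p $ 1 = - (c $ 1 - q $ 1)" "c' $ 1 - p $ 1 = - (c' $ 1 - q $ 1)"
    using \<open>u1 \<noteq> 0\<close> unfolding power2_eq_iff u1_u2_def by auto
  then show False using \<open>d1 \<noteq> 0\<close> by (simp add: d1_d2_def)
qed

text \<open>Szekely's graph: its edges join points of \<open>B\<close> that are consecutive on the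
  upper half circle around \<open>c\<close>. The centre is part of the edge since it names the
  arc.\<close>

definition upper_edges :: "real \<Rightarrow> point2 set \<Rightarrow> point2 set \<Rightarrow> (point2 \<times> point2 \<times> point2) set" where
  "upper_edges \<delta> A B = {(c, p, q). c \<in> A \<and> p \<in> B \<and> q \<in> B \<and> upper \<delta> c p \<and> upper \<delta> c q \<and> p $ 1 < q $ 1 \<and>
      (\<forall>v\<in>B. upper \<delta> c v \<longrightarrow> \<not> (p $ 1 < v $ 1 \<and> v $ 1 < q $ 1))}"

text \<open>The absence of parallel edges is \<open>upper_unique\<close>: two points determine the
  arc through them. Since the ends are consecutive, no further vertex lies on an edge.\<close>

lemma upper_drawing:
  assumes "finite A" "finite B" "\<delta> > 0"
  shows "x_monotone_drawing B (upper_edges \<delta> A B) (fst \<circ> snd) (snd \<circ> snd) (\<lambda>e. upper_arc \<delta> (fst e))"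
proof
  show "finite (upper_edges \<delta> A B)"
    by (rule finite_subset[of _ "A \<times> B \<times> B"]) (use assms in \<open>auto simp: upper_edges_def\<close>)
next
  fix e v assume e: "e \<in> upper_edges \<delta> A B" and v: "v \<in> B" "(fst \<circ> snd) e $ 1 < v $ 1" "v $ 1 < (snd \<circ> snd) e $ 1"
  obtain c p q where [simp]: "e = (c, p, q)" by (cases e)
  show "v $ 2 \<noteq> upper_arc \<delta> (fst e) (v $ 1)"
  proof
    assume eq: "v $ 2 = upper_arc \<delta> (fst e) (v $ 1)"
    have "\<bar>p $ 1 - c $ 1\<bar> \<le> \<delta>" "\<bar>q $ 1 - c $ 1\<bar> \<le> \<delta>"
      using e by (auto simp: upper_edges_def upper_iff_arc[OF assms(3)])
    then have "\<bar>v $ 1 - c $ 1\<bar> \<le> \<delta>" using v by simp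
    then have "upper \<delta> c v" using eq by (simp add: upper_iff_arc[OF assms(3)])
    then show False using e v by (auto simp: upper_edges_def)
  qed
next
  fix e e' assume "e \<in> upper_edges \<delta> A B" "e' \<in> upper_edges \<delta> A B"
    "(fst \<circ> snd) e = (fst \<circ> snd) e'" "(snd \<circ> snd) e = (snd \<circ> snd) e'"
  then show "e = e'" using upper_unique[OF assms(3)] by (fastforce simp: upper_edges_def)
next
  fix e show "continuous_on {(fst \<circ> snd) e $ 1..(snd \<circ> snd) e $ 1} (upper_arc \<delta> (fst e))"
    unfolding upper_arc_def by (intro continuous_intros)
qed (use assms in \<open>auto simp: upper_edges_def upper_iff_arc\<close>)

text \<open>Arcs with different centres meet at most once, so a crossing is determined by its
  ordered pair of centres, which gives at most \<open>card A ^ 2\<close> crossings. For the same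
  reason crossing edges share no end.\<close>

lemma card_upper_edges:
  assumes "finite A" "finite B" "\<delta> > 0"
  shows "card (upper_edges \<delta> A B) \<le> 4 * card B \<or>
    card (upper_edges \<delta> A B) ^ 3 \<le> 64 * card B ^ 2 * card A ^ 2"
proof -
  let ?E = "upper_edges \<delta> A B"
  interpret x_monotone_drawing B ?E "fst \<circ> snd" "snd \<circ> snd" "\<lambda>e. upper_arc \<delta> (fst e)"
    by (rule upper_drawing[OF assms])
  \<comment> \<open>Edges on one arc join consecutive points, so two of them over a common abscissa
    coincide.\<close>
  have same: "e = e'" if "e \<in> ?E" "e' \<in> ?E" "fst e = fst e'" "inside e x" "inside e' x" for e e' x
  proof -
    note asm = that
    obtain c p q where [simp]: "e = (c, p, q)" by (cases e)
    obtain p' q' where e': "e' = (c, p', q')" using asm(3) by (cases e') auto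
    have pq: "p $ 1 < x" "x < q $ 1" "p' $ 1 < x" "x < q' $ 1" using that by (auto simp: inside_def e')
    have "upper \<delta> c p" "upper \<delta> c q" "upper \<delta> c p'" "upper \<delta> c q'" "p \<in> B" "q \<in> B" "p' \<in> B" "q' \<in> B"
      using that by (auto simp: upper_edges_def e')
    moreover have "\<not> (p $ 1 < v $ 1 \<and> v $ 1 < q $ 1)" "\<not> (p' $ 1 < v $ 1 \<and> v $ 1 < q' $ 1)"
      if "v \<in> B" "upper \<delta> c v" for v
      using that \<open>e \<in> ?E\<close> \<open>e' \<in> ?E\<close> by (auto simp: upper_edges_def e')
    ultimately have "\<not> p $ 1 < p' $ 1" "\<not> p' $ 1 < p $ 1" "\<not> q $ 1 < q' $ 1" "\<not> q' $ 1 < q $ 1"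
      using pq by (meson order_less_trans)+
    then have "p $ 1 = p' $ 1" "q $ 1 = q' $ 1" by simp_all
    then show ?thesis
      using \<open>upper \<delta> c p\<close> \<open>upper \<delta> c q\<close> \<open>upper \<delta> c p'\<close> \<open>upper \<delta> c q'\<close>
      by (auto simp: e' upper_iff_arc[OF assms(3)] intro!: point2_eqI)
  qed
  have on: "upper \<delta> (fst e) (vector [x, upper_arc \<delta> (fst e) x])" if "e \<in> ?E" "inside e x" for e x
  proof -
    have "\<bar>fst (snd e) $ 1 - fst e $ 1\<bar> \<le> \<delta>" "\<bar>snd (snd e) $ 1 - fst e $ 1\<bar> \<le> \<delta>"
      using that by (auto simp: upper_edges_def upper_iff_arc[OF assms(3)])
    then show ?thesis using that(2) by (auto simp: upper_iff_arc[OF assms(3)] inside_def vector_2)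
  qed
  have cr: "fst e \<noteq> fst e' \<and> (\<exists>x. inside e x \<and> inside e' x \<and>
      upper \<delta> (fst e) (vector [x, upper_arc \<delta> (fst e) x]) \<and> upper \<delta> (fst e') (vector [x, upper_arc \<delta> (fst e) x]))"
    if "(e, e') \<in> crossings" for e e'
  proof -
    note asm = that
    obtain x where x: "inside e x" "inside e' x" "upper_arc \<delta> (fst e) x = upper_arc \<delta> (fst e') x"
      and E: "e \<in> ?E" "e' \<in> ?E" "e \<noteq> e'"
      using asm unfolding crossings_def crossing_def by blast
    then show ?thesis using same[OF E(1,2) _ x(1,2)] on[OF E(1) x(1)] on[OF E(2) x(2)] by force
  qed
  have "ends e \<inter> ends e' = {}" if ee: "(e, e') \<in> crossings" for e e'
  proof (rule ccontr)
    assume "ends e \<inter> ends e' \<noteq> {}"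
    then obtain v where v: "v \<in> ends e" "v \<in> ends e'" by blast
    from cr[OF ee] obtain x where ne: "fst e \<noteq> fst e'" and x: "inside e x"
      "upper \<delta> (fst e) (vector [x, upper_arc \<delta> (fst e) x])" "upper \<delta> (fst e') (vector [x, upper_arc \<delta> (fst e) x])"
      by blast
    have E: "e \<in> ?E" "e' \<in> ?E" using ee by (auto simp: crossings_def)
    have "upper \<delta> (fst e) v" "upper \<delta> (fst e') v" using E v by (auto simp: ends_def upper_edges_def)
    moreover have "v $ 1 \<noteq> x" using x(1) v(1) by (auto simp: inside_def ends_def)
    then have "v \<noteq> vector [x, upper_arc \<delta> (fst e) x]" by (auto simp: vector_2)
    ultimately show False using upper_unique[OF assms(3) _ _ _ _ \<open>v \<noteq> _\<close>] x ne by blast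
  qed
  then have "card ?E \<le> 4 * card B \<or> card ?E ^ 3 \<le> 64 * card B ^ 2 * card crossings"
    by (rule crossing_lemma)
  moreover have "card crossings \<le> card (A \<times> A)"
  proof (rule card_inj_on_le[of "map_prod fst fst"])
    show "inj_on (map_prod fst fst) crossings"
    proof (rule inj_onI)
      fix i j assume ij: "i \<in> crossings" "j \<in> crossings" "map_prod fst fst i = map_prod fst fst j"
      obtain e e' g g' where [simp]: "i = (e, e')" "j = (g, g')" by (metis prod.collapse)
      have X: "(e, e') \<in> crossings" "(g, g') \<in> crossings" and eq: "fst e = fst g" "fst e' = fst g'"
        using ij by (auto simp del: split_paired_All)
      from cr[OF X(1)] obtain x where ne: "fst e \<noteq> fst e'" and x: "inside e x" "inside e' x"
        "upper \<delta> (fst e) (vector [x, upper_arc \<delta> (fst e) x])" "upper \<delta> (fst e') (vector [x, upper_arc \<delta> (fst e) x])"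
        by blast
      from cr[OF X(2)] obtain y where y: "inside g y" "inside g' y"
        "upper \<delta> (fst g) (vector [y, upper_arc \<delta> (fst g) y])" "upper \<delta> (fst g') (vector [y, upper_arc \<delta> (fst g) y])"
        by blast
      have "(vector [x, upper_arc \<delta> (fst e) x] :: point2) = vector [y, upper_arc \<delta> (fst g) y]"
        using upper_unique[OF assms(3)] x y eq ne by metis
      then have "(vector [x, upper_arc \<delta> (fst e) x] :: point2) $ 1 = (vector [y, upper_arc \<delta> (fst g) y] :: point2) $ 1" by simp
      then have "x = y" by (simp add: vector_2)
      then have "e = g" "e' = g'"
        using same[of e g x] same[of e' g' x] X x(1,2) y(1,2) eq unfolding crossings_def by blast+
      then show "i = j" by simp
    qed
  next
    have "fst e \<in> A" if "e \<in> ?E" for e using that by (auto simp: upper_edges_def)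
    then show "map_prod fst fst ` crossings \<subseteq> A \<times> A" unfolding crossings_def by fastforce
  qed (use assms in simp)
  ultimately show ?thesis
    by (auto simp: card_cartesian_product power2_eq_square intro: order_trans mult_left_mono)
qed

text \<open>Every incidence \<open>(c, p)\<close> starts an edge, except when \<open>p\<close> is
  the rightmost point of \<open>B\<close> on the arc of \<open>c\<close>.\<close>

lemma card_upper_le:
  assumes "finite A" "finite B" "\<delta> > 0"
  shows "card {(c, p). c \<in> A \<and> p \<in> B \<and> upper \<delta> c p} \<le> card (upper_edges \<delta> A B) + card A"
proof -
  let ?I = "{(c, p). c \<in> A \<and> p \<in> B \<and> upper \<delta> c p}"
  let ?last = "\<lambda>(c, p). \<forall>q\<in>B. upper \<delta> c q \<longrightarrow> q $ 1 \<le> p $ 1"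
  have finI: "finite ?I" by (rule finite_subset[of _ "A \<times> B"]) (use assms in auto)
  have finE: "finite (upper_edges \<delta> A B)"
    by (rule finite_subset[of _ "A \<times> B \<times> B"]) (use assms in \<open>auto simp: upper_edges_def\<close>)
  have "card {i \<in> ?I. ?last i} \<le> card A"
  proof (rule card_inj_on_le[of fst])
    show "inj_on fst {i \<in> ?I. ?last i}"
    proof (rule inj_onI)
      fix i j assume ij: "i \<in> {i \<in> ?I. ?last i}" "j \<in> {i \<in> ?I. ?last i}" "fst i = fst j"
      then obtain c p q where [simp]: "i = (c, p)" "j = (c, q)" by (metis prod.collapse)
      have *: "\<forall>v\<in>B. upper \<delta> c v \<longrightarrow> v $ 1 \<le> p $ 1" "\<forall>v\<in>B. upper \<delta> c v \<longrightarrow> v $ 1 \<le> q $ 1"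
        "p \<in> B" "q \<in> B" "upper \<delta> c p" "upper \<delta> c q"
        using ij by auto
      then have "p $ 1 = q $ 1" by (meson order_antisym)
      then have "p = q" using * by (intro point2_eqI) (auto simp: upper_iff_arc[OF assms(3)])
      then show "i = j" by simp
    qed
  qed (use assms in auto)
  moreover have "card {i \<in> ?I. \<not> ?last i} \<le> card ((\<lambda>(c, p, q). (c, p)) ` upper_edges \<delta> A B)"
  proof (rule card_mono)
    show "{i \<in> ?I. \<not> ?last i} \<subseteq> (\<lambda>(c, p, q). (c, p)) ` upper_edges \<delta> A B"
    proof
      fix i assume "i \<in> {i \<in> ?I. \<not> ?last i}"
      then obtain c p q where i: "i = (c, p)" and *: "c \<in> A" "p \<in> B" "upper \<delta> c p" "q \<in> B" "upper \<delta> c q" "\<not> q $ 1 \<le> p $ 1"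
        by auto
      define S where "S = {q \<in> B. upper \<delta> c q \<and> p $ 1 < q $ 1}"
      have "finite S" "S \<noteq> {}" using * assms by (auto simp: S_def)
      then obtain r where r: "r \<in> S" "\<And>v. v \<in> S \<Longrightarrow> r $ 1 \<le> v $ 1"
        using ex_is_arg_min_if_finite[of S "\<lambda>q. q $ 1"] by (auto simp: is_arg_min_linorder)
      have "(c, p, r) \<in> upper_edges \<delta> A B"
        using * r by (force simp: upper_edges_def S_def)
      then show "i \<in> (\<lambda>(c, p, q). (c, p)) ` upper_edges \<delta> A B" unfolding i by force
    qed
  qed (use finE in simp)
  then have "card {i \<in> ?I. \<not> ?last i} \<le> card (upper_edges \<delta> A B)"
    using card_image_le[OF finE] order_trans by blast
  moreover have "?I = {i \<in> ?I. ?last i} \<union> {i \<in> ?I. \<not> ?last i}" by blast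
  then have "card ?I \<le> card {i \<in> ?I. ?last i} + card {i \<in> ?I. \<not> ?last i}"
    by (metis (no_types, lifting) card_Un_le)
  ultimately show ?thesis by linarith
qed

lemma card_upper_incidences:
  assumes "finite A" "finite B" "\<delta> > 0"
  shows "card {(c, p). c \<in> A \<and> p \<in> B \<and> upper \<delta> c p} \<le> 4 * (card A + card B) \<or>
    card {(c, p). c \<in> A \<and> p \<in> B \<and> upper \<delta> c p} ^ 3 \<le> 512 * card A ^ 2 * card B ^ 2"
proof -
  let ?I = "card {(c, p). c \<in> A \<and> p \<in> B \<and> upper \<delta> c p}" and ?e = "card (upper_edges \<delta> A B)"
  have I: "?I \<le> ?e + card A" by (rule card_upper_le[OF assms])
  \<comment> \<open>In the third case there are at most twice as many incidences as edges, and
    cubing turns 64 into 512.\<close>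
  consider "?e \<le> 4 * card B" | "?e \<le> card A" | "?e ^ 3 \<le> 64 * card B ^ 2 * card A ^ 2" "card A \<le> ?e"
    using card_upper_edges[OF assms] by linarith
  then show ?thesis
  proof cases
    case 3
    then have "?I ^ 3 \<le> (2 * ?e) ^ 3" using I by (intro power_mono) auto
    also have "\<dots> = 8 * ?e ^ 3" by (simp add: power_mult_distrib)
    also have "\<dots> \<le> 512 * card A ^ 2 * card B ^ 2" using 3 by (simp add: ac_simps)
    finally show ?thesis by simp
  next
    case 1
    show ?thesis by (rule disjI1) (use 1 I in simp)
  next
    case 2
    show ?thesis by (rule disjI1) (use 2 I in simp)
  qed
qed

theorem incidence_bound:
  assumes "finite A" "finite B" "\<delta> > 0"
  shows "inc \<delta> A B \<le> 8 * (card A + card B) \<or> inc \<delta> A B ^ 3 \<le> 4096 * card A ^ 2 * card B ^ 2"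
proof -
  \<comment> \<open>Reflection in the horizontal axis turns lower half circles into upper
    ones.\<close>
  define \<rho> where "\<rho> p = (vector [p $ 1, - (p $ 2)] :: point2)" for p :: point2
  have \<rho>1 [simp]: "\<rho> p $ 1 = p $ 1" "\<rho> p $ 2 = - (p $ 2)" for p by (simp_all add: \<rho>_def vector_2)
  have \<rho>\<rho> [simp]: "\<rho> (\<rho> p) = p" for p by (rule point2_eqI) auto
  have inj: "inj \<rho>" by (rule inj_on_inverseI[of _ \<rho>]) simp
  have \<rho>dist: "dist (\<rho> p) (\<rho> q) = dist p q" for p q
    unfolding dist_point2 by (simp add: power2_eq_square algebra_simps)
  let ?U = "\<lambda>A B. {(c, p). c \<in> A \<and> p \<in> B \<and> upper \<delta> c p}"
  let ?I = "{(a, b). a \<in> A \<and> b \<in> B \<and> dist a b = \<delta>}"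
  have fU: "finite (?U A B)" if "finite A" "finite B" for A B
    by (rule finite_subset[of _ "A \<times> B"]) (use that in auto)
  have "?I \<subseteq> ?U A B \<union> map_prod \<rho> \<rho> ` ?U (\<rho> ` A) (\<rho> ` B)"
  proof
    fix x assume "x \<in> ?I"
    then obtain a b where x: "x = (a, b)" and ab: "a \<in> A" "b \<in> B" "dist a b = \<delta>" by blast
    have "upper \<delta> a b \<or> upper \<delta> (\<rho> a) (\<rho> b)"
      using ab(3) \<rho>dist[of a b] by (auto simp: upper_def)
    then show "x \<in> ?U A B \<union> map_prod \<rho> \<rho> ` ?U (\<rho> ` A) (\<rho> ` B)"
      using ab image_eqI[of x "map_prod \<rho> \<rho>" "(\<rho> a, \<rho> b)"] by (auto simp: x)
  qed
  then have "card ?I \<le> card (?U A B \<union> map_prod \<rho> \<rho> ` ?U (\<rho> ` A) (\<rho> ` B))"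
    by (intro card_mono) (use fU assms in auto)
  also have "\<dots> \<le> card (?U A B) + card (map_prod \<rho> \<rho> ` ?U (\<rho> ` A) (\<rho> ` B))"
    by (rule card_Un_le)
  also have "\<dots> \<le> card (?U A B) + card (?U (\<rho> ` A) (\<rho> ` B))"
    by (intro add_left_mono card_image_le fU) (use assms in auto)
  finally have I: "inc \<delta> A B \<le> card (?U A B) + card (?U (\<rho> ` A) (\<rho> ` B))" by (simp add: inc_def)
  have cards: "card (\<rho> ` A) = card A" "card (\<rho> ` B) = card B"
    using inj by (auto intro!: card_image simp: inj_on_def)
  define M where "M = max (card (?U A B)) (card (?U (\<rho> ` A) (\<rho> ` B)))"
  have "M \<le> 4 * (card A + card B) \<or> M ^ 3 \<le> 512 * card A ^ 2 * card B ^ 2"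
    using card_upper_incidences[OF assms] card_upper_incidences[of "\<rho> ` A" "\<rho> ` B" \<delta>] assms
    unfolding cards M_def by (auto simp: max_def)
  moreover have IM: "inc \<delta> A B \<le> 2 * M" using I by (simp add: M_def)
  moreover have "inc \<delta> A B ^ 3 \<le> 8 * M ^ 3"
    using power_mono[OF IM, of 3] by (simp add: power_mult_distrib)
  ultimately show ?thesis by linarith
qed

section \<open>Chains and dyadic classes\<close>

lemma chains_subset_lists: "chains \<delta> k P \<subseteq> {ps. set ps \<subseteq> P \<and> length ps = Suc k}"
  by (auto simp: chains_def)

lemma finite_chains: "finite P \<Longrightarrow> finite (chains \<delta> k P)"
  using finite_subset[OF chains_subset_lists finite_lists_length_eq] .

lemma card_chains_le: "finite P \<Longrightarrow> card (chains \<delta> k P) \<le> card P ^ Suc k"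
  using card_mono[OF finite_lists_length_eq chains_subset_lists, of P \<delta> k] card_lists_length_eq[of P "Suc k"]
  by simp

definition ending :: "(nat \<Rightarrow> real) \<Rightarrow> point2 set \<Rightarrow> nat \<Rightarrow> point2 \<Rightarrow> nat" where
  "ending \<delta> P i q = card {ps \<in> chains \<delta> i P. last ps = q}"

lemma ending_le: "finite P \<Longrightarrow> ending \<delta> P i q \<le> card P ^ Suc i"
  unfolding ending_def
  by (rule order_trans[OF card_mono card_chains_le]) (auto simp: finite_chains)

lemma sum_ending:
  assumes "finite P" "finite Q"
  shows "(\<Sum>q\<in>Q. ending \<delta> P i q) = card {ps \<in> chains \<delta> i P. last ps \<in> Q}"
proof -
  have "card {ps \<in> chains \<delta> i P. last ps \<in> Q} = card (\<Union>q\<in>Q. {ps \<in> chains \<delta> i P. last ps = q})"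
    by (rule arg_cong[of _ _ card]) auto
  also have "\<dots> = (\<Sum>q\<in>Q. ending \<delta> P i q)"
    unfolding ending_def using assms by (intro card_UN_disjoint) (auto simp: finite_chains)
  finally show ?thesis by simp
qed

lemma last_chain_in: "ps \<in> chains \<delta> i P \<Longrightarrow> last ps \<in> P"
  using last_in_set[of ps] by (cases "ps = []") (auto simp: chains_def)

lemma last_chain: "ps \<in> chains \<delta> i P \<Longrightarrow> last ps = ps ! i"
  by (cases "ps = []") (auto simp: chains_def last_conv_nth)

lemma sum_ending_all:
  assumes "finite P"
  shows "(\<Sum>q\<in>P. ending \<delta> P i q) = card (chains \<delta> i P)"
proof -
  have "{ps \<in> chains \<delta> i P. last ps \<in> P} = chains \<delta> i P" using last_chain_in by blast
  then show ?thesis using sum_ending[OF assms assms, of \<delta> i] by simp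
qed

lemma take_chain: "ps \<in> chains \<delta> (i + m) P \<Longrightarrow> take (Suc i) ps \<in> chains \<delta> i P"
  by (auto simp: chains_def dest: in_set_takeD)

text \<open>A chain consists of its part up to index \<open>i\<close> and a tail that can be
  recovered from \<open>tag\<close>. The various counts of the same class below are different
  choices of \<open>tag\<close>.\<close>

lemma card_chains_tail:
  assumes "finite P" "finite T" "S \<subseteq> chains \<delta> (i + m) P"
    and tag: "\<And>ps. ps \<in> S \<Longrightarrow> tag ps \<in> T"
    and h: "\<And>ps. ps \<in> S \<Longrightarrow> h (tag ps) = ps ! i"
    and inj: "\<And>ps ps'. ps \<in> S \<Longrightarrow> ps' \<in> S \<Longrightarrow> tag ps = tag ps' \<Longrightarrow> drop (Suc i) ps = drop (Suc i) ps'"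
  shows "card S \<le> (\<Sum>t\<in>T. ending \<delta> P i (h t))"
proof -
  let ?C = "\<lambda>t. {ps \<in> chains \<delta> i P. last ps = h t}"
  have "card S \<le> card (SIGMA t:T. ?C t)"
  proof (rule card_inj_on_le[of "\<lambda>ps. (tag ps, take (Suc i) ps)"])
    show "inj_on (\<lambda>ps. (tag ps, take (Suc i) ps)) S"
    proof (rule inj_onI)
      fix ps ps' assume p: "ps \<in> S" "ps' \<in> S" "(tag ps, take (Suc i) ps) = (tag ps', take (Suc i) ps')"
      then have "drop (Suc i) ps = drop (Suc i) ps'" using inj by blast
      then show "ps = ps'" using p(3) by (metis append_take_drop_id prod.inject)
    qed
    show "(\<lambda>ps. (tag ps, take (Suc i) ps)) ` S \<subseteq> (SIGMA t:T. ?C t)"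
    proof (rule image_subsetI)
      fix ps assume ps: "ps \<in> S"
      then have c: "ps \<in> chains \<delta> (i + m) P" using assms by auto
      have "last (take (Suc i) ps) = ps ! i"
        using last_chain[OF take_chain[OF c]] by simp
      then show "(tag ps, take (Suc i) ps) \<in> (SIGMA t:T. ?C t)"
        using tag[OF ps] h[OF ps] take_chain[OF c] by simp
    qed
    show "finite (SIGMA t:T. ?C t)" using assms by (auto intro!: finite_SigmaI simp: finite_chains)
  qed
  also have "\<dots> = (\<Sum>t\<in>T. ending \<delta> P i (h t))"
    using assms by (simp add: ending_def finite_chains)
  finally show ?thesis .
qed

lemma card_common_neighbours:
  fixes a c :: point2
  assumes "a \<noteq> c" "s > 0" "t > 0"
  shows "card {b \<in> Z. dist a b = s \<and> dist b c = t} \<le> 2"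
proof (cases "{b \<in> Z. dist a b = s \<and> dist b c = t} = {}")
  case False
  let ?S = "{b \<in> Z. dist a b = s \<and> dist b c = t}"
  from False obtain b where b: "b \<in> ?S" by blast
  have uniq: "p = q" if "p \<in> ?S" "q \<in> ?S" "p \<noteq> b" "q \<noteq> b" for p q
  proof (rule point2_eqI)
    define d1 d2 where "d1 = c $ 1 - a $ 1" "d2 = c $ 2 - a $ 2"
    define w1 w2 where "w1 = b $ 1 - a $ 1" "w2 = b $ 2 - a $ 2"
    define D where "D = d1\<^sup>2 + d2\<^sup>2"
    define K where "K = w2 * d1 - w1 * d2"
    have "D > 0" unfolding D_def
      using assms(1) point2_eqI[of a c] by (auto simp: sum_power2_gt_zero_iff d1_d2_def)
    \<comment> \<open>A common point \<open>v\<close> other than \<open>b\<close> is the mirror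
      image of \<open>b\<close> in the line through \<open>a\<close> and \<open>c\<close>. Here
      \<open>K\<close> is twice the signed area of the triangle \<open>a\<close>, \<open>c\<close>,
      \<open>b\<close>.\<close>
    have key: "(v $ 1 - b $ 1) * D = 2 * d2 * K \<and> (v $ 2 - b $ 2) * D = - 2 * d1 * K" if v: "v \<in> ?S" "v \<noteq> b" for v
    proof -
      define u1 u2 where "u1 = v $ 1 - b $ 1" "u2 = v $ 2 - b $ 2"
      have e: "(a $ 1 - v $ 1)\<^sup>2 + (a $ 2 - v $ 2)\<^sup>2 = s\<^sup>2" "(v $ 1 - c $ 1)\<^sup>2 + (v $ 2 - c $ 2)\<^sup>2 = t\<^sup>2"
        "(a $ 1 - b $ 1)\<^sup>2 + (a $ 2 - b $ 2)\<^sup>2 = s\<^sup>2" "(b $ 1 - c $ 1)\<^sup>2 + (b $ 2 - c $ 2)\<^sup>2 = t\<^sup>2"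
        using v b assms dist_point2_eq_iff by auto
      have "2 * (u1 * d1 + u2 * d2) = 0" "u1\<^sup>2 + u2\<^sup>2 + 2 * (u1 * w1 + u2 * w2) = 0"
        using e unfolding u1_u2_def d1_d2_def w1_w2_def by (simp_all add: power2_eq_square algebra_simps)
      then have o: "u1 * d1 + u2 * d2 = 0" and q: "u1\<^sup>2 + u2\<^sup>2 + 2 * (u1 * w1 + u2 * w2) = 0" by simp_all
      define \<tau> where "\<tau> = u2 * d1 - u1 * d2"
      have "u1 * D = d1 * (u1 * d1 + u2 * d2) - d2 * \<tau>" "u2 * D = d2 * (u1 * d1 + u2 * d2) + d1 * \<tau>"
        "(u1\<^sup>2 + u2\<^sup>2) * D = (u1 * d1 + u2 * d2)\<^sup>2 + \<tau>\<^sup>2"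
        unfolding D_def \<tau>_def by (simp_all add: power2_eq_square algebra_simps)
      then have u: "u1 * D = - d2 * \<tau>" "u2 * D = d1 * \<tau>" and \<tau>2: "(u1\<^sup>2 + u2\<^sup>2) * D = \<tau>\<^sup>2"
        unfolding o by simp_all
      have "\<tau> \<noteq> 0"
      proof
        assume "\<tau> = 0"
        then have "u1 = 0" "u2 = 0" using u \<open>D > 0\<close> by auto
        then show False using v(2) point2_eqI[of v b] by (auto simp: u1_u2_def)
      qed
      have "0 = (u1\<^sup>2 + u2\<^sup>2) * D + 2 * ((u1 * D) * w1 + (u2 * D) * w2)"
        using arg_cong[OF q, of "\<lambda>x. x * D"] by (simp add: algebra_simps)
      also have "\<dots> = \<tau> * (\<tau> + 2 * K)"
        unfolding u \<tau>2 K_def by (simp add: power2_eq_square algebra_simps)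
      finally have "\<tau> = - 2 * K" using \<open>\<tau> \<noteq> 0\<close> by auto
      then show ?thesis using u unfolding u1_u2_def by simp
    qed
    have "(p $ 1 - b $ 1) * D = (q $ 1 - b $ 1) * D" "(p $ 2 - b $ 2) * D = (q $ 2 - b $ 2) * D"
      using key[OF that(1,3)] key[OF that(2,4)] by simp_all
    then show "p $ 1 = q $ 1" "p $ 2 = q $ 2" using \<open>D > 0\<close> by simp_all
  qed
  obtain b' where "?S \<subseteq> {b, b'}"
  proof (cases "?S \<subseteq> {b}")
    case False
    then obtain b' where "b' \<in> ?S" "b' \<noteq> b" by blast
    with uniq show thesis by (intro that[of b']) blast
  qed (use that[of b] in blast)
  then have "card ?S \<le> card {b, b'}" by (intro card_mono) auto
  also have "\<dots> \<le> 2" by (simp add: card_insert_if)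
  finally show ?thesis .
next
  case True
  then show ?thesis by (simp only: card.empty)
qed

text \<open>The point at index \<open>i + 1\<close> is a common neighbour of two distinct points,
  which leaves at most two choices for it.\<close>

lemma ending_add2_le:
  assumes "finite P" "\<And>j. \<delta> j > 0"
  shows "ending \<delta> P (i + 2) b \<le> 2 * (\<Sum>a\<in>P. ending \<delta> P i a)"
proof -
  let ?S = "{ps \<in> chains \<delta> (i + 2) P. last ps = b}"
  let ?N = "\<lambda>a. {p \<in> P. dist a p = \<delta> i \<and> dist p b = \<delta> (i + 1)}"
  let ?T = "SIGMA a:{a \<in> P. a \<noteq> b}. ?N a"
  have len: "length ps = i + 3" "last ps = ps ! (i + 2)" if "ps \<in> ?S" for ps
    using that last_chain[of ps] by (auto simp: chains_def)
  have "card ?S \<le> (\<Sum>t\<in>?T. ending \<delta> P i (fst t))"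
  proof (rule card_chains_tail[where m = 2 and tag = "\<lambda>ps. (ps ! i, ps ! (i + 1))"])
    fix ps assume ps: "ps \<in> ?S"
    then have "distinct ps" "set ps \<subseteq> P" "\<forall>j<i+2. dist (ps ! j) (ps ! Suc j) = \<delta> j" by (auto simp: chains_def)
    then show "(ps ! i, ps ! (i + 1)) \<in> ?T"
      using len[OF ps] ps nth_eq_iff_index_eq[of ps i "i + 2"] by auto
  next
    fix ps ps' assume ps: "ps \<in> ?S" "ps' \<in> ?S" "(ps ! i, ps ! (i + 1)) = (ps' ! i, ps' ! (i + 1))"
    have "drop (Suc i) qs = [qs ! (i + 1), b]" if "qs \<in> ?S" for qs
      using len[OF that] that by (simp add: Cons_nth_drop_Suc[symmetric])
    then show "drop (Suc i) ps = drop (Suc i) ps'" using ps by simp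
  qed (use assms in auto)
  also have "\<dots> = (\<Sum>(a, p)\<in>?T. ending \<delta> P i a)" by (simp add: split_def)
  also have "\<dots> = (\<Sum>a\<in>{a \<in> P. a \<noteq> b}. card (?N a) * ending \<delta> P i a)"
    using assms by (subst sum.Sigma[symmetric]) auto
  also have "\<dots> \<le> (\<Sum>a\<in>{a \<in> P. a \<noteq> b}. 2 * ending \<delta> P i a)"
    by (intro sum_mono mult_right_mono card_common_neighbours) (use assms in auto)
  also have "\<dots> \<le> (\<Sum>a\<in>P. 2 * ending \<delta> P i a)"
    by (rule sum_mono2) (use assms in auto)
  finally show ?thesis by (simp add: ending_def sum_distrib_left)
qed

section \<open>Points of large degree, and incidences in terms of unit distances\<close>

lemma inc_eq_sum:
  assumes "finite A" "finite B"
  shows "inc \<delta> A B = (\<Sum>b\<in>B. card {a \<in> A. dist a b = \<delta>})"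
proof -
  have "inc \<delta> A B = card ((\<lambda>(b, a). (a, b)) ` (SIGMA b:B. {a \<in> A. dist a b = \<delta>}))"
    unfolding inc_def by (rule arg_cong[of _ _ card]) auto
  also have "\<dots> = card (SIGMA b:B. {a \<in> A. dist a b = \<delta>})"
    by (rule card_image) (auto simp: inj_on_def)
  finally show ?thesis using assms by simp
qed

lemma inc_mono:
  assumes "finite A'" "finite B'" "A \<subseteq> A'" "B \<subseteq> B'"
  shows "inc \<delta> A B \<le> inc \<delta> A' B'"
  unfolding inc_def by (rule card_mono[OF finite_subset[of _ "A' \<times> B'"]]) (use assms in auto)

lemma rich_le_inc:
  assumes "finite A" "finite Z" "\<And>b. b \<in> Z \<Longrightarrow> d \<le> card {a \<in> A. dist a b = \<delta>}"
  shows "d * card Z \<le> inc \<delta> A Z"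
  using sum_mono[of Z "\<lambda>_. d" "\<lambda>b. card {a \<in> A. dist a b = \<delta>}"] assms
  by (simp add: inc_eq_sum ac_simps)

text \<open>The points of \<open>Z\<close> have degree at least \<open>d\<close>, so
  \<open>d * card Z\<close> is at most the number of incidences. When the linear term of the
  incidence bound is the relevant one, either \<open>card A\<close> or \<open>card Z\<close>
  dominates it; these are the last two alternatives.\<close>

lemma rich_bound:
  fixes A Z :: "point2 set"
  assumes "finite A" "finite Z" "\<delta> > 0" "Z \<noteq> {}" "\<And>b. b \<in> Z \<Longrightarrow> d \<le> card {a \<in> A. dist a b = \<delta>}"
  shows "d ^ 3 * card Z \<le> 4096 * card A ^ 2 \<or> d * card Z \<le> 16 * card A \<or> d \<le> 16"
proof -
  have z: "card Z > 0" using assms by (simp add: card_gt_0_iff)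
  have I: "d * card Z \<le> inc \<delta> A Z" by (rule rich_le_inc) (use assms in auto)
  from incidence_bound[OF assms(1,2,3)] show ?thesis
  proof
    assume "inc \<delta> A Z \<le> 8 * (card A + card Z)"
    with I have le: "d * card Z \<le> 8 * card A + 8 * card Z" by simp
    show ?thesis
    proof (cases "card Z \<le> card A")
      case False
      then have "d * card Z \<le> 16 * card Z" using le by linarith
      then have "d \<le> 16" using z by (subst (asm) mult_le_cancel2) auto
      then show ?thesis by blast
    qed (use le in simp)
  next
    assume "inc \<delta> A Z ^ 3 \<le> 4096 * card A ^ 2 * card Z ^ 2"
    then have "(d * card Z) ^ 3 \<le> 4096 * card A ^ 2 * card Z ^ 2"
      using power_mono[OF I, of 3] by linarith
    then have "card Z ^ 2 * (d ^ 3 * card Z) \<le> card Z ^ 2 * (4096 * card A ^ 2)"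
      by (simp add: power_mult_distrib power2_eq_square power3_eq_cube ac_simps)
    then show ?thesis using z by simp
  qed
qed

lemma finite_u2_values:
  "finite {card {{p, q} | p q. p \<in> P \<and> q \<in> P \<and> dist p q = 1} | P :: point2 set. finite P \<and> card P = n}"
proof (rule finite_subset)
  show "{card {{p, q} | p q. p \<in> P \<and> q \<in> P \<and> dist p q = 1} | P :: point2 set. finite P \<and> card P = n} \<subseteq> {..2 ^ n}"
  proof clarsimp
    fix P :: "point2 set" assume "finite P"
    then have "card {{p, q} | p q. p \<in> P \<and> q \<in> P \<and> dist p q = 1} \<le> card (Pow P)"
      by (intro card_mono) auto
    then show "card {{p, q} | p q. p \<in> P \<and> q \<in> P \<and> dist p q = 1} \<le> 2 ^ card P"
      using \<open>finite P\<close> by (simp add: card_Pow)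
  qed
qed simp

lemma card_unit_pairs_le_u2:
  "finite P \<Longrightarrow> card {{p, q} | p q. p \<in> P \<and> q \<in> P \<and> dist p q = 1} \<le> u2 (card P)" for P :: "point2 set"
  unfolding u2_def by (rule Max_ge[OF finite_u2_values]) auto

text \<open>Scaling by \<open>1 / \<delta>\<close> produces unit distances. The factor 2 passes from
  ordered to unordered pairs.\<close>

lemma inc_le_u2:
  assumes "finite P" "\<delta> > 0"
  shows "inc \<delta> P P \<le> 2 * u2 (card P)"
proof -
  define sc where "sc p = (1 / \<delta>) *\<^sub>R p" for p :: point2
  define I where "I = {(a, b). a \<in> P \<and> b \<in> P \<and> dist a b = \<delta>}"
  define U where "U = {{p, q} | p q. p \<in> sc ` P \<and> q \<in> sc ` P \<and> dist p q = 1}"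
  define f where "f x = {sc (fst x), sc (snd x)}" for x
  have inj: "sc p = sc q \<longleftrightarrow> p = q" for p q using assms by (simp add: sc_def)
  have P': "finite (sc ` P)" "card (sc ` P) = card P"
    using assms by (auto simp: card_image inj_on_def inj)
  have finU: "finite U" by (rule finite_subset[of _ "Pow (sc ` P)"]) (use P' in \<open>auto simp: U_def\<close>)
  have finI: "finite I" by (rule finite_subset[of _ "P \<times> P"]) (use assms in \<open>auto simp: I_def\<close>)
  have im: "f x \<in> U" if "x \<in> I" for x
  proof -
    have ab: "fst x \<in> P" "snd x \<in> P" "dist (fst x) (snd x) = \<delta>" using that by (auto simp: I_def)
    have "dist (sc (fst x)) (sc (snd x)) = 1"
      using ab(3) assms(2) by (simp add: dist_norm sc_def flip: scaleR_diff_right)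
    then show ?thesis using ab(1,2) unfolding U_def f_def by blast
  qed
  have "I \<subseteq> (\<Union>t\<in>U. {x \<in> I. f x = t})" using im by auto
  then have "card I \<le> card (\<Union>t\<in>U. {x \<in> I. f x = t})"
    by (intro card_mono) (use finU finI in auto)
  also have "\<dots> \<le> (\<Sum>t\<in>U. card {x \<in> I. f x = t})" by (rule card_UN_le[OF finU])
  also have "\<dots> \<le> (\<Sum>t\<in>U. 2)"
  proof (rule sum_mono)
    fix t
    show "card {x \<in> I. f x = t} \<le> 2"
    proof (cases "{x \<in> I. f x = t} = {}")
      case False
      then obtain x where x: "f x = t" by auto
      have "{x \<in> I. f x = t} \<subseteq> {x, prod.swap x}"
      proof
        fix y assume "y \<in> {x \<in> I. f x = t}"
        then have "{sc (fst y), sc (snd y)} = {sc (fst x), sc (snd x)}" using x by (simp add: f_def)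
        then show "y \<in> {x, prod.swap x}" unfolding doubleton_eq_iff inj by (auto simp: prod_eq_iff)
      qed
      then have "card {x \<in> I. f x = t} \<le> card {x, prod.swap x}" by (intro card_mono) auto
      also have "\<dots> \<le> 2" by (simp add: card_insert_if)
      finally show ?thesis .
    next
      case True
      then show ?thesis by (simp only: card.empty)
    qed
  qed
  also have "\<dots> \<le> 2 * u2 (card P)"
    using card_unit_pairs_le_u2[OF P'(1)] unfolding P'(2) U_def by simp
  finally show ?thesis by (simp add: inc_def I_def)
qed

section \<open>Dyadic classes of chains and their four counts\<close>

lemma pigeonhole_fibre:
  assumes "finite S" "S \<noteq> {}" "finite C" "\<And>s. s \<in> S \<Longrightarrow> code s \<in> C"
  obtains c where "c \<in> C" "{s \<in> S. code s = c} \<noteq> {}" "card S \<le> card C * card {s \<in> S. code s = c}"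
proof -
  have ne: "C \<noteq> {}" using assms by blast
  let ?f = "\<lambda>c. card {s \<in> S. code s = c}"
  obtain c where "c \<in> C" "?f c = Max (?f ` C)"
  proof -
    have "Max (?f ` C) \<in> ?f ` C" using assms(3) ne by (intro Max_in) auto
    then show thesis using that by force
  qed
  then have c: "c \<in> C" "\<And>c'. c' \<in> C \<Longrightarrow> ?f c' \<le> ?f c" using assms(3) by auto
  have "S = (\<Union>c\<in>C. {s \<in> S. code s = c})" using assms by blast
  then have "card S \<le> (\<Sum>c\<in>C. card {s \<in> S. code s = c})" using card_UN_le[OF assms(3)] by metis
  also have "\<dots> \<le> (\<Sum>c'\<in>C. card {s \<in> S. code s = c})" by (rule sum_mono) (rule c(2))
  finally have le: "card S \<le> card C * card {s \<in> S. code s = c}" by simp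
  moreover have "card S > 0" using assms by (simp add: card_gt_0_iff)
  ultimately have "card {s \<in> S. code s = c} \<noteq> 0" by (metis mult_0_right not_le)
  then have "{s \<in> S. code s = c} \<noteq> {}" by (metis card.empty)
  then show thesis using that c le by blast
qed

lemma floor_log_less_of_le_power:
  assumes "m \<le> n ^ j" "0 < m" "0 < j"
  shows "floor_log m < j * Suc (floor_log n)"
proof -
  have "0 < n" using assms by (cases n) (auto simp: power_0_left)
  have "2 ^ floor_log m \<le> m" using assms(2) by (rule floor_log_exp2_le)
  also have "\<dots> \<le> n ^ j" by (rule assms)
  also have "\<dots> < (2 * 2 ^ floor_log n) ^ j"
    using assms \<open>0 < n\<close> by (intro power_strict_mono floor_log_exp2_gt) auto
  also have "\<dots> = 2 ^ (j * Suc (floor_log n))" by (simp flip: power_Suc power_mult add: mult.commute)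
  finally show ?thesis by simp
qed

lemma finite_card_Sigma_le:
  assumes "finite A \<and> card A \<le> m" "\<And>a. a \<in> A \<Longrightarrow> finite (B a) \<and> card (B a) \<le> k"
  shows "finite (Sigma A B) \<and> card (Sigma A B) \<le> m * k"
proof
  show "finite (Sigma A B)" using assms by (intro finite_SigmaI) auto
  have "card (Sigma A B) = (\<Sum>a\<in>A. card (B a))" using assms by (intro card_SigmaI) auto
  also have "\<dots> \<le> card A * k" using sum_bounded_above[of A "\<lambda>a. card (B a)" k] assms(2) by simp
  also have "\<dots> \<le> m * k" using assms(1) by simp
  finally show "card (Sigma A B) \<le> m * k" .
qed

lemma sum_le_card_mult: "(\<And>t. t \<in> T \<Longrightarrow> f t \<le> k) \<Longrightarrow> sum f T \<le> card T * k" for k :: nat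
  using sum_bounded_above[of T f k] by simp

lemma floor_log_class:
  assumes "0 < m" "floor_log m = t"
  shows "2 ^ t \<le> m" "m \<le> 2 * 2 ^ t"
  using floor_log_exp2_le[OF assms(1)] floor_log_exp2_gt[of m] assms by auto

lemma chain_nth:
  assumes "ps \<in> chains \<delta> k P"
  shows "j \<le> k \<Longrightarrow> ps ! j \<in> P" "j < k \<Longrightarrow> dist (ps ! j) (ps ! (j + 1)) = \<delta> j"
    "j \<le> k \<Longrightarrow> j' \<le> k \<Longrightarrow> j \<noteq> j' \<Longrightarrow> ps ! j \<noteq> ps ! j'" "length ps = Suc k"
  using assms by (auto simp: chains_def nth_eq_iff_index_eq)

lemma ending_pos:
  assumes "finite P" "ps \<in> chains \<delta> (i + m) P"
  shows "0 < ending \<delta> P i (ps ! i)"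
proof -
  have c: "take (Suc i) ps \<in> chains \<delta> i P" by (rule take_chain[OF assms(2)])
  then have "take (Suc i) ps \<in> {qs \<in> chains \<delta> i P. last qs = ps ! i}"
    using last_chain[OF c] by simp
  moreover have "finite {qs \<in> chains \<delta> i P. last qs = ps ! i}"
    using finite_chains[OF assms(1)] by simp
  ultimately show ?thesis unfolding ending_def by (subst card_gt_0_iff) blast
qed

lemma card_chains_tail_le:
  assumes "finite P" "S \<subseteq> chains \<delta> (i + m) P" "finite T \<and> card T \<le> k"
    and "\<And>ps. ps \<in> S \<Longrightarrow> tag ps \<in> T" "\<And>ps. ps \<in> S \<Longrightarrow> h (tag ps) = ps ! i"
    and "\<And>ps ps'. ps \<in> S \<Longrightarrow> ps' \<in> S \<Longrightarrow> tag ps = tag ps' \<Longrightarrow> drop (Suc i) ps = drop (Suc i) ps'"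
    and "\<And>t. t \<in> T \<Longrightarrow> ending \<delta> P i (h t) \<le> l"
  shows "card S \<le> k * l"
proof -
  have "card S \<le> (\<Sum>t\<in>T. ending \<delta> P i (h t))"
    by (rule card_chains_tail[OF assms(1) conjunct1[OF assms(3)] assms(2,4,5,6)])
  also have "\<dots> \<le> card T * l" by (rule sum_le_card_mult) (rule assms(7))
  also have "\<dots> \<le> k * l" using assms(3) by simp
  finally show ?thesis .
qed

text \<open>One dyadic class of the chains \<open>\<dots>, a, b, c, \<dots>\<close> in \<open>S\<close>, whose last point lies in \<open>D c\<close>. The class
  fixes, up to a factor two, the number \<open>r\<close> of chains ending in \<open>a\<close>, the size \<open>s\<close> of \<open>D c\<close>,
  and the numbers \<open>d\<close>, \<open>e\<close> of neighbours of \<open>b\<close> among the possible \<open>a\<close> and \<open>c\<close>.\<close>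
lemma dyadic_chain_class:
  fixes P :: "point2 set"
  assumes P: "finite P" and \<delta>: "\<And>j. \<delta> j > 0" and H: "\<And>b. ending \<delta> P (i + 1) b \<le> H"
    and S_sub: "S \<subseteq> chains \<delta> (i + m) P" and m: "2 \<le> m" and ne: "S \<noteq> {}"
    and D: "\<And>c. finite (D c)" "\<And>c. card (D c) \<le> card P"
    and lastD: "\<And>ps. ps \<in> S \<Longrightarrow> last ps \<in> D (ps ! (i + 2)) \<and> last ps \<noteq> ps ! (i + 1)"
    and det: "\<And>ps ps'. ps \<in> S \<Longrightarrow> ps' \<in> S \<Longrightarrow> last ps = last ps' \<Longrightarrow> ps ! (i + 2) = ps' ! (i + 2) \<Longrightarrow>
      drop (i + 2) ps = drop (i + 2) ps'"
    and w: "\<And>b. card (SIGMA c:{c \<in> P. dist b c = \<delta> (i + 1)}. {q \<in> D c. q \<noteq> b}) \<le> w"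
  obtains X Y z r s d e N where
    "X \<subseteq> P" "X \<noteq> {}" "Y \<subseteq> P" "Y \<noteq> {}" "0 < z" "z \<le> card P" "0 < r" "0 < s" "0 < d" "0 < e" "0 < N"
    "card S \<le> (i + 1) * Suc (floor_log (card P)) ^ 4 * N" "\<forall>c\<in>Y. s \<le> card (D c)"
    "N \<le> 16 * (r * s * z * d * e)" "N \<le> 8 * (r * s * card X * card Y)" "N \<le> 4 * (r * z * d * w)"
    "N \<le> 4 * (H * z * e * s)"
    "r * card X \<le> (\<Sum>a\<in>X. ending \<delta> P i a)"
    "d ^ 3 * z \<le> 4096 * card X ^ 2 \<or> d * z \<le> 16 * card X \<or> d \<le> 16"
    "e ^ 3 * z \<le> 4096 * card Y ^ 2 \<or> e * z \<le> 16 * card Y \<or> e \<le> 16"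
    "d * z \<le> 2 * u2 (card P)" "e * z \<le> 2 * u2 (card P)"
proof -
  define F where "F = ending \<delta> P i"
  \<comment> \<open>Zero is excluded since \<open>floor_log 0 = 0\<close> would put it into the
    class of 1.\<close>
  define X where "X t = {a \<in> P. 0 < F a \<and> floor_log (F a) = t}" for t
  define Y where "Y t = {c \<in> P. 0 < card (D c) \<and> floor_log (card (D c)) = t}" for t
  define A where "A t b = {a \<in> X t. dist a b = \<delta> i}" for t b
  define C where "C t b = {c \<in> Y t. dist b c = \<delta> (i + 1)}" for t b
  define cr where "cr ps = floor_log (F (ps ! i))" for ps
  define cs where "cs ps = floor_log (card (D (ps ! (i + 2))))" for ps
  define code where "code ps = (cr ps, cs ps, floor_log (card (A (cr ps) (ps ! (i + 1)))),
     floor_log (card (C (cs ps) (ps ! (i + 1)))))" for ps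
  let ?L = "Suc (floor_log (card P))"
  \<comment> \<open>The first range is longer by the factor \<open>i + 1\<close> because as many as
    \<open>card P ^ (i + 1)\<close> chains may end in a point. The size of this set is the price of
    passing to a single class.\<close>
  let ?codes = "{..<(i + 1) * ?L} \<times> {..<?L} \<times> {..<?L} \<times> {..<?L}"
  have fin: "finite (X t)" "finite (Y t)" "finite (A t b)" "finite (C t b)" for t b
    using P by (auto simp: X_def Y_def A_def C_def)
  have le: "card (A t b) \<le> card P" "card (C t b) \<le> card P" for t b
    using P by (auto intro!: card_mono simp: X_def Y_def A_def C_def)
  have finS: "finite S" using finite_chains[OF P] S_sub finite_subset by blast
  have S: "ps ! i \<in> X (cr ps)" "ps ! (i + 1) \<in> P" "ps ! (i + 2) \<in> Y (cs ps)"
      "ps ! i \<in> A (cr ps) (ps ! (i + 1))" "ps ! (i + 2) \<in> C (cs ps) (ps ! (i + 1))" "ps ! i \<noteq> ps ! (i + 2)"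
      "drop (Suc i) ps = ps ! (i + 1) # drop (i + 2) ps"
      "dist (ps ! i) (ps ! (i + 1)) = \<delta> i" "dist (ps ! (i + 1)) (ps ! (i + 2)) = \<delta> (i + 1)" if "ps \<in> S" for ps
  proof -
    have c: "ps \<in> chains \<delta> (i + m) P" using that S_sub by blast
    show "ps ! (i + 1) \<in> P" and "ps ! i \<noteq> ps ! (i + 2)" using chain_nth[OF c] m by auto
    show d: "dist (ps ! i) (ps ! (i + 1)) = \<delta> i" "dist (ps ! (i + 1)) (ps ! (i + 2)) = \<delta> (i + 1)"
      using chain_nth(2)[OF c, of i] chain_nth(2)[OF c, of "i + 1"] m by simp_all
    show a: "ps ! i \<in> X (cr ps)"
      using chain_nth(1)[OF c, of i] ending_pos[OF P c] by (simp add: X_def F_def cr_def)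
    have "0 < card (D (ps ! (i + 2)))" using lastD[OF that] D(1) by (auto simp: card_gt_0_iff)
    then show y: "ps ! (i + 2) \<in> Y (cs ps)" using chain_nth(1)[OF c, of "i + 2"] m by (simp add: Y_def cs_def)
    show "ps ! i \<in> A (cr ps) (ps ! (i + 1))" "ps ! (i + 2) \<in> C (cs ps) (ps ! (i + 1))"
      using a y d by (simp_all add: A_def C_def)
    show "drop (Suc i) ps = ps ! (i + 1) # drop (i + 2) ps"
      using chain_nth(4)[OF c] m by (simp add: Cons_nth_drop_Suc)
  qed
  have pos: "0 < card (A (cr ps) (ps ! (i + 1)))" "0 < card (C (cs ps) (ps ! (i + 1)))" if "ps \<in> S" for ps
    using S(4,5)[OF that] fin by (auto simp: card_gt_0_iff)
  have codes: "code ps \<in> ?codes" if "ps \<in> S" for ps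
  proof -
    have "floor_log (F (ps ! i)) < (i + 1) * ?L"
      using floor_log_less_of_le_power[of "F (ps ! i)" "card P" "i + 1"] ending_le[OF P, of \<delta> i "ps ! i"] S(1)[OF that]
      by (simp add: F_def X_def)
    moreover have "floor_log k < ?L" if "k \<le> card P" for k
      using floor_log_mono[THEN monoD, OF that] by simp
    ultimately show ?thesis using le D(2) by (simp add: code_def cr_def cs_def)
  qed
  have "finite ?codes" by simp
  obtain c where c: "{ps \<in> S. code ps = c} \<noteq> {}" "card S \<le> card ?codes * card {ps \<in> S. code ps = c}"
    by (rule pigeonhole_fibre[OF finS ne \<open>finite ?codes\<close> codes])
  obtain t1 t2 t3 t4 where ct: "c = (t1, t2, t3, t4)" by (cases c)
  define S' where "S' = {ps \<in> S. code ps = c}"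
  define N where "N = card S'"
  define Z where "Z = {b \<in> P. 0 < card (A t1 b) \<and> floor_log (card (A t1 b)) = t3 \<and> 0 < card (C t2 b) \<and> floor_log (card (C t2 b)) = t4}"
  define r s d e where "r = (2::nat) ^ t1" "s = (2::nat) ^ t2" "d = (2::nat) ^ t3" "e = (2::nat) ^ t4"
  have S'S: "S' \<subseteq> S" by (auto simp: S'_def)
  then have S'c: "S' \<subseteq> chains \<delta> (i + m) P" "S' \<subseteq> chains \<delta> ((i + 1) + (m - 1)) P" using S_sub m by auto
  have S': "ps ! i \<in> X t1" "ps ! (i + 2) \<in> Y t2" "ps ! (i + 1) \<in> Z" "ps ! i \<in> A t1 (ps ! (i + 1))"
      "ps ! (i + 2) \<in> C t2 (ps ! (i + 1))" if "ps \<in> S'" for ps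
  proof -
    have ps: "ps \<in> S" "code ps = (t1, t2, t3, t4)" using that by (auto simp: S'_def ct)
    show "ps ! i \<in> X t1" "ps ! (i + 2) \<in> Y t2" "ps ! i \<in> A t1 (ps ! (i + 1))"
      "ps ! (i + 2) \<in> C t2 (ps ! (i + 1))"
      using S[OF ps(1)] ps(2) by (auto simp: code_def)
    show "ps ! (i + 1) \<in> Z" using S(2)[OF ps(1)] pos[OF ps(1)] ps(2) by (auto simp: code_def Z_def)
  qed
  have finZ: "finite Z" using P by (simp add: Z_def)
  have bA: "d \<le> card (A t1 b)" "finite (A t1 b) \<and> card (A t1 b) \<le> 2 * d" if "b \<in> Z" for b
    using that floor_log_class[of "card (A t1 b)" t3] fin by (auto simp: Z_def r_s_d_e_def)
  have bC: "e \<le> card (C t2 b)" "finite (C t2 b) \<and> card (C t2 b) \<le> 2 * e" if "b \<in> Z" for b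
    using that floor_log_class[of "card (C t2 b)" t4] fin by (auto simp: Z_def r_s_d_e_def)
  have bD: "s \<le> card (D c)" "finite (D c) \<and> card (D c) \<le> 2 * s" if "c \<in> Y t2" for c
    using that floor_log_class[of "card (D c)" t2] D(1) by (auto simp: Y_def r_s_d_e_def)
  have bF: "r \<le> F a" "F a \<le> 2 * r" if "a \<in> X t1" for a
    using that floor_log_class[of "F a" t1] by (auto simp: X_def r_s_d_e_def)
  have CY: "finite (D c) \<and> card (D c) \<le> 2 * s" if "c \<in> C t2 b" for b c using that bD(2) by (simp add: C_def)
  have AF: "ending \<delta> P i a \<le> 2 * r" if "a \<in> A t1 b" for a b using that bF(2) by (simp add: A_def F_def)
  have drop: "drop (Suc i) ps = drop (Suc i) ps'"
    if "ps \<in> S'" "ps' \<in> S'" "ps ! (i + 1) = ps' ! (i + 1)" "ps ! (i + 2) = ps' ! (i + 2)" "last ps = last ps'" for ps ps'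
  proof -
    have "ps \<in> S" "ps' \<in> S" using that S'S by auto
    then show ?thesis using S(7) that det by metis
  qed
  have drop': "drop (Suc (i + 1)) ps = drop (Suc (i + 1)) ps'"
    if "ps \<in> S'" "ps' \<in> S'" "ps ! (i + 2) = ps' ! (i + 2)" "last ps = last ps'" for ps ps'
    using det[of ps ps'] that S'S by auto
  have ZZ: "finite Z \<and> card Z \<le> card Z" using finZ by simp
  \<comment> \<open>First count: choose \<open>b\<close>, and then \<open>a\<close>,
    \<open>c\<close> and the end point independently within their classes.\<close>
  have "N \<le> (card Z * ((2 * d) * ((2 * e) * (2 * s)))) * (2 * r)" unfolding N_def
  proof (rule card_chains_tail_le[OF P S'c(1)])
    show "finite (SIGMA b:Z. SIGMA a:A t1 b. SIGMA c:C t2 b. D c) \<and>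
      card (SIGMA b:Z. SIGMA a:A t1 b. SIGMA c:C t2 b. D c) \<le> card Z * ((2 * d) * ((2 * e) * (2 * s)))"
      by (intro finite_card_Sigma_le ZZ bA(2) bC(2) CY)
    show "(ps ! (i + 1), ps ! i, ps ! (i + 2), last ps) \<in> (SIGMA b:Z. SIGMA a:A t1 b. SIGMA c:C t2 b. D c)" if "ps \<in> S'" for ps
      using S'[OF that] lastD[of ps] that S'S by auto
    show "ending \<delta> P i (fst (snd x)) \<le> 2 * r" if "x \<in> (SIGMA b:Z. SIGMA a:A t1 b. SIGMA c:C t2 b. D c)" for x
      using that AF by auto
    show "drop (Suc i) ps = drop (Suc i) ps'" if p: "ps \<in> S'" "ps' \<in> S'" "(ps ! (i + 1), ps ! i, ps ! (i + 2), last ps) = (ps' ! (i + 1), ps' ! i, ps' ! (i + 2), last ps')" for ps ps'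
      using p(3) by (intro drop[OF p(1,2)]) simp_all
  qed simp
  then have N1: "N \<le> 16 * (r * s * card Z * d * e)" by (simp add: ac_simps)
  let ?B = "\<lambda>a c. {b \<in> P. dist a b = \<delta> i \<and> dist b c = \<delta> (i + 1)}"
  let ?T2 = "SIGMA a:X t1. SIGMA c:{c \<in> Y t2. c \<noteq> a}. SIGMA b:?B a c. D c"
  \<comment> \<open>Second count: choose \<open>a\<close> and \<open>c\<close>, which leave two
    possibilities for \<open>b\<close>.\<close>
  have "N \<le> (card (X t1) * (card (Y t2) * (2 * (2 * s)))) * (2 * r)" unfolding N_def
  proof (rule card_chains_tail_le[OF P S'c(1)])
    have "finite {c \<in> Y t2. c \<noteq> a} \<and> card {c \<in> Y t2. c \<noteq> a} \<le> card (Y t2)" for a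
      using fin by (auto intro: card_mono)
    moreover have "finite (?B a c) \<and> card (?B a c) \<le> 2" if "c \<in> {c \<in> Y t2. c \<noteq> a}" for a c
      using P that by (intro conjI card_common_neighbours \<delta>) auto
    ultimately show "finite ?T2 \<and> card ?T2 \<le> card (X t1) * (card (Y t2) * (2 * (2 * s)))"
      using fin bD(2) by (intro finite_card_Sigma_le) auto
    show "(ps ! i, ps ! (i + 2), ps ! (i + 1), last ps) \<in> ?T2" if "ps \<in> S'" for ps
    proof -
      have "ps \<in> S" using that S'S by auto
      then show ?thesis using S'(1,2)[OF that] S(2,6,8,9)[of ps] lastD[of ps] by auto
    qed
    show "ending \<delta> P i (fst x) \<le> 2 * r" if "x \<in> ?T2" for x using that bF(2) by (auto simp: F_def)
    show "drop (Suc i) ps = drop (Suc i) ps'" if p: "ps \<in> S'" "ps' \<in> S'" "(ps ! i, ps ! (i + 2), ps ! (i + 1), last ps) = (ps' ! i, ps' ! (i + 2), ps' ! (i + 1), last ps')" for ps ps'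
      using p(3) by (intro drop[OF p(1,2)]) simp_all
  qed simp
  then have N2: "N \<le> 8 * (r * s * card (X t1) * card (Y t2))" by (simp add: ac_simps)
  let ?U = "\<lambda>b. SIGMA c:{c \<in> P. dist b c = \<delta> (i + 1)}. {q \<in> D c. q \<noteq> b}"
  \<comment> \<open>Third count: choose \<open>b\<close> and \<open>a\<close>, and take
    \<open>c\<close> and the end point together as one of at most \<open>w\<close> pairs.\<close>
  have "N \<le> (card Z * ((2 * d) * w)) * (2 * r)" unfolding N_def
  proof (rule card_chains_tail_le[OF P S'c(1)])
    have "finite (?U b) \<and> card (?U b) \<le> w" for b using w[of b] P D(1) by (auto intro!: finite_SigmaI)
    then show "finite (SIGMA b:Z. SIGMA a:A t1 b. ?U b) \<and> card (SIGMA b:Z. SIGMA a:A t1 b. ?U b) \<le> card Z * ((2 * d) * w)"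
      by (intro finite_card_Sigma_le ZZ bA(2))
    show "(ps ! (i + 1), ps ! i, ps ! (i + 2), last ps) \<in> (SIGMA b:Z. SIGMA a:A t1 b. ?U b)" if "ps \<in> S'" for ps
    proof -
      have "ps \<in> S" "ps ! (i + 2) \<in> P" using that S'S S'(2) by (auto simp: Y_def)
      then show ?thesis using S'(3,4)[OF that] S(9)[of ps] lastD[of ps] by auto
    qed
    show "ending \<delta> P i (fst (snd x)) \<le> 2 * r" if "x \<in> (SIGMA b:Z. SIGMA a:A t1 b. ?U b)" for x
      using that AF by auto
    show "drop (Suc i) ps = drop (Suc i) ps'" if p: "ps \<in> S'" "ps' \<in> S'" "(ps ! (i + 1), ps ! i, ps ! (i + 2), last ps) = (ps' ! (i + 1), ps' ! i, ps' ! (i + 2), last ps')" for ps ps'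
      using p(3) by (intro drop[OF p(1,2)]) simp_all
  qed simp
  then have N3: "N \<le> 4 * (r * card Z * d * w)" by (simp add: ac_simps)
  \<comment> \<open>Fourth count: the part up to \<open>b\<close> is not split any further, since at
    most \<open>H\<close> chains end in \<open>b\<close>.\<close>
  have "N \<le> (card Z * ((2 * e) * (2 * s))) * H" unfolding N_def
  proof (rule card_chains_tail_le[OF P S'c(2), where h = fst])
    show "finite (SIGMA b:Z. SIGMA c:C t2 b. D c) \<and> card (SIGMA b:Z. SIGMA c:C t2 b. D c) \<le> card Z * ((2 * e) * (2 * s))"
      by (intro finite_card_Sigma_le ZZ bC(2) CY)
    show "(ps ! (i + 1), ps ! (i + 2), last ps) \<in> (SIGMA b:Z. SIGMA c:C t2 b. D c)" if "ps \<in> S'" for ps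
      using S'[OF that] lastD[of ps] that S'S by auto
    show "ending \<delta> P (i + 1) (fst x) \<le> H" for x by (rule H)
    show "drop (Suc (i + 1)) ps = drop (Suc (i + 1)) ps'" if p: "ps \<in> S'" "ps' \<in> S'" "(ps ! (i + 1), ps ! (i + 2), last ps) = (ps' ! (i + 1), ps' ! (i + 2), last ps')" for ps ps'
      using p(3) by (intro drop'[OF p(1,2)]) simp_all
  qed simp
  then have N4: "N \<le> 4 * (H * card Z * e * s)" by (simp add: ac_simps)
  obtain ps where "ps \<in> S'" using c by (auto simp: S'_def)
  then have neX: "X t1 \<noteq> {}" "Y t2 \<noteq> {}" "Z \<noteq> {}" using S' by blast+
  have sub: "X t1 \<subseteq> P" "Y t2 \<subseteq> P" "Z \<subseteq> P" by (auto simp: X_def Y_def Z_def)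
  have inc_le: "inc (\<delta> j) B B' \<le> 2 * u2 (card P)" if "B \<subseteq> P" "B' \<subseteq> P" for j B B'
    using inc_mono[OF P P that] inc_le_u2[OF P \<delta>] order_trans by blast
  have rd: "d \<le> card {a \<in> X t1. dist a b = \<delta> i}" if "b \<in> Z" for b using bA(1)[OF that] by (simp add: A_def)
  have re: "e \<le> card {c \<in> Y t2. dist c b = \<delta> (i + 1)}" if "b \<in> Z" for b
    using bC(1)[OF that] by (simp add: C_def dist_commute)
  show thesis
  proof (rule that[of "X t1" "Y t2" "card Z" r s d e N])
    show "card S \<le> (i + 1) * ?L ^ 4 * N"
      using c(2) unfolding N_def S'_def card_cartesian_product card_lessThan power4_eq_xxxx
      by (simp only: mult.assoc)
    show "r * card (X t1) \<le> (\<Sum>a\<in>X t1. ending \<delta> P i a)"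
      using sum_bounded_below[of "X t1" r F] bF(1) by (simp add: F_def ac_simps)
    show "0 < N" using c finS by (auto simp: N_def S'_def card_gt_0_iff)
    show "d * card Z \<le> 2 * u2 (card P)"
      using rich_le_inc[OF fin(1) finZ rd] inc_le[OF sub(1,3)] order_trans by blast
    show "e * card Z \<le> 2 * u2 (card P)"
      using rich_le_inc[OF fin(2) finZ re] inc_le[OF sub(2,3)] order_trans by blast
    show "0 < card Z" using neX finZ by (simp add: card_gt_0_iff)
    show "card Z \<le> card P" using sub P by (simp add: card_mono)
    show "0 < r" "0 < s" "0 < d" "0 < e" by (simp_all add: r_s_d_e_def)
    show "\<forall>c\<in>Y t2. s \<le> card (D c)" using bD(1) by blast
    show "d ^ 3 * card Z \<le> 4096 * (card (X t1))\<^sup>2 \<or> d * card Z \<le> 16 * card (X t1) \<or> d \<le> 16"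
      by (rule rich_bound[OF fin(1) finZ \<delta>[of i] neX(3)]) (rule rd)
    show "e ^ 3 * card Z \<le> 4096 * (card (Y t2))\<^sup>2 \<or> e * card Z \<le> 16 * card (Y t2) \<or> e \<le> 16"
      by (rule rich_bound[OF fin(2) finZ \<delta>[of "i + 1"] neX(3)]) (rule re)
  qed (fact N1 N2 N3 N4 sub neX)+
qed

text \<open>With \<open>D c = {c}\<close> and \<open>m = 2\<close> the end point is \<open>c\<close>
  itself, so that \<open>s = 1\<close>. The class \<open>Y\<close> is then replaced by the larger
  set \<open>P\<close>.\<close>

lemma three_point_class:
  fixes P :: "point2 set"
  assumes P: "finite P" and \<delta>: "\<And>j. \<delta> j > 0" and H: "\<And>b. ending \<delta> P (i + 1) b \<le> H"
    and ne: "chains \<delta> (i + 2) P \<noteq> {}"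
  obtains X z r d e N where
    "X \<subseteq> P" "X \<noteq> {}" "0 < z" "z \<le> card P" "0 < r" "0 < d" "0 < e" "0 < N"
    "card (chains \<delta> (i + 2) P) \<le> (i + 1) * Suc (floor_log (card P)) ^ 4 * N"
    "N \<le> 16 * (r * z * d * e)" "N \<le> 8 * (r * card X * card P)" "N \<le> 4 * (H * z * e)"
    "r * card X \<le> (\<Sum>a\<in>X. ending \<delta> P i a)"
    "d ^ 3 * z \<le> 4096 * card X ^ 2 \<or> d * z \<le> 16 * card X \<or> d \<le> 16"
    "e ^ 3 * z \<le> 4096 * card P ^ 2 \<or> e * z \<le> 16 * card P \<or> e \<le> 16"
proof -
  have P0: "1 \<le> card P"
    using ne P chain_nth(1)[of _ \<delta> "i + 2" P 0] by (auto simp: Suc_le_eq card_gt_0_iff)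
  have w: "card (SIGMA c:{c \<in> P. dist b c = \<delta> (i + 1)}. {q \<in> {c}. q \<noteq> b}) \<le> card P * 1" for b
  proof -
    have f: "finite {c \<in> P. dist b c = \<delta> (i + 1)} \<and> card {c \<in> P. dist b c = \<delta> (i + 1)} \<le> card P"
      using P by (auto intro: card_mono)
    have g: "finite {q \<in> {c}. q \<noteq> b} \<and> card {q \<in> {c}. q \<noteq> b} \<le> 1" for c
      using card_mono[of "{c}" "{q \<in> {c}. q \<noteq> b}"] by auto
    show ?thesis by (rule conjunct2, rule finite_card_Sigma_le[OF f]) (rule g)
  qed
  have D: "finite {c}" "card {c} \<le> card P" for c :: point2 using P0 by auto
  have lst: "last ps \<in> {ps ! (i + 2)} \<and> last ps \<noteq> ps ! (i + 1)" if "ps \<in> chains \<delta> (i + 2) P" for ps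
    using last_chain[OF that] chain_nth(3)[OF that, of "i + 2" "i + 1"] by auto
  have "drop (i + 2) ps = [ps ! (i + 2)]" if "ps \<in> chains \<delta> (i + 2) P" for ps
    using chain_nth(4)[OF that] by (simp add: Cons_nth_drop_Suc[symmetric])
  then have dr: "drop (i + 2) ps = drop (i + 2) ps'"
    if "ps \<in> chains \<delta> (i + 2) P" "ps' \<in> chains \<delta> (i + 2) P" "last ps = last ps'" "ps ! (i + 2) = ps' ! (i + 2)" for ps ps'
    using that by metis
  obtain X Y z r s d e N where C:
    "X \<subseteq> P" "X \<noteq> {}" "Y \<subseteq> P" "Y \<noteq> {}" "0 < z" "z \<le> card P" "0 < r" "0 < s" "0 < d" "0 < e" "0 < N"
    "card (chains \<delta> (i + 2) P) \<le> (i + 1) * Suc (floor_log (card P)) ^ 4 * N" "\<forall>c\<in>Y. s \<le> card {c}"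
    "N \<le> 16 * (r * s * z * d * e)" "N \<le> 8 * (r * s * card X * card Y)" "N \<le> 4 * (r * z * d * (card P * 1))"
    "N \<le> 4 * (H * z * e * s)" "r * card X \<le> (\<Sum>a\<in>X. ending \<delta> P i a)"
    "d ^ 3 * z \<le> 4096 * card X ^ 2 \<or> d * z \<le> 16 * card X \<or> d \<le> 16"
    "e ^ 3 * z \<le> 4096 * card Y ^ 2 \<or> e * z \<le> 16 * card Y \<or> e \<le> 16"
    by (rule dyadic_chain_class[where D = "\<lambda>c. {c}", OF P \<delta> H order_refl order_refl ne D lst dr w])
  have "s = 1" using C(4,8,13) by force
  have Y: "card Y \<le> card P" by (rule card_mono[OF P C(3)])
  show thesis
  proof (rule that[of X z r d e N])
    show "N \<le> 16 * (r * z * d * e)" "N \<le> 4 * (H * z * e)" using C(14,17) \<open>s = 1\<close> by simp_all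
    have "N \<le> 8 * (r * card X * card Y)" using C(15) \<open>s = 1\<close> by simp
    also have "\<dots> \<le> 8 * (r * card X * card P)" using Y by (intro mult_le_mono2)
    finally show "N \<le> 8 * (r * card X * card P)" .
    have "4096 * (card Y)\<^sup>2 \<le> 4096 * (card P)\<^sup>2" "16 * card Y \<le> 16 * card P" using Y by (simp_all add: power_mono)
    then show "e ^ 3 * z \<le> 4096 * (card P)\<^sup>2 \<or> e * z \<le> 16 * card P \<or> e \<le> 16" using C(20) by linarith
  qed (fact C)+
qed

text \<open>Here \<open>D c\<close> consists of the neighbours of \<open>c\<close> in
  \<open>Q\<close>. A point \<open>b\<close> and an end point \<open>q\<close> have at most two
  common neighbours \<open>c\<close>, so \<open>w\<close> becomes \<open>2 * card Q\<close>.\<close>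

lemma four_point_class:
  fixes P :: "point2 set"
  assumes P: "finite P" and \<delta>: "\<And>j. \<delta> j > 0" and Q: "Q \<subseteq> P" and H: "\<And>b. ending \<delta> P (i + 1) b \<le> H"
    and ne: "{ps \<in> chains \<delta> (i + 3) P. last ps \<in> Q} \<noteq> {}"
  obtains X y z r s d e N where
    "X \<subseteq> P" "X \<noteq> {}" "0 < y" "y \<le> card P" "0 < z" "z \<le> card P" "0 < r" "0 < s" "0 < d" "0 < e" "0 < N"
    "card {ps \<in> chains \<delta> (i + 3) P. last ps \<in> Q} \<le> (i + 1) * Suc (floor_log (card P)) ^ 4 * N"
    "N \<le> 16 * (r * s * z * d * e)" "N \<le> 8 * (r * s * card X * y)" "N \<le> 8 * (r * z * d * card Q)"
    "N \<le> 4 * (H * z * e * s)"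
    "r * card X \<le> (\<Sum>a\<in>X. ending \<delta> P i a)"
    "d ^ 3 * z \<le> 4096 * card X ^ 2 \<or> d * z \<le> 16 * card X \<or> d \<le> 16"
    "e ^ 3 * z \<le> 4096 * y ^ 2 \<or> e * z \<le> 16 * y \<or> e \<le> 16"
    "s ^ 3 * y \<le> 4096 * card Q ^ 2 \<or> s * y \<le> 16 * card Q \<or> s \<le> 16"
    "d * z \<le> 2 * u2 (card P)" "e * z \<le> 2 * u2 (card P)" "s * y \<le> 2 * u2 (card P)"
proof -
  let ?S = "{ps \<in> chains \<delta> (i + 3) P. last ps \<in> Q}"
  define D where "D c = {q \<in> Q. dist q c = \<delta> (i + 2)}" for c
  have fQ: "finite Q" using P Q finite_subset by blast
  have D: "finite (D c)" "card (D c) \<le> card P" for c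
    using P Q fQ by (auto intro!: card_mono simp: D_def)
  have w: "card (SIGMA c:{c \<in> P. dist b c = \<delta> (i + 1)}. {q \<in> D c. q \<noteq> b}) \<le> card Q * 2" for b
  proof -
    let ?T = "SIGMA q:{q \<in> Q. q \<noteq> b}. {c \<in> P. dist b c = \<delta> (i + 1) \<and> dist c q = \<delta> (i + 2)}"
    have "finite {q \<in> Q. q \<noteq> b} \<and> card {q \<in> Q. q \<noteq> b} \<le> card Q" using fQ by (auto intro: card_mono)
    then have T: "finite ?T \<and> card ?T \<le> card Q * 2"
      using P \<delta> by (intro finite_card_Sigma_le conjI card_common_neighbours) auto
    have "card (SIGMA c:{c \<in> P. dist b c = \<delta> (i + 1)}. {q \<in> D c. q \<noteq> b}) \<le> card ?T"
      by (rule card_inj_on_le[of prod.swap]) (use T in \<open>auto simp: D_def dist_commute\<close>)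
    then show ?thesis using T by linarith
  qed
  have lst: "last ps \<in> D (ps ! (i + 2)) \<and> last ps \<noteq> ps ! (i + 1)"
    and dr0: "drop (i + 2) ps = [ps ! (i + 2), last ps]" if "ps \<in> ?S" for ps
  proof -
    have c: "ps \<in> chains \<delta> (i + 3) P" "last ps \<in> Q" using that by auto
    have l: "last ps = ps ! (i + 3)" by (rule last_chain[OF c(1)])
    show "last ps \<in> D (ps ! (i + 2)) \<and> last ps \<noteq> ps ! (i + 1)"
      using chain_nth(2)[OF c(1), of "i + 2"] chain_nth(3)[OF c(1), of "i + 3" "i + 1"] c(2) l
      by (simp add: D_def dist_commute numeral_3_eq_3)
    show "drop (i + 2) ps = [ps ! (i + 2), last ps]"
      using chain_nth(4)[OF c(1)] l by (simp add: Cons_nth_drop_Suc[symmetric] numeral_3_eq_3)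
  qed
  have dr: "drop (i + 2) ps = drop (i + 2) ps'"
    if "ps \<in> ?S" "ps' \<in> ?S" "last ps = last ps'" "ps ! (i + 2) = ps' ! (i + 2)" for ps ps'
    unfolding dr0[OF that(1)] dr0[OF that(2)] using that(3,4) by simp
  have sub: "?S \<subseteq> chains \<delta> (i + 3) P" and m: "2 \<le> (3::nat)" by auto
  obtain X Y z r s d e N where C:
    "X \<subseteq> P" "X \<noteq> {}" "Y \<subseteq> P" "Y \<noteq> {}" "0 < z" "z \<le> card P" "0 < r" "0 < s" "0 < d" "0 < e" "0 < N"
    "card ?S \<le> (i + 1) * Suc (floor_log (card P)) ^ 4 * N" "\<forall>c\<in>Y. s \<le> card (D c)"
    "N \<le> 16 * (r * s * z * d * e)" "N \<le> 8 * (r * s * card X * card Y)" "N \<le> 4 * (r * z * d * (card Q * 2))"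
    "N \<le> 4 * (H * z * e * s)" "r * card X \<le> (\<Sum>a\<in>X. ending \<delta> P i a)"
    "d ^ 3 * z \<le> 4096 * card X ^ 2 \<or> d * z \<le> 16 * card X \<or> d \<le> 16"
    "e ^ 3 * z \<le> 4096 * card Y ^ 2 \<or> e * z \<le> 16 * card Y \<or> e \<le> 16"
    "d * z \<le> 2 * u2 (card P)" "e * z \<le> 2 * u2 (card P)"
    by (rule dyadic_chain_class[OF P \<delta> H sub m ne D lst dr w])
  have fY: "finite Y" using C(3) P finite_subset by blast
  have rs: "s \<le> card {q \<in> Q. dist q c = \<delta> (i + 2)}" if "c \<in> Y" for c using C(13) that by (simp add: D_def)
  show thesis
  proof (rule that[of X "card Y" z r s d e N])
    show "0 < card Y" "card Y \<le> card P" using C(3,4) fY P by (auto simp: card_gt_0_iff intro: card_mono)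
    show "N \<le> 8 * (r * z * d * card Q)" using C(16) by simp
    show "s ^ 3 * card Y \<le> 4096 * (card Q)\<^sup>2 \<or> s * card Y \<le> 16 * card Q \<or> s \<le> 16"
      by (rule rich_bound[OF fQ fY \<delta>[of "i + 2"] C(4)]) (rule rs)
    show "s * card Y \<le> 2 * u2 (card P)"
      using rich_le_inc[OF fQ fY rs] inc_mono[OF P P Q C(3), of "\<delta> (i + 2)"] inc_le_u2[OF P \<delta>[of "i + 2"]] by linarith
  qed (fact C)+
qed

section \<open>The upper bound\<close>

text \<open>The case analysis is carried out for logarithms: \<open>n\<close> stands for \<open>ln (card P)\<close>, \<open>K\<close> for the
  logarithm of the admissible loss, and so on.\<close>
lemma three_point_exponents:
  fixes n K r d e x z T :: real
  assumes K: "0 \<le> K" and "0 \<le> x" "x \<le> n" "0 \<le> z" "z \<le> n" "0 \<le> d" "0 \<le> e"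
    and T1: "T \<le> K + r + z + d + e" and T2: "T \<le> K + r + x + n" and T3: "T \<le> K + n + z + e"
    and a: "3 * (r + x) \<le> K + 2 * n + 2 * x \<or> r + x \<le> K + n"
    and d: "3 * d + z \<le> K + 2 * x \<or> d + z \<le> K + x \<or> d \<le> K"
    and e: "3 * e + z \<le> K + 2 * n \<or> e + z \<le> K + n \<or> e \<le> K"
  shows "T \<le> 8 * K + 2 * n"
  using assms by (smt (verit))

text \<open>In the application \<open>j * n\<close> has been subtracted from the logarithms
  \<open>T\<close> and \<open>r\<close>, so the same inequality serves every \<open>j\<close>. The
  four disjunctive hypotheses leave 54 combinations, each of them a problem of linear
  arithmetic.\<close>

lemma four_point_exponents:
  fixes n K r s d e x y z q T :: real
  assumes K: "0 \<le> K" and "0 \<le> x" "x \<le> n" "0 \<le> y" "y \<le> n" "0 \<le> z" "z \<le> n" "0 \<le> q" "q \<le> n" "0 \<le> d" "0 \<le> e" "0 \<le> s"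
    and T1: "T \<le> K + r + s + z + d + e" and T2: "T \<le> K + r + s + x + y" and T3: "T \<le> K + r + z + d + q"
    and T4: "T \<le> K + n + z + e + s"
    and a: "3 * (r + x) \<le> K + 2 * n + 2 * x \<or> r + x \<le> K + n"
    and d: "3 * d + z \<le> K + 2 * x \<or> d + z \<le> K + x \<or> d \<le> K"
    and e: "3 * e + z \<le> K + 2 * y \<or> e + z \<le> K + y \<or> e \<le> K"
    and s: "3 * s + y \<le> K + 2 * q \<or> s + y \<le> K + q \<or> s \<le> K"
  shows "3 * T \<le> 30 * K + 5 * n + 2 * q \<or> T \<le> 10 * K + 2 * n"
  using assms by (smt (verit))

text \<open>Here \<open>u\<close> stands for the logarithm of \<open>u2 (card P)\<close>, whose
  order of growth stays open. It is linked to \<open>n\<close> through \<open>n \<le> K + u\<close>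
  only; in addition the four products behind \<open>r + x\<close>, \<open>s + y\<close>,
  \<open>d + z\<close> and \<open>e + z\<close> are capped by it.\<close>

lemma four_point_exponents_unit:
  fixes n K r s d e x y z T u :: real
  assumes K: "0 \<le> K" and "0 \<le> x" "x \<le> n" "0 \<le> y" "y \<le> n" "0 \<le> z" "z \<le> n" "0 \<le> d" "0 \<le> e" "0 \<le> s"
    and T1: "T \<le> K + r + s + z + d + e" and T2: "T \<le> K + r + s + x + y" and T3: "T \<le> K + r + z + d + n"
    and T4: "T \<le> K + n + z + e + s"
    and a: "3 * (r + x) \<le> K + 2 * n + 2 * x \<or> r + x \<le> K + n"
    and d: "3 * d + z \<le> K + 2 * x \<or> d + z \<le> K + x \<or> d \<le> K"
    and e: "3 * e + z \<le> K + 2 * y \<or> e + z \<le> K + y \<or> e \<le> K"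
    and s: "3 * s + y \<le> K + 2 * n \<or> s + y \<le> K + n \<or> s \<le> K"
    and u: "n \<le> K + u" "r + x \<le> K + u" "s + y \<le> K + u" "d + z \<le> K + u" "e + z \<le> K + u"
  shows "T \<le> 10 * K + n + u"
  using assms by (smt (verit))

text \<open>The induction invariant, with \<open>K\<close> absorbing the polylogarithmic factors. Its first clause is the weak-type
  estimate that the incidence bound provides for \<open>j = 0\<close>, where \<open>ending\<close> counts neighbours.\<close>
definition chain_bounds :: "(nat \<Rightarrow> real) \<Rightarrow> point2 set \<Rightarrow> nat \<Rightarrow> nat \<Rightarrow> bool" where
  "chain_bounds \<delta> P K j \<longleftrightarrow>
    (\<forall>Q\<subseteq>P. (\<Sum>q\<in>Q. ending \<delta> P (3 * j + 1) q) ^ 3 \<le> K * card P ^ (3 * j + 2) * card Q ^ 2 \<or>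
        (\<Sum>q\<in>Q. ending \<delta> P (3 * j + 1) q) \<le> K * card P ^ (j + 1)) \<and>
    card (chains \<delta> (3 * j + 1) P) \<le> K * card P ^ j * u2 (card P) \<and>
    (\<forall>b. ending \<delta> P (3 * j + 2) b \<le> K * card P ^ (j + 1))"

section \<open>From counts to logarithms, and the induction step\<close>

lemma ln_nat_mono: "0 < a \<Longrightarrow> a \<le> b \<Longrightarrow> ln (real a) \<le> ln (real b)"
  by simp

lemma ln_nat_mult: "0 < a \<Longrightarrow> 0 < b \<Longrightarrow> ln (real (a * b)) = ln (real a) + ln (real b)"
  by (simp add: ln_mult)

lemma ln_nat_power: "0 < a \<Longrightarrow> ln (real (a ^ k)) = k * ln (real a)"
  by (simp add: ln_realpow)

lemma ln_nat_le_cancel: "0 < b \<Longrightarrow> ln (real a) \<le> ln (real b) \<Longrightarrow> a \<le> b"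
  by (cases "a = 0") auto

lemma rich_logs:
  assumes "d ^ 3 * z \<le> 4096 * x ^ 2 \<or> d * z \<le> 16 * x \<or> d \<le> 16"
    and "0 < d" "0 < z" "0 < x" "4096 \<le> K"
  shows "3 * ln (real d) + ln (real z) \<le> 2 * ln (real K) + 2 * ln (real x) \<or>
    ln (real d) + ln (real z) \<le> 2 * ln (real K) + ln (real x) \<or> ln (real d) \<le> 2 * ln (real K)"
proof -
  have K: "ln (real 4096) \<le> ln (real K)" "ln (real 16) \<le> ln (real 4096)" "0 \<le> ln (real K)" using assms(5) by auto
  from assms(1) show ?thesis
  proof (elim disjE)
    assume "d ^ 3 * z \<le> 4096 * x ^ 2"
    then have "ln (real (d ^ 3 * z)) \<le> ln (real (4096 * x ^ 2))" using assms by (intro ln_nat_mono) auto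
    then have "3 * ln (real d) + ln (real z) \<le> ln (real 4096) + 2 * ln (real x)"
      using assms by (simp only: ln_nat_mult ln_nat_power zero_less_power zero_less_numeral of_nat_numeral)
    then show ?thesis using K by linarith
  next
    assume "d * z \<le> 16 * x"
    then have "ln (real (d * z)) \<le> ln (real (16 * x))" using assms by (intro ln_nat_mono) auto
    then have "ln (real d) + ln (real z) \<le> ln (real 16) + ln (real x)"
      using assms by (simp only: ln_nat_mult ln_nat_power zero_less_power zero_less_numeral)
    then show ?thesis using K by linarith
  next
    assume "d \<le> 16"
    then have "ln (real d) \<le> ln (real 16)" using assms by (intro ln_nat_mono) auto
    then show ?thesis using K by linarith
  qed
qed

context
  fixes \<delta> :: "nat \<Rightarrow> real" and P :: "point2 set" and K j :: nat
  assumes P: "finite P" "card P \<ge> 2" and \<delta>: "\<And>i. \<delta> i > 0" and K: "4096 \<le> K" "card P \<le> K * u2 (card P)"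
    and bounds: "chain_bounds \<delta> P K j"
begin

lemma K_ln: "ln (real 16) \<le> ln (real K)" "ln (real 2) \<le> ln (real K)" "ln (real 4) \<le> ln (real K)" "ln (real 8) \<le> ln (real K)" "0 \<le> ln (real K)"
  using K by auto

lemma u2_pos: "0 < u2 (card P)"
  using K P by (cases "u2 (card P)") auto

text \<open>At least \<open>r * card X\<close> chains end in \<open>X\<close>, so the invariant for
  \<open>Q = X\<close> limits \<open>r\<close> in terms of \<open>card X\<close>. The subtracted
  multiple of \<open>ln (card P)\<close> removes the dependence on \<open>j\<close>.\<close>

lemma start_logs:
  assumes "X \<subseteq> P" "X \<noteq> {}" "r * card X \<le> (\<Sum>a\<in>X. ending \<delta> P (3 * j + 1) a)" "0 < r"
  shows "3 * (ln (real r) - j * ln (real (card P)) + ln (real (card X))) \<le> 2 * ln (real K) + 2 * ln (real (card P)) + 2 * ln (real (card X)) \<or>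
      ln (real r) - j * ln (real (card P)) + ln (real (card X)) \<le> 2 * ln (real K) + ln (real (card P))"
    and "ln (real r) - j * ln (real (card P)) + ln (real (card X)) \<le> 2 * ln (real K) + ln (real (u2 (card P)))"
proof -
  have x: "0 < card X" using assms P finite_subset by (auto simp: card_gt_0_iff)
  have n: "0 < (card P)" "0 < K" using P K by auto
  let ?s = "\<Sum>a\<in>X. ending \<delta> P (3 * j + 1) a"
  have s: "0 < ?s" "0 < r * card X" using assms x by (auto intro: less_le_trans[of _ "r * card X"])
  have rx: "ln (real r) + ln (real (card X)) \<le> ln (real ?s)"
    using ln_nat_mono[OF s(2) assms(3)] assms(4) x by (simp only: ln_nat_mult)
  have "?s ^ 3 \<le> K * card P ^ (3 * j + 2) * card X ^ 2 \<or> ?s \<le> K * card P ^ (j + 1)"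
    using bounds assms(1) unfolding chain_bounds_def by blast
  then show "3 * (ln (real r) - j * ln (real (card P)) + ln (real (card X))) \<le> 2 * ln (real K) + 2 * ln (real (card P)) + 2 * ln (real (card X)) \<or>
      ln (real r) - j * ln (real (card P)) + ln (real (card X)) \<le> 2 * ln (real K) + ln (real (card P))"
  proof
    assume "?s ^ 3 \<le> K * card P ^ (3 * j + 2) * card X ^ 2"
    then have "ln (real (?s ^ 3)) \<le> ln (real (K * card P ^ (3 * j + 2) * card X ^ 2))"
      using s by (intro ln_nat_mono) auto
    then have "real 3 * ln (real ?s) \<le> ln (real K) + real (3 * j + 2) * ln (real (card P)) + real 2 * ln (real (card X))"
      using s n x by (simp only: ln_nat_mult ln_nat_power zero_less_power mult_pos_pos)
    then show ?thesis using rx K_ln by (simp add: algebra_simps)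
  next
    assume "?s \<le> K * card P ^ (j + 1)"
    then have "ln (real ?s) \<le> ln (real (K * card P ^ (j + 1)))" using s by (intro ln_nat_mono) auto
    then have "ln (real ?s) \<le> ln (real K) + real (j + 1) * ln (real (card P))"
      using s n x by (simp only: ln_nat_mult ln_nat_power zero_less_power mult_pos_pos)
    then show ?thesis using rx K_ln by (simp add: algebra_simps)
  qed
  have "?s \<le> (\<Sum>a\<in>P. ending \<delta> P (3 * j + 1) a)" by (rule sum_mono2) (use assms P in auto)
  also have "\<dots> \<le> K * card P ^ j * u2 (card P)"
    using bounds unfolding chain_bounds_def sum_ending_all[OF P(1)] by blast
  finally have "ln (real ?s) \<le> ln (real (K * card P ^ j * u2 (card P)))" using s by (intro ln_nat_mono) auto
  then have "ln (real ?s) \<le> ln (real K) + real j * ln (real (card P)) + ln (real (u2 (card P)))"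
    using s n x u2_pos by (simp only: ln_nat_mult ln_nat_power zero_less_power mult_pos_pos)
  then show "ln (real r) - j * ln (real (card P)) + ln (real (card X)) \<le> 2 * ln (real K) + ln (real (u2 (card P)))"
    using rx K_ln by (simp add: algebra_simps)
qed

lemma tail_count: "ending \<delta> P ((3 * j + 1) + 1) b \<le> K * card P ^ (j + 1)"
  using bounds by (simp add: chain_bounds_def)

lemma card_chains_three:
  "card (chains \<delta> (3 * j + 3) P) \<le> ((3 * j + 2) * Suc (floor_log (card P)) ^ 4) * (K ^ 16 * card P ^ (j + 2))"
proof (cases "chains \<delta> ((3 * j + 1) + 2) P = {}")
  case False
  have n: "0 < (card P)" "0 < K" using P K by auto
  obtain X z r d e N where X: "X \<subseteq> P" "X \<noteq> {}" and pos: "0 < z" "z \<le> (card P)" "0 < r" "0 < d" "0 < e" "0 < N"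
    and S: "card (chains \<delta> ((3 * j + 1) + 2) P) \<le> ((3 * j + 1) + 1) * Suc (floor_log (card P)) ^ 4 * N"
    and N: "N \<le> 16 * (r * z * d * e)" "N \<le> 8 * (r * card X * card P)" "N \<le> 4 * ((K * card P ^ (j + 1)) * z * e)"
    and r: "r * card X \<le> (\<Sum>a\<in>X. ending \<delta> P (3 * j + 1) a)"
    and d: "d ^ 3 * z \<le> 4096 * card X ^ 2 \<or> d * z \<le> 16 * card X \<or> d \<le> 16"
    and e: "e ^ 3 * z \<le> 4096 * card P ^ 2 \<or> e * z \<le> 16 * (card P) \<or> e \<le> 16"
    by (rule three_point_class[OF P(1) \<delta> tail_count False])
  have x: "0 < card X" "card X \<le> (card P)" using X P finite_subset by (auto simp: card_gt_0_iff intro: card_mono)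
  note logs = ln_nat_mult ln_nat_power zero_less_power mult_pos_pos zero_less_numeral
  \<comment> \<open>The loss \<open>2 * ln K\<close> pays for a factor \<open>K\<close> from the
    invariant and for a numerical constant, which \<open>K\<close> exceeds as well. Eight such
    losses make up \<open>K ^ 16\<close>.\<close>
  have "ln (real N) - j * ln (real (card P)) \<le> 8 * (2 * ln (real K)) + 2 * ln (real (card P))"
  proof (rule three_point_exponents[where r = "ln (real r) - j * ln (real (card P))" and x = "ln (real (card X))" and z = "ln (real z)" and d = "ln (real d)" and e = "ln (real e)"])
    have "ln (real N) \<le> ln (real 16) + (ln (real r) + ln (real z) + ln (real d) + ln (real e))"
      using ln_nat_mono[OF pos(6) N(1)] pos by (simp only: logs)
    then show "ln (real N) - j * ln (real (card P)) \<le> 2 * ln (real K) + (ln (real r) - j * ln (real (card P))) + ln (real z) + ln (real d) + ln (real e)"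
      using K_ln by linarith
    have "ln (real N) \<le> ln (real 8) + (ln (real r) + ln (real (card X)) + ln (real (card P)))"
      using ln_nat_mono[OF pos(6) N(2)] pos x n by (simp only: logs)
    then show "ln (real N) - j * ln (real (card P)) \<le> 2 * ln (real K) + (ln (real r) - j * ln (real (card P))) + ln (real (card X)) + ln (real (card P))"
      using K_ln by linarith
    have "ln (real N) \<le> ln (real 4) + (ln (real K) + real (j + 1) * ln (real (card P)) + ln (real z) + ln (real e))"
      using ln_nat_mono[OF pos(6) N(3)] pos x n by (simp only: logs)
    then show "ln (real N) - j * ln (real (card P)) \<le> 2 * ln (real K) + ln (real (card P)) + ln (real z) + ln (real e)"
      using K_ln by (simp add: algebra_simps)
    show "3 * (ln (real r) - j * ln (real (card P)) + ln (real (card X))) \<le> 2 * ln (real K) + 2 * ln (real (card P)) + 2 * ln (real (card X)) \<or>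
      ln (real r) - j * ln (real (card P)) + ln (real (card X)) \<le> 2 * ln (real K) + ln (real (card P))"
      by (rule start_logs(1)[OF X r pos(3)])
    show "3 * ln (real d) + ln (real z) \<le> 2 * ln (real K) + 2 * ln (real (card X)) \<or>
      ln (real d) + ln (real z) \<le> 2 * ln (real K) + ln (real (card X)) \<or> ln (real d) \<le> 2 * ln (real K)"
      by (rule rich_logs[OF d pos(4,1) x(1) K(1)])
    show "3 * ln (real e) + ln (real z) \<le> 2 * ln (real K) + 2 * ln (real (card P)) \<or>
      ln (real e) + ln (real z) \<le> 2 * ln (real K) + ln (real (card P)) \<or> ln (real e) \<le> 2 * ln (real K)"
      by (rule rich_logs[OF e pos(5,1) n(1) K(1)])
  qed (use pos x n K in auto)
  then have "ln (real N) \<le> real 16 * ln (real K) + real (j + 2) * ln (real (card P))" by (simp add: algebra_simps)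
  also have "\<dots> = ln (real (K ^ 16 * card P ^ (j + 2)))" using n by (simp only: logs)
  finally have "N \<le> K ^ 16 * card P ^ (j + 2)" using n by (intro ln_nat_le_cancel) auto
  then have "((3 * j + 1) + 1) * Suc (floor_log (card P)) ^ 4 * N \<le> ((3 * j + 1) + 1) * Suc (floor_log (card P)) ^ 4 * (K ^ 16 * card P ^ (j + 2))"
    by (rule mult_le_mono2)
  with S have "card (chains \<delta> ((3 * j + 1) + 2) P) \<le> ((3 * j + 1) + 1) * Suc (floor_log (card P)) ^ 4 * (K ^ 16 * card P ^ (j + 2))" by (rule order_trans)
  moreover have "(3 * j + 1) + 2 = 3 * j + 3" "(3 * j + 1) + 1 = 3 * j + 2" by auto
  ultimately show ?thesis by metis
next
  case True
  have "(3 * j + 1) + 2 = 3 * j + 3" by simp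
  then have "chains \<delta> (3 * j + 3) P = {}" using True by metis
  then show ?thesis by (simp only: card.empty le0)
qed

text \<open>The powers 60 and 20 of \<open>K\<close> are the losses \<open>30 * K\<close> and
  \<open>10 * K\<close> of the exponent lemmas, read with \<open>2 * ln K\<close> in place of
  \<open>K\<close>. The bound by \<open>u2\<close> is claimed for \<open>Q = P\<close>, where the
  sum counts all chains.\<close>

lemma sum_ending_four:
  assumes Q: "Q \<subseteq> P" "Q \<noteq> {}"
  obtains N where "(\<Sum>q\<in>Q. ending \<delta> P (3 * j + 4) q) \<le> ((3 * j + 2) * Suc (floor_log (card P)) ^ 4) * N"
    "N ^ 3 \<le> K ^ 60 * card P ^ (3 * j + 5) * card Q ^ 2 \<or> N \<le> K ^ 20 * card P ^ (j + 2)"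
    "Q = P \<Longrightarrow> N \<le> K ^ 20 * card P ^ (j + 1) * u2 (card P)"
proof -
  have fQ: "finite Q" using Q P finite_subset by auto
  have eq: "(\<Sum>q\<in>Q. ending \<delta> P (3 * j + 4) q) = card {ps \<in> chains \<delta> ((3 * j + 1) + 3) P. last ps \<in> Q}"
    using sum_ending[OF P(1) fQ, of \<delta> "(3 * j + 1) + 3"] by (simp add: numeral_eq_Suc)
  show thesis
  proof (cases "{ps \<in> chains \<delta> ((3 * j + 1) + 3) P. last ps \<in> Q} = {}")
    case True
    then have "card {ps \<in> chains \<delta> ((3 * j + 1) + 3) P. last ps \<in> Q} = 0" by (simp only: card.empty)
    then show thesis using that[of 0] eq by simp
  next
    case False
    have n: "0 < (card P)" "0 < K" using P K by auto
    have q: "0 < card Q" "card Q \<le> (card P)" using Q fQ P by (auto simp: card_gt_0_iff intro: card_mono)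
    obtain X y z r s d e N where X: "X \<subseteq> P" "X \<noteq> {}" and pos: "0 < y" "y \<le> (card P)" "0 < z" "z \<le> (card P)" "0 < r" "0 < s" "0 < d" "0 < e" "0 < N"
      and S: "card {ps \<in> chains \<delta> ((3 * j + 1) + 3) P. last ps \<in> Q} \<le> ((3 * j + 1) + 1) * Suc (floor_log (card P)) ^ 4 * N"
      and N: "N \<le> 16 * (r * s * z * d * e)" "N \<le> 8 * (r * s * card X * y)" "N \<le> 8 * (r * z * d * card Q)" "N \<le> 4 * ((K * card P ^ (j + 1)) * z * e * s)"
      and r: "r * card X \<le> (\<Sum>a\<in>X. ending \<delta> P (3 * j + 1) a)"
      and d: "d ^ 3 * z \<le> 4096 * card X ^ 2 \<or> d * z \<le> 16 * card X \<or> d \<le> 16"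
      and e: "e ^ 3 * z \<le> 4096 * y ^ 2 \<or> e * z \<le> 16 * y \<or> e \<le> 16"
      and s: "s ^ 3 * y \<le> 4096 * card Q ^ 2 \<or> s * y \<le> 16 * card Q \<or> s \<le> 16"
      and u: "d * z \<le> 2 * u2 (card P)" "e * z \<le> 2 * u2 (card P)" "s * y \<le> 2 * u2 (card P)"
      by (rule four_point_class[OF P(1) \<delta> Q(1) tail_count False])
    have x: "0 < card X" "card X \<le> (card P)" using X P finite_subset by (auto simp: card_gt_0_iff intro: card_mono)
    note logs = ln_nat_mult ln_nat_power zero_less_power mult_pos_pos zero_less_numeral
    let ?T = "ln (real N) - j * ln (real (card P))" and ?K = "2 * ln (real K)" and ?r = "ln (real r) - j * ln (real (card P))"
    have "ln (real N) \<le> ln (real 16) + (ln (real r) + ln (real s) + ln (real z) + ln (real d) + ln (real e))"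
      using ln_nat_mono[OF pos(9) N(1)] pos by (simp only: logs)
    then have T1: "?T \<le> ?K + ?r + ln (real s) + ln (real z) + ln (real d) + ln (real e)" using K_ln by linarith
    have "ln (real N) \<le> ln (real 8) + (ln (real r) + ln (real s) + ln (real (card X)) + ln (real y))"
      using ln_nat_mono[OF pos(9) N(2)] pos x by (simp only: logs)
    then have T2: "?T \<le> ?K + ?r + ln (real s) + ln (real (card X)) + ln (real y)" using K_ln by linarith
    have "ln (real N) \<le> ln (real 8) + (ln (real r) + ln (real z) + ln (real d) + ln (real (card Q)))"
      using ln_nat_mono[OF pos(9) N(3)] pos q by (simp only: logs)
    then have T3: "?T \<le> ?K + ?r + ln (real z) + ln (real d) + ln (real (card Q))" using K_ln by linarith
    have "ln (real N) \<le> ln (real 4) + (ln (real K) + real (j + 1) * ln (real (card P)) + ln (real z) + ln (real e) + ln (real s))"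
      using ln_nat_mono[OF pos(9) N(4)] pos n by (simp only: logs)
    then have T4: "?T \<le> ?K + ln (real (card P)) + ln (real z) + ln (real e) + ln (real s)" using K_ln by (simp add: algebra_simps)
    have U: "ln (real a) + ln (real b) \<le> ?K + ln (real (u2 (card P)))" if "a * b \<le> 2 * u2 (card P)" "0 < a" "0 < b" for a b
    proof -
      have "ln (real a) + ln (real b) \<le> ln (real 2) + ln (real (u2 (card P)))"
        using ln_nat_mono[OF _ that(1)] that u2_pos by (simp only: logs)
      then show ?thesis using K_ln by linarith
    qed
    have "ln (real (card P)) \<le> ln (real K) + ln (real (u2 (card P)))"
      using ln_nat_mono[OF n(1) K(2)] n u2_pos by (simp only: logs)
    then have nu: "ln (real (card P)) \<le> ?K + ln (real (u2 (card P)))" using K_ln by linarith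
    have ranges: "0 \<le> ?K" "0 \<le> ln (real (card X))" "ln (real (card X)) \<le> ln (real (card P))" "0 \<le> ln (real y)" "ln (real y) \<le> ln (real (card P))"
      "0 \<le> ln (real z)" "ln (real z) \<le> ln (real (card P))" "0 \<le> ln (real (card Q))" "ln (real (card Q)) \<le> ln (real (card P))"
      "0 \<le> ln (real d)" "0 \<le> ln (real e)" "0 \<le> ln (real s)"
      using pos x q n K by auto
    note R = start_logs(1)[OF X r pos(5)] rich_logs[OF d pos(7,3) x(1) K(1)] rich_logs[OF e pos(8,3) pos(1) K(1)]
      rich_logs[OF s pos(6,1) q(1) K(1)]
    show thesis
    proof (rule that[of N])
      show "(\<Sum>q\<in>Q. ending \<delta> P (3 * j + 4) q) \<le> ((3 * j + 2) * Suc (floor_log (card P)) ^ 4) * N"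
        using S eq by simp
      have "3 * ?T \<le> 30 * ?K + 5 * ln (real (card P)) + 2 * ln (real (card Q)) \<or> ?T \<le> 10 * ?K + 2 * ln (real (card P))"
        by (rule four_point_exponents[OF ranges T1 T2 T3 T4 R])
      then show "N ^ 3 \<le> K ^ 60 * card P ^ (3 * j + 5) * card Q ^ 2 \<or> N \<le> K ^ 20 * card P ^ (j + 2)"
      proof
        assume "3 * ?T \<le> 30 * ?K + 5 * ln (real (card P)) + 2 * ln (real (card Q))"
        then have "real 3 * ln (real N) \<le> real 60 * ln (real K) + real (3 * j + 5) * ln (real (card P)) + real 2 * ln (real (card Q))"
          by (simp add: algebra_simps)
        then have "ln (real (N ^ 3)) \<le> ln (real (K ^ 60 * card P ^ (3 * j + 5) * card Q ^ 2))"
          using n pos q by (simp only: logs)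
        then show ?thesis using n q by (intro disjI1 ln_nat_le_cancel) auto
      next
        assume "?T \<le> 10 * ?K + 2 * ln (real (card P))"
        then have "ln (real N) \<le> real 20 * ln (real K) + real (j + 2) * ln (real (card P))"
          by (simp add: algebra_simps)
        then have "ln (real N) \<le> ln (real (K ^ 20 * card P ^ (j + 2)))" using n by (simp only: logs)
        then show ?thesis using n q by (intro disjI2 ln_nat_le_cancel) auto
      qed
    next
      assume QP: "Q = P"
      have "?T \<le> 10 * ?K + ln (real (card P)) + ln (real (u2 (card P)))"
        by (rule four_point_exponents_unit[OF ranges(1-7) ranges(10-12) T1 T2 T3[unfolded QP] T4 R[unfolded QP] nu
              start_logs(2)[OF X r pos(5)] U[OF u(3) pos(6,1)] U[OF u(1) pos(7,3)] U[OF u(2) pos(8,3)]])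
      then have "ln (real N) \<le> real 20 * ln (real K) + real (j + 1) * ln (real (card P)) + ln (real (u2 (card P)))"
        by (simp add: algebra_simps)
      then have "ln (real N) \<le> ln (real (K ^ 20 * card P ^ (j + 1) * u2 (card P)))" using n u2_pos by (simp only: logs)
      then show "N \<le> K ^ 20 * card P ^ (j + 1) * u2 (card P)" using n u2_pos by (intro ln_nat_le_cancel) auto
    qed
  qed
qed

text \<open>The class factor is cubed because the first clause bounds a cube. The clause for a
  single end point is obtained from the chains with \<open>3 * j + 3\<close> edges by adding two
  more edges with \<open>ending_add2_le\<close>.\<close>

lemma chain_bounds_Suc:
  "chain_bounds \<delta> P (((3 * j + 2) * Suc (floor_log (card P)) ^ 4) ^ 3 * K ^ 60) (Suc j)"
proof -
  let ?M = "(3 * j + 2) * Suc (floor_log (card P)) ^ 4"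
  have "0 < ?M" by simp
  then have M: "1 \<le> ?M" by (simp only: One_nat_def Suc_le_eq)
  have K1: "1 \<le> K" using K by simp
  have mono: "?M * K ^ 20 \<le> ?M ^ 3 * K ^ 60"
    using power_increasing[of 1 3 ?M] power_increasing[of 20 60 K] M K1
    by (intro mult_le_mono) auto
  have "\<forall>Q\<subseteq>P. (\<Sum>q\<in>Q. ending \<delta> P (3 * Suc j + 1) q) ^ 3 \<le> ?M ^ 3 * K ^ 60 * card P ^ (3 * Suc j + 2) * card Q ^ 2 \<or>
        (\<Sum>q\<in>Q. ending \<delta> P (3 * Suc j + 1) q) \<le> ?M ^ 3 * K ^ 60 * card P ^ (Suc j + 1)"
  proof (intro allI impI)
    fix Q assume Q: "Q \<subseteq> P"
    let ?s = "\<Sum>q\<in>Q. ending \<delta> P (3 * Suc j + 1) q"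
    have j4: "3 * Suc j + 1 = 3 * j + 4" "3 * Suc j + 2 = 3 * j + 5" "Suc j + 1 = j + 2" by auto
    show "?s ^ 3 \<le> ?M ^ 3 * K ^ 60 * card P ^ (3 * Suc j + 2) * card Q ^ 2 \<or> ?s \<le> ?M ^ 3 * K ^ 60 * card P ^ (Suc j + 1)"
    proof (cases "Q = {}")
      case False
      obtain N where N: "(\<Sum>q\<in>Q. ending \<delta> P (3 * j + 4) q) \<le> ?M * N"
        "N ^ 3 \<le> K ^ 60 * card P ^ (3 * j + 5) * card Q ^ 2 \<or> N \<le> K ^ 20 * card P ^ (j + 2)"
        by (rule sum_ending_four[OF Q False])
      from N(2) show ?thesis unfolding j4
      proof
        assume "N ^ 3 \<le> K ^ 60 * card P ^ (3 * j + 5) * card Q ^ 2"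
        then have "?M ^ 3 * N ^ 3 \<le> ?M ^ 3 * (K ^ 60 * card P ^ (3 * j + 5) * card Q ^ 2)" by (rule mult_le_mono2)
        moreover have "(\<Sum>q\<in>Q. ending \<delta> P (3 * j + 4) q) ^ 3 \<le> (?M * N) ^ 3" by (rule power_mono[OF N(1)]) simp
        ultimately have "(\<Sum>q\<in>Q. ending \<delta> P (3 * j + 4) q) ^ 3 \<le> ?M ^ 3 * (K ^ 60 * card P ^ (3 * j + 5) * card Q ^ 2)"
          by (simp only: power_mult_distrib[of ?M N])
        then show "(\<Sum>q\<in>Q. ending \<delta> P (3 * j + 4) q) ^ 3 \<le> ?M ^ 3 * K ^ 60 * card P ^ (3 * j + 5) * card Q ^ 2 \<or>
           (\<Sum>q\<in>Q. ending \<delta> P (3 * j + 4) q) \<le> ?M ^ 3 * K ^ 60 * card P ^ (j + 2)" by (simp only: mult.assoc simp_thms)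
      next
        assume "N \<le> K ^ 20 * card P ^ (j + 2)"
        then have "?M * N \<le> ?M * (K ^ 20 * card P ^ (j + 2))" by (rule mult_le_mono2)
        also have "\<dots> = (?M * K ^ 20) * card P ^ (j + 2)" by (simp only: mult.assoc)
        also have "\<dots> \<le> (?M ^ 3 * K ^ 60) * card P ^ (j + 2)" by (rule mult_le_mono1[OF mono])
        finally show "(\<Sum>q\<in>Q. ending \<delta> P (3 * j + 4) q) ^ 3 \<le> ?M ^ 3 * K ^ 60 * card P ^ (3 * j + 5) * card Q ^ 2 \<or>
           (\<Sum>q\<in>Q. ending \<delta> P (3 * j + 4) q) \<le> ?M ^ 3 * K ^ 60 * card P ^ (j + 2)" using N(1) by (intro disjI2) (rule order_trans)
      qed
    qed simp
  qed
  moreover have "card (chains \<delta> (3 * Suc j + 1) P) \<le> ?M ^ 3 * K ^ 60 * card P ^ Suc j * u2 (card P)"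
  proof -
    have "P \<noteq> {}" using P by auto
    then obtain N where N: "(\<Sum>q\<in>P. ending \<delta> P (3 * j + 4) q) \<le> ?M * N" "N \<le> K ^ 20 * card P ^ (j + 1) * u2 (card P)"
      using sum_ending_four[OF order_refl] by metis
    have "card (chains \<delta> (3 * j + 4) P) \<le> ?M * N" using N(1) unfolding sum_ending_all[OF P(1)] .
    also have "\<dots> \<le> ?M * (K ^ 20 * card P ^ (j + 1) * u2 (card P))" by (rule mult_le_mono2[OF N(2)])
    also have "\<dots> = (?M * K ^ 20) * ((card P) ^ (j + 1) * u2 (card P))" by (simp only: mult.assoc)
    also have "\<dots> \<le> (?M ^ 3 * K ^ 60) * ((card P) ^ (j + 1) * u2 (card P))" by (rule mult_le_mono1[OF mono])
    finally have "card (chains \<delta> (3 * j + 4) P) \<le> ?M ^ 3 * K ^ 60 * card P ^ (j + 1) * u2 (card P)" by (simp only: mult.assoc)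
    moreover have "3 * Suc j + 1 = 3 * j + 4" "Suc j = j + 1" by auto
    ultimately show ?thesis by metis
  qed
  moreover have "\<forall>b. ending \<delta> P (3 * Suc j + 2) b \<le> ?M ^ 3 * K ^ 60 * card P ^ (Suc j + 1)"
  proof
    fix b
    have "ending \<delta> P ((3 * j + 3) + 2) b \<le> 2 * card (chains \<delta> (3 * j + 3) P)"
      using ending_add2_le[of P \<delta> "3 * j + 3" b, OF P(1) \<delta>] unfolding sum_ending_all[OF P(1)] .
    also have "\<dots> \<le> K * (((3 * j + 2) * Suc (floor_log (card P)) ^ 4) * (K ^ 16 * card P ^ (j + 2)))"
      by (rule mult_le_mono) (use K card_chains_three in auto)
    also have "\<dots> = ((3 * j + 2) * Suc (floor_log (card P)) ^ 4) * K ^ 17 * card P ^ (j + 2)"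
      using power_Suc[of K 16] by simp
    also have "\<dots> \<le> (?M * K ^ 20) * card P ^ (j + 2)"
      using power_increasing[of 17 20 K] K1
      by (intro mult_le_mono1 mult_le_mono mult_le_mono2) simp_all
    also have "\<dots> \<le> (?M ^ 3 * K ^ 60) * card P ^ (j + 2)" by (rule mult_le_mono1[OF mono])
    finally have "ending \<delta> P ((3 * j + 3) + 2) b \<le> ?M ^ 3 * K ^ 60 * card P ^ (j + 2)" .
    moreover have "3 * Suc j + 2 = (3 * j + 3) + 2" "Suc j + 1 = j + 2" by auto
    ultimately show "ending \<delta> P (3 * Suc j + 2) b \<le> ?M ^ 3 * K ^ 60 * card P ^ (Suc j + 1)" by metis
  qed
  ultimately show ?thesis unfolding chain_bounds_def by blast
qed

end

section \<open>Start of the induction, iteration, and the upper bound for \<open>C2\<close>\<close>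

lemma u2_ge:
  assumes "n \<ge> 1"
  shows "n \<le> u2 n + 1"
proof -
  \<comment> \<open>A star provides the unit distances: the origin is the centre, and the other
    points lie on the unit circle with pairwise different first coordinates.\<close>
  define p where "p i = (vector [1 / (1 + real i), sqrt (1 - (1 / (1 + real i))\<^sup>2)] :: point2)" for i :: nat
  have p1: "p i $ 1 = 1 / (1 + real i)" "p i $ 2 = sqrt (1 - (1 / (1 + real i))\<^sup>2)" for i
    by (simp_all add: p_def vector_2)
  have inj: "inj p"
  proof (rule injI)
    fix i j assume "p i = p j"
    then have "1 / (1 + real i) = 1 / (1 + real j)" using p1(1) by metis
    then show "i = j" by (simp add: field_simps)
  qed
  have d: "dist 0 (p i) = 1" for i
  proof -
    have "(1 / (1 + real i))\<^sup>2 \<le> 1" by (simp add: power_le_one divide_le_eq)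
    then show ?thesis unfolding dist_point2 by (simp add: p1)
  qed
  define P where "P = insert 0 (p ` {..<n - 1})"
  have "0 \<notin> p ` {..<n - 1}" using d by (metis dist_self image_iff zero_neq_one)
  then have P: "finite P" "card P = n"
    using assms inj by (auto simp: P_def card_image inj_on_def)
  have "n - 1 = card ((\<lambda>i. {0, p i}) ` {..<n - 1})"
    using inj by (subst card_image) (auto simp: inj_on_def doubleton_eq_iff)
  also have "\<dots> \<le> card {{q, r} | q r. q \<in> P \<and> r \<in> P \<and> dist q r = 1}"
  proof (rule card_mono)
    show "finite {{q, r} | q r. q \<in> P \<and> r \<in> P \<and> dist q r = 1}"
      by (rule finite_subset[of _ "Pow P"]) (use P in auto)
    show "(\<lambda>i. {0, p i}) ` {..<n - 1} \<subseteq> {{q, r} | q r. q \<in> P \<and> r \<in> P \<and> dist q r = 1}"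
      using d by (force simp: P_def)
  qed
  also have "\<dots> \<le> u2 n" using card_unit_pairs_le_u2[OF P(1)] P(2) by simp
  finally show ?thesis by simp
qed

lemma ending_0_le: "ending \<delta> P 0 a \<le> 1"
proof -
  have "{ps \<in> chains \<delta> 0 P. last ps = a} \<subseteq> {[a]}" by (auto simp: chains_def length_Suc_conv)
  then have "card {ps \<in> chains \<delta> 0 P. last ps = a} \<le> card {[a]}" by (intro card_mono) auto
  then show ?thesis by (simp add: ending_def)
qed

lemma ending_1_le:
  assumes "finite P"
  shows "ending \<delta> P 1 q \<le> card {a \<in> P. dist a q = \<delta> 0}"
proof -
  let ?S = "{ps \<in> chains \<delta> (0 + 1) P. last ps = q}"
  have len: "length ps = 2" "ps ! 1 = q" if "ps \<in> ?S" for ps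
    using that last_chain[of ps \<delta> 1 P] chain_nth(4)[of ps] by auto
  have "card ?S \<le> (\<Sum>a\<in>{a \<in> P. dist a q = \<delta> 0}. ending \<delta> P 0 (id a))"
  proof (rule card_chains_tail[where m = 1 and tag = "\<lambda>ps. ps ! 0"])
    fix ps assume ps: "ps \<in> ?S"
    then have c: "ps \<in> chains \<delta> 1 P" by simp
    show "ps ! 0 \<in> {a \<in> P. dist a q = \<delta> 0}"
      using chain_nth(1,2)[OF c, of 0] len[OF ps] by simp
  next
    fix ps ps' assume ps: "ps \<in> ?S" "ps' \<in> ?S"
    show "drop (Suc 0) ps = drop (Suc 0) ps'"
      by (rule nth_equalityI) (use len[OF ps(1)] len[OF ps(2)] in \<open>simp_all\<close>)
  qed (use assms in auto)
  also have "\<dots> \<le> card {a \<in> P. dist a q = \<delta> 0} * 1"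
    by (rule sum_le_card_mult) (rule ending_0_le)
  finally show ?thesis by (simp add: ending_def)
qed

lemma chain_bounds_mono: "chain_bounds \<delta> P K j \<Longrightarrow> K \<le> K' \<Longrightarrow> chain_bounds \<delta> P K' j"
  unfolding chain_bounds_def by (meson mult_le_mono1 order_trans)

lemma chain_bounds_0:
  assumes P: "finite P" and \<delta>: "\<And>i. \<delta> i > 0"
  shows "chain_bounds \<delta> P 4096 0"
proof -
  have s: "(\<Sum>q\<in>Q. ending \<delta> P 1 q) \<le> inc (\<delta> 0) P Q" if "Q \<subseteq> P" for Q
    unfolding inc_eq_sum[OF P finite_subset[OF that P]] by (rule sum_mono) (rule ending_1_le[OF P])
  have "(\<Sum>q\<in>Q. ending \<delta> P 1 q) ^ 3 \<le> 4096 * card P ^ 2 * card Q ^ 2 \<or> (\<Sum>q\<in>Q. ending \<delta> P 1 q) \<le> 4096 * card P"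
    if Q: "Q \<subseteq> P" for Q
  proof -
    have c: "card Q \<le> card P" using Q P by (rule card_mono[rotated])
    have cube: "(\<Sum>q\<in>Q. ending \<delta> P 1 q) ^ 3 \<le> inc (\<delta> 0) P Q ^ 3" by (rule power_mono[OF s[OF Q]]) simp
    from incidence_bound[OF P finite_subset[OF Q P] \<delta>[of 0]] show ?thesis
    proof
      assume "inc (\<delta> 0) P Q \<le> 8 * (card P + card Q)"
      also have "\<dots> \<le> 4096 * card P" using c by simp
      finally show ?thesis using s[OF Q] by (intro disjI2) (rule order_trans)
    next
      assume "inc (\<delta> 0) P Q ^ 3 \<le> 4096 * card P ^ 2 * card Q ^ 2"
      with cube show ?thesis by (intro disjI1) (rule order_trans)
    qed
  qed
  moreover have "card (chains \<delta> 1 P) \<le> 4096 * u2 (card P)"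
    using s[OF order_refl] inc_le_u2[OF P \<delta>[of 0]] unfolding sum_ending_all[OF P] by linarith
  moreover have "ending \<delta> P 2 b \<le> 4096 * card P" for b
  proof -
    have "ending \<delta> P (0 + 2) b \<le> 2 * (\<Sum>a\<in>P. ending \<delta> P 0 a)" by (rule ending_add2_le[OF P \<delta>])
    moreover have "(\<Sum>a\<in>P. ending \<delta> P 0 a) \<le> card P * 1" by (rule sum_le_card_mult) (rule ending_0_le)
    ultimately show ?thesis unfolding add_0 by linarith
  qed
  ultimately show ?thesis
    unfolding chain_bounds_def mult_0_right add_0 power_0 mult_1_right power_one_right by blast
qed

lemma floor_log_ge_1: "2 \<le> n \<Longrightarrow> 1 \<le> floor_log n"
  using floor_log_mono[THEN monoD, of 2 n] by (simp add: floor_log.simps)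

lemma le_power_of_two_le: "2 \<le> L \<Longrightarrow> m \<le> L ^ m" for L m :: nat
  using less_exp[of m] power_mono[of 2 L m] by simp

lemma power_12_ge: "2 \<le> L \<Longrightarrow> 4096 \<le> L ^ 12" for L :: nat
  using power_mono[of 2 L 12] by simp

lemma power_regroup: "(L ^ a * L ^ 4) ^ 3 * (L ^ c) ^ 60 = L ^ (a * 3 + 12 + c * 60)" for L :: nat
  by (simp add: power_mult_distrib power_add flip: power_mult)

text \<open>With \<open>L = Suc (floor_log (card P))\<close>, each step raises \<open>K\<close> to
  the power 60 and multiplies it by powers of \<open>L\<close> and of \<open>3 * j + 2\<close>, so
  it stays below a power of \<open>L\<close>. As \<open>L\<close> is at least 2,
  \<open>12 \<le> c\<close> secures \<open>4096 \<le> L ^ c\<close>, as the step requires.\<close>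

lemma chain_bounds_log:
  assumes \<delta>: "\<And>i. \<delta> i > 0"
  shows "\<exists>c\<ge>12. \<forall>P. finite P \<and> 2 \<le> card P \<longrightarrow> chain_bounds \<delta> P (Suc (floor_log (card P)) ^ c) j"
proof (induction j)
  case 0
  have "chain_bounds \<delta> P (Suc (floor_log (card P)) ^ 12) 0" if "finite P" "2 \<le> card P" for P
    by (rule chain_bounds_mono[OF chain_bounds_0[OF that(1) \<delta>] power_12_ge])
      (use floor_log_ge_1[OF that(2)] in linarith)
  then show ?case by (intro exI[of _ 12]) blast
next
  case (Suc j)
  obtain c where c: "12 \<le> c" and b: "\<And>P. finite P \<Longrightarrow> 2 \<le> card P \<Longrightarrow> chain_bounds \<delta> P (Suc (floor_log (card P)) ^ c) j"
    using Suc.IH by blast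
  let ?c = "(3 * j + 2) * 3 + 12 + c * 60"
  have "chain_bounds \<delta> P (Suc (floor_log (card P)) ^ ?c) (Suc j)" if P: "finite P" "2 \<le> card P" for P
  proof -
    define L where "L = Suc (floor_log (card P))"
    have L: "2 \<le> L" using floor_log_ge_1[OF P(2)] by (simp add: L_def)
    have K: "4096 \<le> L ^ c" using order_trans[OF power_12_ge[OF L] power_increasing[OF c]] L by simp
    have "card P \<le> 2 * u2 (card P)" using u2_ge[of "card P"] P by linarith
    also have "\<dots> \<le> L ^ c * u2 (card P)" using K by (intro mult_le_mono1) linarith
    finally have u: "card P \<le> L ^ c * u2 (card P)" .
    have le: "((3 * j + 2) * L ^ 4) ^ 3 * (L ^ c) ^ 60 \<le> (L ^ (3 * j + 2) * L ^ 4) ^ 3 * (L ^ c) ^ 60"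
      by (intro mult_le_mono1 power_mono le_power_of_two_le[OF L]) simp
    show ?thesis unfolding L_def[symmetric]
      by (rule chain_bounds_mono[OF chain_bounds_Suc[OF P \<delta> K u b[OF P, folded L_def], folded L_def] le[unfolded power_regroup]])
  qed
  moreover have "12 \<le> ?c" by simp
  ultimately show ?case by (intro exI[of _ ?c] conjI allI impI) blast+
qed

text \<open>For \<open>k = 3 * j + 1\<close> this is the second clause of the invariant. For
  \<open>k = 3 * j + 2\<close> the third clause is summed over the end points, and
  \<open>k = 3 * j + 3\<close> is \<open>card_chains_three\<close>.\<close>

lemma card_chains_upper:
  assumes \<delta>: "\<And>i. \<delta> i > 0" and k: "1 \<le> k"
  shows "\<exists>c. \<forall>P. finite P \<and> 2 \<le> card P \<longrightarrow> card (chains \<delta> k P) \<le> Suc (floor_log (card P)) ^ c *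
    (if k mod 3 = 1 then card P ^ (k div 3) * u2 (card P) else card P ^ ((k + 1) div 3 + 1))"
proof -
  define j where "j = (k - 1) div 3"
  obtain c where c: "12 \<le> c" and b: "\<And>P. finite P \<Longrightarrow> 2 \<le> card P \<Longrightarrow> chain_bounds \<delta> P (Suc (floor_log (card P)) ^ c) j"
    using chain_bounds_log[of \<delta> j, OF \<delta>] by blast
  consider "k = 3 * j + 1" | "k = 3 * j + 2" | "k = 3 * j + 3" using k unfolding j_def by linarith
  then show ?thesis
  proof cases
    case 1
    then have k': "k mod 3 = 1" "k div 3 = j" by presburger+
    show ?thesis unfolding k' using b unfolding chain_bounds_def 1 by (intro exI[of _ c]) (simp add: mult.assoc)
  next
    case 2
    then have k': "k mod 3 \<noteq> 1" "(k + 1) div 3 + 1 = j + 2" by presburger+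
    have "card (chains \<delta> k P) \<le> Suc (floor_log (card P)) ^ c * card P ^ (j + 2)" if P: "finite P" "2 \<le> card P" for P
    proof -
      have "card (chains \<delta> k P) \<le> card P * (Suc (floor_log (card P)) ^ c * card P ^ (j + 1))"
        unfolding sum_ending_all[OF P(1), symmetric] 2
        by (rule sum_le_card_mult) (use b[OF P] in \<open>simp add: chain_bounds_def\<close>)
      then show ?thesis by (simp add: ac_simps)
    qed
    then show ?thesis unfolding k'(2) using k'(1) by (simp only: if_False) blast
  next
    case 3
    then have k': "k mod 3 \<noteq> 1" "(k + 1) div 3 + 1 = j + 2" by presburger+
    let ?c = "(3 * j + 2) + 4 + c * 16"
    have "card (chains \<delta> k P) \<le> Suc (floor_log (card P)) ^ ?c * card P ^ (j + 2)" if P: "finite P" "2 \<le> card P" for P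
    proof -
      define L where "L = Suc (floor_log (card P))"
      have L: "2 \<le> L" using floor_log_ge_1[OF P(2)] by (simp add: L_def)
      have K: "4096 \<le> L ^ c" using order_trans[OF power_12_ge[OF L] power_increasing[OF c]] L by simp
      have "card P \<le> 2 * u2 (card P)" using u2_ge[of "card P"] P by linarith
      also have "\<dots> \<le> L ^ c * u2 (card P)" using K by (intro mult_le_mono1) linarith
      finally have "card (chains \<delta> k P) \<le> (3 * j + 2) * L ^ 4 * ((L ^ c) ^ 16 * card P ^ (j + 2))"
        unfolding 3 L_def[symmetric] by (rule card_chains_three[OF P \<delta> K _ b[OF P, folded L_def], folded L_def])
      also have "\<dots> \<le> L ^ (3 * j + 2) * L ^ 4 * ((L ^ c) ^ 16 * card P ^ (j + 2))"
        by (intro mult_le_mono1 le_power_of_two_le[OF L])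
      also have "\<dots> = L ^ ?c * card P ^ (j + 2)"
        by (simp only: power_mult power_add mult.assoc)
      finally show ?thesis unfolding L_def .
    qed
    then show ?thesis unfolding k'(2) using k'(1) by (simp only: if_False) blast
  qed
qed

lemma exists_card_point2: "\<exists>P :: point2 set. finite P \<and> card P = n"
  using infinite_arbitrarily_large[of "UNIV :: point2 set" n] by (auto simp: infinite_UNIV_char_0)

text \<open>The counts are at most \<open>n ^ Suc k\<close>, so \<open>Max\<close> is taken over a
  finite non-empty set and is a true maximum.\<close>

lemma C2_cases:
  obtains P where "finite P" "card P = n" "C2 \<delta> k n = card (chains \<delta> k P)"
    "\<And>P'. finite P' \<Longrightarrow> card P' = n \<Longrightarrow> card (chains \<delta> k P') \<le> C2 \<delta> k n"
proof -
  let ?V = "{card (chains \<delta> k P) | P. finite P \<and> card P = n}"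
  have fin: "finite ?V" by (rule finite_subset[of _ "{..n ^ Suc k}"]) (use card_chains_le in auto)
  have "?V \<noteq> {}" using exists_card_point2[of n] by auto
  then have "C2 \<delta> k n \<in> ?V" unfolding C2_def by (rule Max_in[OF fin])
  moreover have "card (chains \<delta> k P') \<le> C2 \<delta> k n" if "finite P'" "card P' = n" for P'
    unfolding C2_def by (rule Max_ge[OF fin]) (use that in auto)
  ultimately show thesis using that by auto
qed

text \<open>It allows the sequence to be continued by 1 from index \<open>k\<close> on, so that all
  its terms may be taken positive.\<close>

lemma C2_cong: "(\<And>j. j < k \<Longrightarrow> \<delta> j = \<delta>' j) \<Longrightarrow> C2 \<delta> k = C2 \<delta>' k"
  by (rule ext) (simp add: C2_def chains_def)

lemma Suc_floor_log_le:
  assumes "3 \<le> n"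
  shows "real (Suc (floor_log n)) \<le> 3 * ln (real n)"
proof -
  have "ln (real (2 ^ floor_log n)) \<le> ln (real n)"
    using floor_log_exp2_le[of n] assms by (subst ln_le_cancel_iff) (auto simp flip: of_nat_le_iff)
  then have f: "real (floor_log n) * ln 2 \<le> ln (real n)" by (simp add: ln_realpow)
  have l2: "ln (2::real) \<ge> 1 / 2" using ln2_ge_two_thirds by linarith
  then have "real (floor_log n) * (1 / 2) \<le> real (floor_log n) * ln 2" by (intro mult_left_mono) auto
  moreover have "1 \<le> ln (real n)"
    using assms exp_le by (subst ln_ge_iff) auto
  ultimately show ?thesis using f by simp
qed

lemma C2_upper:
  assumes \<delta>: "\<And>j. j < k \<Longrightarrow> \<delta> j > 0" and k: "1 \<le> k"
  shows "\<exists>c. \<forall>n\<ge>3. real (C2 \<delta> k n) \<le> (3 * ln (real n)) ^ c *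
    real (if k mod 3 = 1 then n ^ (k div 3) * u2 n else n ^ ((k + 1) div 3 + 1))"
proof -
  let ?g = "\<lambda>n. if k mod 3 = 1 then n ^ (k div 3) * u2 n else n ^ ((k + 1) div 3 + 1)"
  define \<delta>' where "\<delta>' j = (if j < k then \<delta> j else 1)" for j
  have eq: "C2 \<delta> k = C2 \<delta>' k" by (rule C2_cong) (simp add: \<delta>'_def)
  have pos: "\<delta>' j > 0" for j using \<delta> by (simp add: \<delta>'_def)
  obtain c where c: "\<And>P. finite P \<Longrightarrow> 2 \<le> card P \<Longrightarrow> card (chains \<delta>' k P) \<le> Suc (floor_log (card P)) ^ c * ?g (card P)"
    using card_chains_upper[of \<delta>' k, OF pos k] by blast
  have "real (C2 \<delta> k n) \<le> (3 * ln (real n)) ^ c * real (?g n)" if n: "3 \<le> n" for n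
  proof -
    obtain P where P: "finite P" "card P = n" "C2 \<delta>' k n = card (chains \<delta>' k P)" by (rule C2_cases)
    have "C2 \<delta> k n \<le> Suc (floor_log n) ^ c * ?g n"
      using c[OF P(1)] n unfolding eq P(2,3) by linarith
    then have "real (C2 \<delta> k n) \<le> real (Suc (floor_log n)) ^ c * real (?g n)"
      by (simp only: of_nat_mult[symmetric] of_nat_power[symmetric] of_nat_le_iff)
    also have "\<dots> \<le> (3 * ln (real n)) ^ c * real (?g n)"
      by (intro mult_right_mono power_mono Suc_floor_log_le n) auto
    finally show ?thesis .
  qed
  then show ?thesis by blast
qed

lemma ln_power_bigo_powr:
  assumes "\<epsilon> > 0"
  shows "(\<lambda>n. (3 * ln (real n)) ^ c) \<in> O(\<lambda>n. real n powr \<epsilon>)"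
  using assms by real_asymp

section \<open>The lower bound\<close>

lemma dist_point2_less:
  fixes p q :: point2
  assumes "\<bar>p $ 1 - q $ 1\<bar> < \<eta> / 2" "\<bar>p $ 2 - q $ 2\<bar> < \<eta> / 2"
  shows "dist p q < \<eta>"
proof -
  have "dist p q \<le> \<bar>p $ 1 - q $ 1\<bar> + \<bar>p $ 2 - q $ 2\<bar>"
    unfolding dist_point2 using sqrt_sum_squares_le_sum_abs by blast
  then show ?thesis using assms by linarith
qed

text \<open>The two-bar linkage \<open>z - w - c\<close> with \<open>c\<close> fixed follows small movements of \<open>z\<close> as long as
  it is not stretched: the joint \<open>w\<close> depends continuously on \<open>z\<close>.\<close>
lemma linkage:
  fixes z w c :: point2
  assumes s: "dist z w = s" "s > 0" and t: "dist w c = t" "t > 0"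
    and det: "(z $ 1 - c $ 1) * (w $ 2 - c $ 2) - (z $ 2 - c $ 2) * (w $ 1 - c $ 1) \<noteq> 0" (is "?det \<noteq> 0")
    and \<eta>: "\<eta> > 0"
  shows "\<exists>\<gamma>>0. \<forall>p. dist p z < \<gamma> \<longrightarrow> (\<exists>p'. dist p' w < \<eta> \<and> dist p p' = s \<and> dist p' c = t)"
proof -
  \<comment> \<open>In the basis of \<open>p - c\<close> and its quarter turn, the joint at distance
    \<open>s\<close> from \<open>p\<close> and \<open>t\<close> from \<open>c\<close> has the
    coordinates \<open>\<alpha> p\<close>, by the law of cosines, and \<open>\<beta> p\<close>, by
    Pythagoras. The sign selects the side on which \<open>w\<close> lies, so that \<open>z\<close>
    is mapped to \<open>w\<close>.\<close>
  define D where "D p = (p $ 1 - c $ 1)\<^sup>2 + (p $ 2 - c $ 2)\<^sup>2" for p :: point2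
  define \<alpha> where "\<alpha> p = (t\<^sup>2 - s\<^sup>2 + D p) / (2 * D p)" for p
  define \<beta> where "\<beta> p = sgn ?det * sqrt (t\<^sup>2 / D p - (\<alpha> p)\<^sup>2)" for p
  define f1 where "f1 p = c $ 1 + \<alpha> p * (p $ 1 - c $ 1) - \<beta> p * (p $ 2 - c $ 2)" for p
  define f2 where "f2 p = c $ 2 + \<alpha> p * (p $ 2 - c $ 2) + \<beta> p * (p $ 1 - c $ 1)" for p
  define dt where "dt = ?det"
  define a1 a2 b1 b2 where "a1 = z $ 1 - c $ 1" "a2 = z $ 2 - c $ 2" "b1 = w $ 1 - c $ 1" "b2 = w $ 2 - c $ 2"
  have e1: "(a1 - b1)\<^sup>2 + (a2 - b2)\<^sup>2 = s\<^sup>2" and e2: "b1\<^sup>2 + b2\<^sup>2 = t\<^sup>2"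
    using s t dist_point2_eq_iff[of s z w] dist_point2_eq_iff[of t w c] by (simp_all add: a1_a2_b1_b2_def)
  have Dz: "D z = a1\<^sup>2 + a2\<^sup>2" by (simp add: D_def a1_a2_b1_b2_def)
  have det': "a1 * b2 - a2 * b1 = dt" by (simp add: a1_a2_b1_b2_def dt_def)
  have Dpos: "D z > 0"
  proof -
    have "a1 \<noteq> 0 \<or> a2 \<noteq> 0" using det unfolding dt_def[symmetric] det'[symmetric] by auto
    then show ?thesis unfolding Dz by (simp add: sum_power2_gt_zero_iff)
  qed
  have \<alpha>z: "\<alpha> z * D z = a1 * b1 + a2 * b2"
  proof -
    have "t\<^sup>2 - s\<^sup>2 + D z = 2 * (a1 * b1 + a2 * b2)"
      unfolding Dz e1[symmetric] e2[symmetric] by (simp add: power2_eq_square algebra_simps)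
    then show ?thesis using Dpos by (simp add: \<alpha>_def)
  qed
  have "(a1 * b1 + a2 * b2)\<^sup>2 + dt\<^sup>2 = D z * t\<^sup>2"
    unfolding det'[symmetric] Dz e2[symmetric] by (simp add: power2_eq_square algebra_simps)
  then have "(\<alpha> z * D z)\<^sup>2 + dt\<^sup>2 = D z * t\<^sup>2" unfolding \<alpha>z .
  then have "t\<^sup>2 = ((\<alpha> z * D z)\<^sup>2 + dt\<^sup>2) / D z" using Dpos by simp
  then have \<beta>sq: "t\<^sup>2 / D z - (\<alpha> z)\<^sup>2 = (dt / D z)\<^sup>2"
    using Dpos by (simp only:) (simp add: power2_eq_square field_simps)
  \<comment> \<open>Being strictly positive at \<open>z\<close>, the radicand stays positive nearby.
    This is where the linkage must not be stretched.\<close>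
  have \<beta>pos: "t\<^sup>2 / D z - (\<alpha> z)\<^sup>2 > 0" unfolding \<beta>sq using det Dpos by (simp add: dt_def)
  have \<beta>z: "\<beta> z = dt / D z"
    unfolding \<beta>_def \<beta>sq real_sqrt_abs dt_def[symmetric] using Dpos by (simp add: abs_divide mult_sgn_abs)
  have f1z: "f1 z = w $ 1"
  proof -
    have "D z * (\<alpha> z * a1 - \<beta> z * a2) = (\<alpha> z * D z) * a1 - (\<beta> z * D z) * a2" by (simp add: algebra_simps)
    also have "\<dots> = (a1 * b1 + a2 * b2) * a1 - (a1 * b2 - a2 * b1) * a2"
      unfolding \<alpha>z det' using \<beta>z Dpos by simp
    also have "\<dots> = D z * b1" unfolding Dz by (simp add: power2_eq_square algebra_simps)
    finally have "\<alpha> z * a1 - \<beta> z * a2 = b1" using Dpos by simp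
    then show ?thesis by (simp add: f1_def a1_a2_b1_b2_def)
  qed
  have f2z: "f2 z = w $ 2"
  proof -
    have "D z * (\<alpha> z * a2 + \<beta> z * a1) = (\<alpha> z * D z) * a2 + (\<beta> z * D z) * a1" by (simp add: algebra_simps)
    also have "\<dots> = (a1 * b1 + a2 * b2) * a2 + (a1 * b2 - a2 * b1) * a1"
      unfolding \<alpha>z det' using \<beta>z Dpos by simp
    also have "\<dots> = D z * b2" unfolding Dz by (simp add: power2_eq_square algebra_simps)
    finally have "\<alpha> z * a2 + \<beta> z * a1 = b2" using Dpos by simp
    then show ?thesis by (simp add: f2_def a1_a2_b1_b2_def)
  qed
  have D0: "D z \<noteq> 0" using Dpos by simp
  have cD: "isCont D z" unfolding D_def by (intro continuous_intros)
  have c\<alpha>: "isCont \<alpha> z" unfolding \<alpha>_def by (intro continuous_intros cD) (use D0 in simp)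
  have cr: "isCont (\<lambda>p. t\<^sup>2 / D p - (\<alpha> p)\<^sup>2) z" by (intro continuous_intros cD c\<alpha> D0)
  have c\<beta>: "isCont \<beta> z" unfolding \<beta>_def by (intro continuous_intros cr)
  have c1: "isCont f1 z" unfolding f1_def by (intro continuous_intros c\<alpha> c\<beta>)
  have c2: "isCont f2 z" unfolding f2_def by (intro continuous_intros c\<alpha> c\<beta>)
  have nhds: "(f \<longlongrightarrow> f z) (nhds z)" if "isCont f z" for f :: "point2 \<Rightarrow> real"
    using that unfolding continuous_at tendsto_at_iff_tendsto_nhds .
  have ev: "eventually (\<lambda>p. D p > 0 \<and> t\<^sup>2 / D p - (\<alpha> p)\<^sup>2 > 0 \<and> \<bar>f1 p - w $ 1\<bar> < \<eta> / 2 \<and> \<bar>f2 p - w $ 2\<bar> < \<eta> / 2) (nhds z)"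
  proof (intro eventually_conj)
    show "eventually (\<lambda>p. D p > 0) (nhds z)"
      by (rule order_tendstoD(1)[OF nhds[OF cD] Dpos])
    show "eventually (\<lambda>p. t\<^sup>2 / D p - (\<alpha> p)\<^sup>2 > 0) (nhds z)"
      by (rule order_tendstoD(1)[OF nhds[OF cr] \<beta>pos])
    have "(f1 \<longlongrightarrow> w $ 1) (nhds z)" "(f2 \<longlongrightarrow> w $ 2) (nhds z)"
      using nhds[OF c1] nhds[OF c2] unfolding f1z f2z by auto
    then show "eventually (\<lambda>p. \<bar>f1 p - w $ 1\<bar> < \<eta> / 2) (nhds z)" "eventually (\<lambda>p. \<bar>f2 p - w $ 2\<bar> < \<eta> / 2) (nhds z)"
      using \<eta> by (auto simp: tendsto_iff dist_real_def dest!: spec[of _ "\<eta> / 2"])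
  qed
  then obtain \<gamma> where \<gamma>: "\<gamma> > 0" "\<And>p. dist p z < \<gamma> \<Longrightarrow> D p > 0 \<and> t\<^sup>2 / D p - (\<alpha> p)\<^sup>2 > 0 \<and> \<bar>f1 p - w $ 1\<bar> < \<eta> / 2 \<and> \<bar>f2 p - w $ 2\<bar> < \<eta> / 2"
    unfolding eventually_nhds_metric by blast
  have "\<exists>p'. dist p' w < \<eta> \<and> dist p p' = s \<and> dist p' c = t" if "dist p z < \<gamma>" for p
  proof -
    define p' where "p' = (vector [f1 p, f2 p] :: point2)"
    have p': "p' $ 1 = f1 p" "p' $ 2 = f2 p" by (simp_all add: p'_def vector_2)
    from \<gamma>(2)[OF that] have P: "D p > 0" "t\<^sup>2 / D p - (\<alpha> p)\<^sup>2 > 0" "\<bar>f1 p - w $ 1\<bar> < \<eta> / 2" "\<bar>f2 p - w $ 2\<bar> < \<eta> / 2" by auto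
    define u1 u2 where "u1 = p $ 1 - c $ 1" "u2 = p $ 2 - c $ 2"
    have Du: "D p = u1\<^sup>2 + u2\<^sup>2" by (simp add: D_def u1_u2_def)
    have "(\<beta> p)\<^sup>2 = t\<^sup>2 / D p - (\<alpha> p)\<^sup>2"
      using P(2) det unfolding \<beta>_def by (simp add: power_mult_distrib sgn_if)
    then have ab: "((\<alpha> p)\<^sup>2 + (\<beta> p)\<^sup>2) * D p = t\<^sup>2" using P(1) by simp
    have a: "2 * \<alpha> p * D p = t\<^sup>2 - s\<^sup>2 + D p" using P(1) by (simp add: \<alpha>_def)
    have "(f1 p - c $ 1)\<^sup>2 + (f2 p - c $ 2)\<^sup>2 = ((\<alpha> p)\<^sup>2 + (\<beta> p)\<^sup>2) * D p"
      unfolding f1_def f2_def Du u1_u2_def by (simp add: power2_eq_square algebra_simps)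
    then have 1: "dist p' c = t" unfolding dist_point2_eq_iff[OF t(2)] p' ab .
    have "(p $ 1 - f1 p)\<^sup>2 + (p $ 2 - f2 p)\<^sup>2 = ((\<alpha> p)\<^sup>2 + (\<beta> p)\<^sup>2) * D p + D p - 2 * \<alpha> p * D p"
      unfolding f1_def f2_def Du u1_u2_def by (simp add: power2_eq_square algebra_simps)
    also have "\<dots> = s\<^sup>2" unfolding ab a by simp
    finally have 2: "dist p p' = s" unfolding dist_point2_eq_iff[OF s(2)] p' .
    have "dist p' w < \<eta>" by (rule dist_point2_less) (use P p' in auto)
    with 1 2 show ?thesis by blast
  qed
  then show ?thesis using \<gamma>(1) by blast
qed

text \<open>A circle is connected and has more than one point, so each of its points is a limit
  point of it.\<close>

lemma circle_points:
  fixes z c :: point2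
  assumes "dist z c = s" "s > 0" "\<gamma> > 0"
  shows "\<exists>S. finite S \<and> card S = N \<and> (\<forall>p\<in>S. dist p c = s \<and> dist p z < \<gamma>)"
proof -
  have "connected (sphere c s)" by (rule connected_sphere) simp
  moreover have z: "z \<in> sphere c s" using assms by (simp add: dist_commute)
  moreover have "\<not> (\<exists>x. sphere c s = {x})"
  proof
    assume "\<exists>x. sphere c s = {x}"
    then obtain x where x: "sphere c s = {x}" by blast
    have "2 *\<^sub>R c - z \<in> sphere c s"
      using assms by (simp add: dist_norm scaleR_2 norm_minus_commute)
    then have "2 *\<^sub>R c - z = z" using z unfolding x singleton_iff by simp
    then have "2 *\<^sub>R c = 2 *\<^sub>R z" by (metis diff_add_cancel scaleR_2)
    then have "c = z" by (simp only: scaleR_cancel_left) simp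
    then show False using assms by simp
  qed
  ultimately have "z islimpt sphere c s" by (metis connected_imp_perfect)
  then have "infinite (sphere c s \<inter> ball z \<gamma>)" using assms by (simp add: islimpt_eq_infinite_ball)
  then obtain S where S: "S \<subseteq> sphere c s \<inter> ball z \<gamma>" "finite S" "card S = N"
    using infinite_arbitrarily_large by metis
  have "\<forall>p\<in>S. dist p c = s \<and> dist p z < \<gamma>" using S(1) by (auto simp: dist_commute)
  then show ?thesis using S(2,3) by blast
qed

section \<open>Lower bounds from parametrised families of chains\<close>

lemma chains_mono: "P \<subseteq> P' \<Longrightarrow> chains \<delta> k P \<subseteq> chains \<delta> k P'"
  by (auto simp: chains_def)

lemma card_chains_le_C2:
  assumes "finite P" "card P \<le> n"
  shows "card (chains \<delta> k P) \<le> C2 \<delta> k n"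
proof -
  have "infinite (UNIV - P)" using assms(1) by (simp add: infinite_UNIV_char_0 Diff_infinite_finite)
  then obtain R where R: "R \<subseteq> UNIV - P" "finite R" "card R = n - card P"
    using infinite_arbitrarily_large by metis
  have "card (P \<union> R) = n" using R assms by (subst card_Un_disjoint) auto
  have "card (chains \<delta> k (P \<union> R)) \<le> C2 \<delta> k n"
  proof (rule C2_cases[where n = n and \<delta> = \<delta> and k = k])
    fix Q assume "\<And>P'. finite P' \<Longrightarrow> card P' = n \<Longrightarrow> card (chains \<delta> k P') \<le> C2 \<delta> k n"
    then show ?thesis using R assms \<open>card (P \<union> R) = n\<close> by simp
  qed
  moreover have "card (chains \<delta> k P) \<le> card (chains \<delta> k (P \<union> R))"
    using R assms by (intro card_mono finite_chains chains_mono) auto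
  ultimately show ?thesis by simp
qed

text \<open>The points at position \<open>i\<close> stay within \<open>\<eta>\<close> of
  \<open>z i\<close>, and different \<open>z i\<close> are at least \<open>2 * \<eta>\<close> apart.
  Hence the points of each member are distinct, and only the distances along the chain have to be
  arranged.\<close>

lemma C2_lower_of_family:
  fixes p :: "'c \<Rightarrow> nat \<Rightarrow> point2"
  assumes W: "\<And>i. i \<le> k \<Longrightarrow> finite (W i) \<and> card (W i) \<le> N"
    and p: "\<And>x i. x \<in> I \<Longrightarrow> i \<le> k \<Longrightarrow> p x i \<in> W i \<and> dist (p x i) (z i) < \<eta>"
    and d: "\<And>x i. x \<in> I \<Longrightarrow> i < k \<Longrightarrow> dist (p x i) (p x (Suc i)) = \<delta> i"
    and sep: "\<And>i j. i \<le> k \<Longrightarrow> j \<le> k \<Longrightarrow> i \<noteq> j \<Longrightarrow> 2 * \<eta> \<le> dist (z i) (z j)"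
    and inj: "\<And>x y. x \<in> I \<Longrightarrow> y \<in> I \<Longrightarrow> (\<And>i. i \<le> k \<Longrightarrow> p x i = p y i) \<Longrightarrow> x = y"
    and n: "(k + 1) * N \<le> n"
  shows "card I \<le> C2 \<delta> k n"
proof -
  define P where "P = (\<Union>i\<in>{..k}. W i)"
  have fP: "finite P" using W by (auto simp: P_def)
  have "card P \<le> (\<Sum>i\<in>{..k}. card (W i))" unfolding P_def by (rule card_UN_le) simp
  also have "\<dots> \<le> card {..k} * N" by (rule sum_le_card_mult) (use W in auto)
  finally have cP: "card P \<le> n" using n by simp
  let ?f = "\<lambda>x. map (p x) [0..<Suc k]"
  have nth: "?f x ! i = p x i" if "i \<le> k" for x i
    using that nth_map_upt[of i "Suc k" 0 "p x"] by (simp del: upt_Suc)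
  have "card I \<le> card (chains \<delta> k P)"
  proof (rule card_inj_on_le[of ?f])
    show "inj_on ?f I"
    proof (rule inj_onI)
      fix x y assume xy: "x \<in> I" "y \<in> I" "?f x = ?f y"
      show "x = y"
      proof (rule inj[OF xy(1,2)])
        fix i assume "i \<le> k"
        then show "p x i = p y i" using nth xy(3) by metis
      qed
    qed
    show "?f ` I \<subseteq> chains \<delta> k P"
    proof (rule image_subsetI)
      fix x assume x: "x \<in> I"
      have "distinct (?f x)"
      proof (subst distinct_map, intro conjI inj_onI)
        fix i j assume ij: "i \<in> set [0..<Suc k]" "j \<in> set [0..<Suc k]" "p x i = p x j"
        show "i = j"
        proof (rule ccontr)
          assume "i \<noteq> j"
          then have "2 * \<eta> \<le> dist (z i) (z j)" using ij by (intro sep) auto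
          also have "\<dots> \<le> dist (p x i) (z i) + dist (p x j) (z j)"
            using dist_triangle2[of "z i" "z j" "p x i"] ij(3) by (simp add: dist_commute)
          also have "\<dots> < \<eta> + \<eta>" using p[OF x, of i] p[OF x, of j] ij by (intro add_strict_mono) auto
          finally show False by simp
        qed
      qed simp
      moreover have "set (?f x) \<subseteq> P" using p[OF x] by (auto simp: P_def less_Suc_eq_le simp del: upt_Suc)
      moreover have "\<forall>j<k. dist (?f x ! j) (?f x ! Suc j) = \<delta> j"
        using d[OF x] nth by (auto simp del: upt_Suc)
      ultimately show "?f x \<in> chains \<delta> k P" by (auto simp: chains_def simp del: upt_Suc)
    qed
    show "finite (chains \<delta> k P)" by (rule finite_chains[OF fP])
  qed
  also have "\<dots> \<le> C2 \<delta> k n" by (rule card_chains_le_C2[OF fP cP])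
  finally show ?thesis .
qed

section \<open>Concentrating unit distances near two points\<close>

lemma u2_attained:
  obtains P :: "point2 set" where "finite P" "card P = n" "u2 n \<le> inc 1 P P"
proof -
  let ?V = "{card {{p, q} | p q. p \<in> P \<and> q \<in> P \<and> dist p q = 1} | P :: point2 set. finite P \<and> card P = n}"
  have "?V \<noteq> {}" using exists_card_point2[of n] by auto
  then have "u2 n \<in> ?V" unfolding u2_def by (rule Max_in[OF finite_u2_values])
  then obtain P :: "point2 set" where P: "finite P" "card P = n" "u2 n = card {{p, q} | p q. p \<in> P \<and> q \<in> P \<and> dist p q = 1}"
    by auto
  have fin: "finite {(a, b). a \<in> P \<and> b \<in> P \<and> dist a b = 1}"
    by (rule finite_subset[of _ "P \<times> P"]) (use P in auto)
  have "{{p, q} | p q. p \<in> P \<and> q \<in> P \<and> dist p q = 1} = (\<lambda>(a, b). {a, b}) ` {(a, b). a \<in> P \<and> b \<in> P \<and> dist a b = 1}"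
    by auto
  then have "u2 n \<le> inc 1 P P" unfolding P(3) inc_def using card_image_le[OF fin] by metis
  then show thesis using that P by blast
qed

lemma card_residue_class: "card {m. m < n \<and> m mod T = t} \<le> n div T + 1" for n T t :: nat
proof -
  have "card {m. m < n \<and> m mod T = t} \<le> card {..n div T}"
  proof (rule card_inj_on_le[of "\<lambda>m. m div T"])
    show "inj_on (\<lambda>m. m div T) {m. m < n \<and> m mod T = t}"
      by (rule inj_onI) (metis (mono_tags) mem_Collect_eq mult_div_mod_eq)
  qed (auto intro: div_le_mono)
  then show ?thesis by simp
qed

lemma balanced_colouring:
  assumes "finite P"
  obtains col :: "'a \<Rightarrow> nat" where "\<And>t. card {p \<in> P. col p = t} \<le> card P div T + 1" "\<And>p. T > 0 \<Longrightarrow> col p < T"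
proof -
  obtain h where h: "bij_betw h P {0..<card P}" using ex_bij_betw_finite_nat[OF assms] by blast
  have "card {p \<in> P. h p mod T = t} \<le> card P div T + 1" for t
  proof -
    have "card {p \<in> P. h p mod T = t} \<le> card {m. m < card P \<and> m mod T = t}"
      by (rule card_inj_on_le[of h]) (use h in \<open>auto simp: bij_betw_def inj_on_def\<close>)
    then show ?thesis using card_residue_class[of "card P" T t] by linarith
  qed
  then show thesis using that[of "\<lambda>p. h p mod T"] by simp
qed

lemma sum_card_fibres_le:
  assumes "finite P" "finite C"
  shows "(\<Sum>c\<in>C. card {p \<in> P. f p = c}) \<le> card P"
proof -
  have "(\<Sum>c\<in>C. card {p \<in> P. f p = c}) = card (\<Union>c\<in>C. {p \<in> P. f p = c})"
    using assms by (intro card_UN_disjoint[symmetric]) auto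
  also have "\<dots> \<le> card P" using assms by (intro card_mono) auto
  finally show ?thesis .
qed

text \<open>If every \<open>c\<close> had less than its share of \<open>e\<close> relative to the
  weight \<open>m c\<close>, summation would give a contradiction. Products avoid division by a
  vanishing weight.\<close>

lemma weighted_average:
  fixes m e :: "'c \<Rightarrow> nat"
  assumes "finite C" "C \<noteq> {}" "sum m C \<le> k"
  shows "\<exists>c\<in>C. m c * sum e C \<le> k * e c"
proof (rule ccontr)
  assume "\<not> ?thesis"
  then have "(\<Sum>c\<in>C. k * e c) < (\<Sum>c\<in>C. m c * sum e C)"
    using assms by (intro sum_strict_mono) auto
  also have "\<dots> = sum m C * sum e C" by (simp add: sum_distrib_right)
  also have "\<dots> \<le> k * sum e C" by (rule mult_le_mono1[OF assms(3)])
  finally show False by (simp add: sum_distrib_left)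
qed

definition e1 :: point2 where "e1 = vector [1, 0]"

lemma e1_nth [simp]: "e1 $ 1 = 1" "e1 $ 2 = 0"
  by (simp_all add: e1_def vector_2)

lemma norm_e1 [simp]: "norm e1 = 1"
  using dist_point2[of e1 0] by simp

lemma separated_shifts:
  fixes F :: "point2 set"
  assumes F: "finite F" and \<sigma>: "\<sigma> > 0"
  shows "\<exists>\<zeta>>0. real q * \<zeta> \<le> \<sigma> \<and> (\<forall>p\<in>F. \<forall>p'\<in>F. \<forall>i<q. \<forall>j<q.
       p + (real i * \<zeta>) *\<^sub>R e1 = p' + (real j * \<zeta>) *\<^sub>R e1 \<longrightarrow> p = p' \<and> i = j)"
proof -
  let ?D = "insert \<sigma> ((\<lambda>x. dist (fst x) (snd x)) ` {x \<in> F \<times> F. fst x \<noteq> snd x})"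
  define m where "m = Min ?D"
  have fin: "finite ?D" using F by simp
  have m0: "m > 0" unfolding m_def using fin \<sigma> by (subst Min_gr_iff) auto
  have m\<sigma>: "m \<le> \<sigma>" unfolding m_def using fin by (intro Min_le) auto
  have mF: "m \<le> dist p p'" if "p \<in> F" "p' \<in> F" "p \<noteq> p'" for p p'
    unfolding m_def by (intro Min_le[OF fin] insertI2 image_eqI[of _ _ "(p, p')"]) (use that in simp_all)
  \<comment> \<open>All shifts together cover a length below \<open>m\<close>, hence below the
    smallest distance in \<open>F\<close>, so different points cannot collide. The entry
    \<open>\<sigma>\<close> in \<open>?D\<close> keeps the copies close to the originals.\<close>
  define \<zeta> where "\<zeta> = m / (real q + 1)"
  have \<zeta>0: "\<zeta> > 0" using m0 by (simp add: \<zeta>_def)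
  have q\<zeta>: "real q * \<zeta> < m" using m0 by (simp add: \<zeta>_def field_simps)
  have "p = p' \<and> i = j" if A: "p \<in> F" "p' \<in> F" "i < q" "j < q" "p + (real i * \<zeta>) *\<^sub>R e1 = p' + (real j * \<zeta>) *\<^sub>R e1" for p p' i j
  proof -
    have eq: "p - p' = ((real j - real i) * \<zeta>) *\<^sub>R e1" using A(5) by (simp add: algebra_simps)
    have "\<bar>real j - real i\<bar> \<le> real q" using A(3,4) by linarith
    then have "\<bar>real j - real i\<bar> * \<zeta> \<le> real q * \<zeta>" using \<zeta>0 by (intro mult_right_mono) auto
    moreover have "dist p p' = \<bar>real j - real i\<bar> * \<zeta>" unfolding dist_norm eq using \<zeta>0 by (simp add: abs_mult)
    ultimately have "dist p p' < m" using q\<zeta> by linarith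
    then have "p = p'" using mF[OF A(1,2)] by linarith
    then have "((real j - real i) * \<zeta>) *\<^sub>R e1 = 0" using eq by simp
    moreover have "e1 \<noteq> 0" using norm_e1 by (metis norm_zero zero_neq_one)
    ultimately show ?thesis using \<zeta>0 \<open>p = p'\<close> by simp
  qed
  moreover have "real q * \<zeta> \<le> \<sigma>" using q\<zeta> m\<sigma> by linarith
  ultimately show ?thesis using \<zeta>0 by blast
qed

text \<open>Simultaneous translation preserves unit distances. The \<open>q\<close> translates are
  disjoint, so the unit distances within them add up, at the price of at most \<open>q\<close> times
  as many points.\<close>

lemma shifted_copies:
  fixes A B :: "point2 set"
  assumes fin: "finite A" "finite B" and \<sigma>: "\<sigma> > 0"
    and A: "\<And>a. a \<in> A \<Longrightarrow> dist a 0 < \<rho>" and B: "\<And>b. b \<in> B \<Longrightarrow> dist b e1 < \<rho>"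
  shows "\<exists>A' B'. finite A' \<and> finite B' \<and> card A' \<le> q * card A \<and> card B' \<le> q * card B \<and>
    (\<forall>a\<in>A'. dist a 0 < \<rho> + \<sigma>) \<and> (\<forall>b\<in>B'. dist b e1 < \<rho> + \<sigma>) \<and> q * inc 1 A B \<le> inc 1 A' B'"
proof -
  have fF: "finite (A \<union> B)" using fin by simp
  obtain \<zeta> where \<zeta>: "\<zeta> > 0" "real q * \<zeta> \<le> \<sigma>"
    "\<And>p p' i j. p \<in> A \<union> B \<Longrightarrow> p' \<in> A \<union> B \<Longrightarrow> i < q \<Longrightarrow> j < q \<Longrightarrow>
       p + (real i * \<zeta>) *\<^sub>R e1 = p' + (real j * \<zeta>) *\<^sub>R e1 \<Longrightarrow> p = p' \<and> i = j"
    using separated_shifts[OF fF \<sigma>, of q] by blast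
  define sh where "sh i p = p + (real i * \<zeta>) *\<^sub>R e1" for i p
  define A' where "A' = (\<lambda>(i, p). sh i p) ` ({..<q} \<times> A)"
  define B' where "B' = (\<lambda>(i, p). sh i p) ` ({..<q} \<times> B)"
  have near: "dist (sh i p) x < \<rho> + \<sigma>" if "dist p x < \<rho>" "i < q" for i p x
  proof -
    have "real i * \<zeta> \<le> \<sigma>" using \<zeta>(1,2) that(2) by (meson less_imp_le mult_right_mono of_nat_le_iff order_trans)
    moreover have "dist (sh i p) p = real i * \<zeta>" using \<zeta>(1) by (simp add: sh_def dist_norm)
    ultimately show ?thesis using dist_triangle[of "sh i p" x p] that(1) by linarith
  qed
  show ?thesis
  proof (rule exI[of _ A'], rule exI[of _ B'], intro conjI ballI)
    show "finite A'" "finite B'" using fin by (auto simp: A'_def B'_def)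
    show "card A' \<le> q * card A"
      unfolding A'_def using card_image_le[of "{..<q} \<times> A" "\<lambda>(i, p). sh i p"] fin by (simp add: card_cartesian_product)
    show "card B' \<le> q * card B"
      unfolding B'_def using card_image_le[of "{..<q} \<times> B" "\<lambda>(i, p). sh i p"] fin by (simp add: card_cartesian_product)
    fix a assume "a \<in> A'"
    then show "dist a 0 < \<rho> + \<sigma>"
    proof -
      assume "a \<in> A'"
      then obtain i p where "a = sh i p" "i < q" "p \<in> A" by (auto simp: A'_def)
      then show ?thesis using near[OF A] by simp
    qed
  next
    fix b assume "b \<in> B'"
    then show "dist b e1 < \<rho> + \<sigma>"
    proof -
      assume "b \<in> B'"
      then obtain i p where "b = sh i p" "i < q" "p \<in> B" by (auto simp: B'_def)
      then show ?thesis using near[OF B] by simp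
    qed
  next
    let ?I = "{(a, b). a \<in> A \<and> b \<in> B \<and> dist a b = 1}" and ?I' = "{(a, b). a \<in> A' \<and> b \<in> B' \<and> dist a b = 1}"
    have "card ({..<q} \<times> ?I) \<le> card ?I'"
    proof (rule card_inj_on_le[of "\<lambda>(i, a, b). (sh i a, sh i b)"])
      show "inj_on (\<lambda>(i, a, b). (sh i a, sh i b)) ({..<q} \<times> ?I)"
      proof (rule inj_onI)
        fix x y assume x: "x \<in> {..<q} \<times> ?I" "y \<in> {..<q} \<times> ?I" "(\<lambda>(i, a, b). (sh i a, sh i b)) x = (\<lambda>(i, a, b). (sh i a, sh i b)) y"
        obtain i a b j c d where xy: "x = (i, a, b)" "y = (j, c, d)" by (metis prod.collapse)
        have "a = c \<and> i = j" by (rule \<zeta>(3)) (use x in \<open>auto simp: xy sh_def\<close>)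
        moreover have "b = d \<and> i = j" by (rule \<zeta>(3)) (use x in \<open>auto simp: xy sh_def\<close>)
        ultimately show "x = y" by (simp add: xy)
      qed
      show "(\<lambda>(i, a, b). (sh i a, sh i b)) ` ({..<q} \<times> ?I) \<subseteq> ?I'"
        unfolding A'_def B'_def by (force simp: sh_def)
      show "finite ?I'" by (rule finite_subset[of _ "A' \<times> B'"]) (use fin in \<open>auto simp: A'_def B'_def\<close>)
    qed
    then show "q * inc 1 A B \<le> inc 1 A' B'" by (simp add: inc_def card_cartesian_product)
  qed
qed

lemma rotate_to_e1:
  fixes a0 b0 :: point2
  assumes "dist a0 b0 = 1"
  shows "\<exists>\<tau> :: point2 \<Rightarrow> point2. (\<forall>p q. dist (\<tau> p) (\<tau> q) = dist p q) \<and> \<tau> a0 = 0 \<and> \<tau> b0 = e1"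
proof -
  define w1 w2 where "w1 = b0 $ 1 - a0 $ 1" "w2 = b0 $ 2 - a0 $ 2"
  have w: "w1\<^sup>2 + w2\<^sup>2 = 1"
    using assms dist_point2_eq_iff[of 1 b0 a0] by (simp add: w1_w2_def dist_commute)
  \<comment> \<open>After \<open>a0\<close> has been moved to the origin, this is multiplication by
    the complex conjugate of the unit vector \<open>w\<close>.\<close>
  define \<tau> where "\<tau> p = (vector [w1 * (p $ 1 - a0 $ 1) + w2 * (p $ 2 - a0 $ 2), w1 * (p $ 2 - a0 $ 2) - w2 * (p $ 1 - a0 $ 1)] :: point2)" for p :: point2
  have \<tau>: "\<tau> p $ 1 = w1 * (p $ 1 - a0 $ 1) + w2 * (p $ 2 - a0 $ 2)" "\<tau> p $ 2 = w1 * (p $ 2 - a0 $ 2) - w2 * (p $ 1 - a0 $ 1)" for p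
    by (simp_all add: \<tau>_def vector_2)
  show ?thesis
  proof (intro exI[of _ \<tau>] conjI allI)
    fix p q
    have "(\<tau> p $ 1 - \<tau> q $ 1)\<^sup>2 + (\<tau> p $ 2 - \<tau> q $ 2)\<^sup>2 = (w1\<^sup>2 + w2\<^sup>2) * ((p $ 1 - q $ 1)\<^sup>2 + (p $ 2 - q $ 2)\<^sup>2)"
      unfolding \<tau> by (simp add: power2_eq_square algebra_simps)
    then show "dist (\<tau> p) (\<tau> q) = dist p q" unfolding dist_point2 w by simp
  next
    show "\<tau> a0 = 0" by (rule point2_eqI) (simp_all add: \<tau>)
    show "\<tau> b0 = e1"
      by (rule point2_eqI) (use w in \<open>simp_all add: \<tau> w1_w2_def[symmetric] power2_eq_square\<close>)
  qed
qed

definition grid_cell :: "real \<Rightarrow> point2 \<Rightarrow> int \<times> int" where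
  "grid_cell s p = (\<lfloor>p $ 1 / s\<rfloor>, \<lfloor>p $ 2 / s\<rfloor>)"

lemma abs_diff_scaled:
  fixes x y s :: real
  assumes "s > 0"
  shows "\<bar>x - y\<bar> = \<bar>x / s - y / s\<bar> * s"
proof -
  have "x - y = (x / s - y / s) * s" using assms by (simp add: left_diff_distrib)
  then have "\<bar>x - y\<bar> = \<bar>x / s - y / s\<bar> * \<bar>s\<bar>" by (simp only: abs_mult)
  then show ?thesis using assms by simp
qed

lemma grid_cell_dist:
  assumes "s > 0" "grid_cell s p = grid_cell s q"
  shows "dist p q < 2 * s"
proof -
  have "\<bar>x - y\<bar> < s" if "\<lfloor>x / s\<rfloor> = \<lfloor>y / s\<rfloor>" for x y
  proof -
    have "\<bar>x / s - y / s\<bar> < 1" using that by linarith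
    then have "\<bar>x / s - y / s\<bar> * s < 1 * s" using assms(1) by (rule mult_strict_right_mono)
    then show ?thesis unfolding abs_diff_scaled[OF assms(1), of x y] by simp
  qed
  then show ?thesis using assms(2) by (intro dist_point2_less) (auto simp: grid_cell_def)
qed

text \<open>The range of offsets depends on \<open>s\<close> alone, so sorting the unit distances by
  the offset of their cells costs only a constant factor.\<close>

lemma grid_cell_offset:
  assumes "s > 0" "dist p q = 1"
  shows "grid_cell s q - grid_cell s p \<in> {-(\<lceil>1 / s\<rceil> + 1)..\<lceil>1 / s\<rceil> + 1} \<times> {-(\<lceil>1 / s\<rceil> + 1)..\<lceil>1 / s\<rceil> + 1}"
proof -
  have "\<lfloor>y / s\<rfloor> - \<lfloor>x / s\<rfloor> \<in> {-(\<lceil>1 / s\<rceil> + 1)..\<lceil>1 / s\<rceil> + 1}" if "\<bar>x - y\<bar> \<le> 1" for x y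
  proof -
    have "\<bar>x / s - y / s\<bar> \<le> 1 / s"
      using assms(1) that abs_diff_scaled[OF assms(1), of x y] by (simp add: pos_le_divide_eq)
    moreover have "1 / s \<le> of_int \<lceil>1 / s\<rceil>" by simp
    moreover have "of_int \<lfloor>x / s\<rfloor> \<le> x / s" "x / s < of_int \<lfloor>x / s\<rfloor> + 1" "of_int \<lfloor>y / s\<rfloor> \<le> y / s" "y / s < of_int \<lfloor>y / s\<rfloor> + 1"
      by simp_all
    ultimately have "real_of_int \<lfloor>y / s\<rfloor> < real_of_int (\<lfloor>x / s\<rfloor> + 1 + \<lceil>1 / s\<rceil>)"
      "real_of_int \<lfloor>x / s\<rfloor> < real_of_int (\<lfloor>y / s\<rfloor> + 1 + \<lceil>1 / s\<rceil>)"
      unfolding of_int_add of_int_1 by linarith+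
    then show ?thesis unfolding of_int_less_iff atLeastAtMost_iff by linarith
  qed
  moreover have "\<bar>p $ 1 - q $ 1\<bar> \<le> 1" "\<bar>p $ 2 - q $ 2\<bar> \<le> 1"
    using assms(2) component_le_norm_cart[of "p - q" 1] component_le_norm_cart[of "p - q" 2] by (simp_all add: dist_norm)
  ultimately show ?thesis by (simp add: grid_cell_def minus_prod_def)
qed

lemma two_quarters_le: "4 \<le> N \<Longrightarrow> 2 * (N div 4 + 1) \<le> N" for N :: nat
  by presburger

text \<open>Some pair of grid cells carries its share of the unit distances of an optimal configuration, relative to the
  number of points in the two cells. Slightly translated copies of these points restore the number of edges.
  Colouring the points first keeps the cells so small that the copies use few points.\<close>
lemma local_unit_configuration:
  assumes \<eta>: "\<eta> > 0" and K: "K \<ge> 1"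
  obtains C :: nat where "C > 0" "\<And>n. n \<ge> 4 * K \<Longrightarrow> \<exists>A B. finite A \<and> finite B \<and> card A + card B \<le> n div K \<and>
     (\<forall>a\<in>A. dist a 0 < \<eta>) \<and> (\<forall>b\<in>B. dist b e1 < \<eta>) \<and> u2 n \<le> C * inc 1 A B"
proof -
  \<comment> \<open>Points of one cell are less than \<open>2 * s\<close> apart and the translations
    add at most \<open>s\<close>; altogether this is \<open>3 * s\<close>, less than
    \<open>\<eta>\<close>.\<close>
  define s where "s = \<eta> / 4"
  have s: "s > 0" using \<eta> by (simp add: s_def)
  let ?R = "{-(\<lceil>1 / s\<rceil> + 1)..\<lceil>1 / s\<rceil> + 1}"
  let ?codes = "(?R \<times> ?R) \<times> {..<K * 4} \<times> {..<K * 4}"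
  define C1 where "C1 = card ?codes"
  have "C1 > 0"
  proof -
    have "0 < 1 / s" using s by simp
    then have "-1 < 1 / s" by linarith
    then have "0 \<le> \<lceil>1 / s\<rceil>" by (simp only: zero_le_ceiling)
    then have "0 \<in> ?R" unfolding atLeastAtMost_iff by linarith
    then have "((0, 0), 0, 0) \<in> ?codes" using K by (intro SigmaI) auto
    then show ?thesis unfolding C1_def by (subst card_gt_0_iff) blast
  qed
  have main: "\<exists>A B. finite A \<and> finite B \<and> card A + card B \<le> n div K \<and>
     (\<forall>a\<in>A. dist a 0 < \<eta>) \<and> (\<forall>b\<in>B. dist b e1 < \<eta>) \<and> u2 n \<le> (8 * K * C1) * inc 1 A B" if n: "n \<ge> 4 * K" for n
  proof -
    obtain P :: "point2 set" where P: "finite P" "card P = n" "u2 n \<le> inc 1 P P" by (rule u2_attained)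
    \<comment> \<open>With \<open>4 * K\<close> colours, two colour classes together have at most
      \<open>n div K\<close> points as soon as \<open>n div K\<close> is at least 4. At least one
      copy of any pair of cells therefore fits into the available room.\<close>
    obtain col :: "point2 \<Rightarrow> nat" where col: "\<And>t. card {p \<in> P. col p = t} \<le> n div (K * 4) + 1" "\<And>p. col p < K * 4"
      using balanced_colouring[OF P(1), of "K * 4"] K P(2) by auto
    define E where "E = {(a, b). a \<in> P \<and> b \<in> P \<and> dist a b = 1}"
    define code where "code x = (grid_cell s (snd x) - grid_cell s (fst x), col (fst x), col (snd x))" for x
    have finE: "finite E" by (rule finite_subset[of _ "P \<times> P"]) (use P in \<open>auto simp: E_def\<close>)
    have uE: "u2 n \<le> card E" using P(3) by (simp add: inc_def E_def)
    have "E \<noteq> {}"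
    proof
      assume "E = {}"
      then have "u2 n = 0" using uE by simp
      then show False using u2_ge[of n] n K by simp
    qed
    have codes: "code x \<in> ?codes" if "x \<in> E" for x
      using grid_cell_offset[OF s, of "fst x" "snd x"] that col(2) by (auto simp: code_def E_def)
    obtain c0 where c0: "{x \<in> E. code x = c0} \<noteq> {}" "card E \<le> C1 * card {x \<in> E. code x = c0}"
      unfolding C1_def by (rule pigeonhole_fibre[OF finE \<open>E \<noteq> {}\<close> _ codes]) simp
    obtain v t t' where c0_eq: "c0 = (v, t, t')" by (cases c0)
    define E' where "E' = {x \<in> E. code x = c0}"
    have E': "x \<in> E" "grid_cell s (snd x) = grid_cell s (fst x) + v" "col (fst x) = t" "col (snd x) = t'"
      "fst x \<in> P" "snd x \<in> P" "dist (fst x) (snd x) = 1" if "x \<in> E'" for x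
      using that by (auto simp: E'_def code_def c0_eq E_def algebra_simps)
    have finE': "finite E'" using finE by (simp add: E'_def)
    \<comment> \<open>All edges of \<open>E'\<close> have the same offset \<open>v\<close>, so a
      cell \<open>c\<close> stands for the pair of cells \<open>c\<close> and
      \<open>c + v\<close>.\<close>
    define cells where "cells = (\<lambda>x. grid_cell s (fst x)) ` E'"
    define A where "A c = {p \<in> {p \<in> P. col p = t}. grid_cell s p = c}" for c
    define B where "B c = {p \<in> {p \<in> P. col p = t'}. grid_cell s p - v = c}" for c
    define e where "e c = card {x \<in> E'. grid_cell s (fst x) = c}" for c
    have fcells: "finite cells" "cells \<noteq> {}" using finE' c0 by (auto simp: cells_def E'_def)
    have fAB: "finite (A c)" "finite (B c)" for c using P by (auto simp: A_def B_def)
    have cardAB: "card (A c) + card (B c) \<le> n div K" for c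
    proof -
      have "card (A c) \<le> card {p \<in> P. col p = t}" "card (B c) \<le> card {p \<in> P. col p = t'}"
        using P by (auto intro!: card_mono simp: A_def B_def)
      then have le: "card (A c) + card (B c) \<le> 2 * (n div K div 4 + 1)"
        using col(1)[of t] col(1)[of t'] by (simp add: div_mult2_eq)
      have "4 \<le> n div K" using n K by (simp add: less_eq_div_iff_mult_less_eq)
      then have "2 * (n div K div 4 + 1) \<le> n div K" by (rule two_quarters_le)
      with le show ?thesis by (rule order_trans)
    qed
    have sumAB: "(\<Sum>c\<in>cells. card (A c) + card (B c)) \<le> 2 * n"
    proof -
      have "(\<Sum>c\<in>cells. card (A c)) \<le> card {p \<in> P. col p = t}"
        unfolding A_def by (rule sum_card_fibres_le) (use P fcells in auto)
      moreover have "(\<Sum>c\<in>cells. card (B c)) \<le> card {p \<in> P. col p = t'}"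
        unfolding B_def by (rule sum_card_fibres_le) (use P fcells in auto)
      moreover have "card {p \<in> P. col p = t''} \<le> n" for t'' unfolding P(2)[symmetric] using P by (intro card_mono) auto
      then have "card {p \<in> P. col p = t} \<le> n" "card {p \<in> P. col p = t'} \<le> n" by blast+
      ultimately show ?thesis unfolding sum.distrib by linarith
    qed
    have sume: "(\<Sum>c\<in>cells. e c) = card E'"
    proof -
      have "E' = (\<Union>c\<in>cells. {x \<in> E'. grid_cell s (fst x) = c})" by (auto simp: cells_def)
      then have "card E' = card (\<Union>c\<in>cells. {x \<in> E'. grid_cell s (fst x) = c})" by simp
      also have "\<dots> = (\<Sum>c\<in>cells. e c)" unfolding e_def using fcells finE' by (intro card_UN_disjoint) auto
      finally show ?thesis by simp
    qed
    obtain c where c: "c \<in> cells" "(card (A c) + card (B c)) * card E' \<le> 2 * n * e c"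
      using weighted_average[OF fcells sumAB, of e] unfolding sume by blast
    obtain x0 where x0: "x0 \<in> E'" "grid_cell s (fst x0) = c" using c(1) by (auto simp: cells_def)
    have inA: "fst x \<in> A c" "snd x \<in> B c" if "x \<in> E'" "grid_cell s (fst x) = c" for x
      using E'[OF that(1)] that by (auto simp: A_def B_def)
    obtain \<tau> :: "point2 \<Rightarrow> point2" where \<tau>: "\<And>p q. dist (\<tau> p) (\<tau> q) = dist p q" "\<tau> (fst x0) = 0" "\<tau> (snd x0) = e1"
      using rotate_to_e1[OF E'(7)[OF x0(1)]] by blast
    have inj\<tau>: "inj \<tau>" using \<tau>(1) by (metis dist_eq_0_iff injI)
    have e_inc: "e c \<le> inc 1 (\<tau> ` A c) (\<tau> ` B c)"
      unfolding e_def inc_def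
    proof (rule card_inj_on_le[of "map_prod \<tau> \<tau>"])
      show "inj_on (map_prod \<tau> \<tau>) {x \<in> E'. grid_cell s (fst x) = c}"
        using inj\<tau> by (intro inj_on_subset[OF prod.inj_map]) auto
      show "map_prod \<tau> \<tau> ` {x \<in> E'. grid_cell s (fst x) = c} \<subseteq> {(a, b). a \<in> \<tau> ` A c \<and> b \<in> \<tau> ` B c \<and> dist a b = 1}"
      proof (rule image_subsetI)
        fix x assume "x \<in> {x \<in> E'. grid_cell s (fst x) = c}"
        then have "fst x \<in> A c" "snd x \<in> B c" "dist (fst x) (snd x) = 1" using inA E'(7) by auto
        then show "map_prod \<tau> \<tau> x \<in> {(a, b). a \<in> \<tau> ` A c \<and> b \<in> \<tau> ` B c \<and> dist a b = 1}"
          using \<tau>(1) by (cases x) auto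
      qed
      show "finite {(a, b). a \<in> \<tau> ` A c \<and> b \<in> \<tau> ` B c \<and> dist a b = 1}"
        by (rule finite_subset[of _ "\<tau> ` A c \<times> \<tau> ` B c"]) (use fAB in auto)
    qed
    \<comment> \<open>As many copies are taken as \<open>N\<close> points allow. Rounding wastes at
      most half of them, which is the bound \<open>N \<le> 2 * (q * m)\<close> below.\<close>
    define N m q where "N = n div K" "m = card (A c) + card (B c)" "q = N div m"
    have nearA: "dist a 0 < 2 * s" if "a \<in> \<tau> ` A c" for a
    proof -
      from that obtain p where p: "p \<in> A c" "a = \<tau> p" by blast
      then have "dist p (fst x0) < 2 * s" using x0 by (intro grid_cell_dist[OF s]) (auto simp: A_def)
      then show ?thesis using p(2) \<tau>(1)[of p "fst x0"] \<tau>(2) by simp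
    qed
    have nearB: "dist b e1 < 2 * s" if "b \<in> \<tau> ` B c" for b
    proof -
      from that obtain p where p: "p \<in> B c" "b = \<tau> p" by blast
      then have "grid_cell s p - v = c" by (simp add: B_def)
      then have "grid_cell s p = grid_cell s (snd x0)" using x0 E'(2)[OF x0(1)] by (metis diff_add_cancel)
      then have "dist p (snd x0) < 2 * s" by (rule grid_cell_dist[OF s])
      then show ?thesis using p(2) \<tau>(1)[of p "snd x0"] \<tau>(3) by simp
    qed
    have "\<exists>A' B'. finite A' \<and> finite B' \<and> card A' \<le> q * card (\<tau> ` A c) \<and> card B' \<le> q * card (\<tau> ` B c) \<and>
      (\<forall>a\<in>A'. dist a 0 < 2 * s + s) \<and> (\<forall>b\<in>B'. dist b e1 < 2 * s + s) \<and> q * inc 1 (\<tau> ` A c) (\<tau> ` B c) \<le> inc 1 A' B'"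
      by (rule shifted_copies[OF finite_imageI[OF fAB(1)] finite_imageI[OF fAB(2)] s nearA nearB])
    then obtain A' B' where AB': "finite A'" "finite B'" "card A' \<le> q * card (\<tau> ` A c)" "card B' \<le> q * card (\<tau> ` B c)"
      "\<And>a. a \<in> A' \<Longrightarrow> dist a 0 < 2 * s + s" "\<And>b. b \<in> B' \<Longrightarrow> dist b e1 < 2 * s + s" "q * inc 1 (\<tau> ` A c) (\<tau> ` B c) \<le> inc 1 A' B'"
      by blast
    have "card (\<tau> ` A c) = card (A c)" "card (\<tau> ` B c) = card (B c)"
      using inj\<tau> by (auto intro!: card_image simp: inj_on_def)
    then have "card A' + card B' \<le> q * m" using AB'(3,4) by (simp add: N_m_q_def algebra_simps)
    also have "\<dots> \<le> N" unfolding N_m_q_def(3) by simp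
    finally have cAB: "card A' + card B' \<le> n div K" by (simp add: N_m_q_def)
    have m: "0 < m" "m \<le> N"
      using inA(1)[OF x0] fAB cardAB by (auto simp: N_m_q_def card_gt_0_iff)
    have q: "N \<le> 2 * (q * m)"
    proof -
      have "1 \<le> q" using m by (simp add: N_m_q_def(3) div_greater_zero_iff Suc_le_eq)
      then have "m \<le> q * m" by simp
      moreover have "N = q * m + N mod m" by (simp add: N_m_q_def(3))
      moreover have "N mod m < m" using m by simp
      ultimately show ?thesis by linarith
    qed
    have nN: "n \<le> 2 * K * N"
    proof -
      have "n = K * N + n mod K" by (simp add: N_m_q_def(1))
      moreover have "n mod K < K" using K by simp
      moreover have "K \<le> K * N" using m by simp
      ultimately show ?thesis by (simp add: mult.assoc, linarith)
    qed
    have "N * card E' \<le> 2 * (q * m) * card E'" by (rule mult_le_mono1[OF q])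
    also have "\<dots> = 2 * q * (m * card E')" by (simp only: ac_simps)
    also have "\<dots> \<le> 2 * q * (2 * n * e c)" using c(2) by (intro mult_le_mono2) (simp add: N_m_q_def(2))
    also have "\<dots> \<le> 2 * q * (2 * (2 * K * N) * e c)" using nN by (intro mult_le_mono) auto
    also have "\<dots> = N * (8 * K * (q * e c))" by (simp add: ac_simps)
    finally have "card E' \<le> 8 * K * (q * e c)" using m by simp
    also have "\<dots> \<le> 8 * K * inc 1 A' B'"
      using AB'(7) e_inc by (intro mult_le_mono2) (meson mult_le_mono2 order_trans)
    finally have E'le: "card E' \<le> 8 * K * inc 1 A' B'" .
    have "u2 n \<le> C1 * card E'" using uE c0(2) unfolding E'_def by (rule order_trans)
    also have "\<dots> \<le> C1 * (8 * K * inc 1 A' B')" using E'le by (rule mult_le_mono2)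
    finally have u: "u2 n \<le> 8 * K * C1 * inc 1 A' B'" by (simp add: ac_simps)
    have "2 * s + s < \<eta>" using s by (simp add: s_def)
    have nA: "dist a 0 < \<eta>" if "a \<in> A'" for a using AB'(5)[OF that] \<open>2 * s + s < \<eta>\<close> by linarith
    have nB: "dist b e1 < \<eta>" if "b \<in> B'" for b using AB'(6)[OF that] \<open>2 * s + s < \<eta>\<close> by linarith
    show ?thesis
      by (rule exI[of _ A'], rule exI[of _ B'], intro conjI ballI) (fact AB'(1,2) cAB nA nB u)+
  qed
  have "8 * K * C1 > 0" using \<open>C1 > 0\<close> K by simp
  then show thesis using main by (rule that)
qed

section \<open>The zigzag and its free positions\<close>

definition dir :: "nat \<Rightarrow> point2" where
  "dir i = (if i mod 3 = 2 then vector [4 / 5, 3 / 5] else e1)"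

text \<open>The edges with index 2 modulo 3 are tilted, so the linkages at both their ends are not
  stretched. All first coordinates still increase, which keeps the positions apart. The coordinates
  \<open>4 / 5\<close> and \<open>3 / 5\<close> give a rational unit vector.\<close>

definition base :: "(nat \<Rightarrow> real) \<Rightarrow> nat \<Rightarrow> point2" where
  "base \<delta> i = (\<Sum>j<i. \<delta> j *\<^sub>R dir j)"

lemma dir_nth: "dir i $ 1 = (if i mod 3 = 2 then 4 / 5 else 1)" "dir i $ 2 = (if i mod 3 = 2 then 3 / 5 else 0)"
  by (simp_all add: dir_def vector_2)

lemma norm_dir [simp]: "norm (dir i) = 1"
proof -
  have "dist (dir i) 0 = 1"
    by (subst dist_point2_eq_iff) (auto simp: dir_nth power2_eq_square)
  then show ?thesis by simp
qed

lemma base_Suc: "base \<delta> (Suc i) = base \<delta> i + \<delta> i *\<^sub>R dir i"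
  by (simp add: base_def)

lemma dist_base_Suc: "\<delta> i > 0 \<Longrightarrow> dist (base \<delta> i) (base \<delta> (Suc i)) = \<delta> i"
  by (simp add: base_Suc dist_norm)

lemma base_strict_mono:
  assumes "\<And>j. \<delta> j > 0" "i < j"
  shows "base \<delta> i $ 1 < base \<delta> j $ 1"
  using assms(2)
proof (induction rule: strict_inc_induct)
  case (base i)
  then show ?case using assms(1) by (simp add: base_Suc dir_nth)
next
  case (step i)
  moreover have "base \<delta> i $ 1 < base \<delta> (Suc i) $ 1" using assms(1) by (simp add: base_Suc dir_nth)
  ultimately show ?case by simp
qed

lemma base_separated:
  assumes "\<And>j. \<delta> j > 0"
  obtains \<eta> where "\<eta> > 0" "\<And>i j. i \<le> k \<Longrightarrow> j \<le> k \<Longrightarrow> i \<noteq> j \<Longrightarrow> 2 * \<eta> \<le> dist (base \<delta> i) (base \<delta> j)"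
proof -
  let ?D = "insert 1 ((\<lambda>x. dist (base \<delta> (fst x)) (base \<delta> (snd x))) ` {x \<in> {..k} \<times> {..k}. fst x \<noteq> snd x})"
  have fin: "finite ?D" by simp
  have ne: "base \<delta> i \<noteq> base \<delta> j" if ij: "i \<noteq> j" for i j
  proof -
    consider "i < j" | "j < i" using ij by linarith
    then show ?thesis using base_strict_mono[of \<delta> i j, OF assms] base_strict_mono[of \<delta> j i, OF assms] by cases auto
  qed
  have "x > 0" if "x \<in> ?D" for x using that ne by auto
  then have "Min ?D > 0" using Min_in[OF fin] by blast
  moreover have "Min ?D \<le> dist (base \<delta> i) (base \<delta> j)" if "i \<le> k" "j \<le> k" "i \<noteq> j" for i j
    by (intro Min_le[OF fin] insertI2 image_eqI[of _ _ "(i, j)"]) (use that in simp_all)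
  ultimately show thesis using that[of "Min ?D / 2"] by simp
qed

text \<open>The point at position \<open>i\<close> moves and drags the joint at
  \<open>Suc i\<close>, while position \<open>i + 2\<close>, which is 1 modulo 3, stays fixed. The
  determinant of the linkage is the product of both lengths with the sine \<open>3 / 5\<close>, up
  to sign.\<close>

lemma base_linkage_up:
  assumes \<delta>: "\<And>j. \<delta> j > 0" and i: "i mod 3 = 2" and \<eta>: "\<eta> > 0"
  shows "\<exists>\<gamma>>0. \<forall>p. dist p (base \<delta> i) < \<gamma> \<longrightarrow>
    (\<exists>p'. dist p' (base \<delta> (Suc i)) < \<eta> \<and> dist p p' = \<delta> i \<and> dist p' (base \<delta> (Suc (Suc i))) = \<delta> (Suc i))"
proof (rule linkage[OF dist_base_Suc[of \<delta>, OF \<delta>] \<delta> dist_base_Suc[of \<delta>, OF \<delta>] \<delta> _ \<eta>])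
  have "Suc i mod 3 \<noteq> 2" using i by presburger
  then have "(base \<delta> i $ 1 - base \<delta> (Suc (Suc i)) $ 1) * (base \<delta> (Suc i) $ 2 - base \<delta> (Suc (Suc i)) $ 2) -
    (base \<delta> i $ 2 - base \<delta> (Suc (Suc i)) $ 2) * (base \<delta> (Suc i) $ 1 - base \<delta> (Suc (Suc i)) $ 1) = - (3 / 5) * (\<delta> i * \<delta> (Suc i))"
    using i unfolding base_Suc vector_add_component vector_scaleR_component dir_nth real_scaleR_def
    by (simp add: algebra_simps)
  moreover have "\<delta> i > 0" "\<delta> (Suc i) > 0" using \<delta> by auto
  ultimately show "(base \<delta> i $ 1 - base \<delta> (Suc (Suc i)) $ 1) * (base \<delta> (Suc i) $ 2 - base \<delta> (Suc (Suc i)) $ 2) -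
    (base \<delta> i $ 2 - base \<delta> (Suc (Suc i)) $ 2) * (base \<delta> (Suc i) $ 1 - base \<delta> (Suc (Suc i)) $ 1) \<noteq> 0"
    by simp
qed

text \<open>The reversed situation, with position \<open>i\<close> fixed and position
  \<open>i + 2\<close> moving. It attaches the unit configuration to the last fixed point of a
  zigzag.\<close>

lemma base_linkage_down:
  assumes \<delta>: "\<And>j. \<delta> j > 0" and i: "Suc i mod 3 = 2" and \<eta>: "\<eta> > 0"
  shows "\<exists>\<gamma>>0. \<forall>p. dist p (base \<delta> (Suc (Suc i))) < \<gamma> \<longrightarrow>
    (\<exists>p'. dist p' (base \<delta> (Suc i)) < \<eta> \<and> dist p p' = \<delta> (Suc i) \<and> dist p' (base \<delta> i) = \<delta> i)"
proof (rule linkage[OF _ \<delta> _ \<delta> _ \<eta>])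
  show "dist (base \<delta> (Suc (Suc i))) (base \<delta> (Suc i)) = \<delta> (Suc i)" "dist (base \<delta> (Suc i)) (base \<delta> i) = \<delta> i"
    using dist_base_Suc[of \<delta>, OF \<delta>] by (simp_all add: dist_commute)
  have "i mod 3 \<noteq> 2" using i by presburger
  then have "(base \<delta> (Suc (Suc i)) $ 1 - base \<delta> i $ 1) * (base \<delta> (Suc i) $ 2 - base \<delta> i $ 2) -
    (base \<delta> (Suc (Suc i)) $ 2 - base \<delta> i $ 2) * (base \<delta> (Suc i) $ 1 - base \<delta> i $ 1) = - (3 / 5) * (\<delta> i * \<delta> (Suc i))"
    using i unfolding base_Suc vector_add_component vector_scaleR_component dir_nth real_scaleR_def
    by (simp add: algebra_simps)
  moreover have "\<delta> i > 0" "\<delta> (Suc i) > 0" using \<delta> by auto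
  ultimately show "(base \<delta> (Suc (Suc i)) $ 1 - base \<delta> i $ 1) * (base \<delta> (Suc i) $ 2 - base \<delta> i $ 2) -
    (base \<delta> (Suc (Suc i)) $ 2 - base \<delta> i $ 2) * (base \<delta> (Suc i) $ 1 - base \<delta> i $ 1) \<noteq> 0"
    by simp
qed

text \<open>Each of these positions contributes one factor \<open>N\<close>, so their number is the
  exponent in the lower bound.\<close>

lemma card_free_positions: "card {i. i \<le> k \<and> (i = 0 \<or> i mod 3 = 2)} = 1 + (k + 1) div 3"
proof (induction k)
  case 0
  have "{i::nat. i \<le> 0 \<and> (i = 0 \<or> i mod 3 = 2)} = {0}" by auto
  then show ?case by simp
next
  case (Suc k)
  let ?F = "\<lambda>k. {i. i \<le> k \<and> (i = 0 \<or> i mod 3 = 2)}"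
  have fin: "finite (?F k)" by simp
  show ?case
  proof (cases "Suc k mod 3 = 2")
    case True
    then have "?F (Suc k) = insert (Suc k) (?F k)" by (auto simp: le_Suc_eq)
    then have "card (?F (Suc k)) = Suc (card (?F k))" using fin by simp
    moreover have "(Suc k + 1) div 3 = Suc ((k + 1) div 3)" using True by presburger
    ultimately show ?thesis using Suc.IH by presburger
  next
    case False
    then have "?F (Suc k) = ?F k" by (auto simp: le_Suc_eq)
    moreover have "(Suc k + 1) div 3 = (k + 1) div 3" using False by presburger
    ultimately show ?thesis using Suc.IH by presburger
  qed
qed

text \<open>Chains near the zigzag \<open>base \<delta>\<close>: the points at positions \<open>1, 4, 7, \<dots>\<close> are fixed, those at
  positions \<open>0\<close> and \<open>2, 5, 8, \<dots>\<close> move freely on a circle around a fixed neighbour, and those at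
  positions \<open>3, 6, 9, \<dots>\<close> complete the linkage between a free point and the next fixed point.\<close>
lemma zigzag_family:
  assumes \<delta>: "\<And>j. \<delta> j > 0" and \<eta>: "\<eta> > 0" and N: "N \<ge> 1"
  obtains I :: "(nat \<Rightarrow> point2) set" and p W where
    "card I = N ^ (1 + (k + 1) div 3)" "\<forall>i. finite (W i) \<and> card (W i) \<le> N"
    "\<forall>x\<in>I. \<forall>i\<le>k. p x i \<in> W i \<and> dist (p x i) (base \<delta> i) < \<eta>"
    "\<forall>x\<in>I. \<forall>i<k. dist (p x i) (p x (Suc i)) = \<delta> i"
    "\<forall>x\<in>I. \<forall>y\<in>I. (\<forall>i\<le>k. p x i = p y i) \<longrightarrow> x = y"
    "\<forall>x\<in>I. \<forall>i\<le>k. i mod 3 = 1 \<longrightarrow> p x i = base \<delta> i"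
proof -
  define Q where "Q i p p' \<longleftrightarrow> dist p' (base \<delta> (Suc i)) < \<eta> \<and> dist p p' = \<delta> i \<and> dist p' (base \<delta> (Suc (Suc i))) = \<delta> (Suc i)" for i p p'
  \<comment> \<open>The restriction on \<open>i\<close> stands inside the existential, so that one
    choice function provides a positive radius for every position.\<close>
  have "\<forall>i. \<exists>\<gamma>>0. i mod 3 = 2 \<longrightarrow> (\<forall>p. dist p (base \<delta> i) < \<gamma> \<longrightarrow> (\<exists>p'. Q i p p'))"
  proof
    fix i
    show "\<exists>\<gamma>>0. i mod 3 = 2 \<longrightarrow> (\<forall>p. dist p (base \<delta> i) < \<gamma> \<longrightarrow> (\<exists>p'. Q i p p'))"
    proof (cases "i mod 3 = 2")
      case True
      then show ?thesis unfolding Q_def using base_linkage_up[of \<delta>, OF \<delta> True \<eta>] by blast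
    qed (auto intro: exI[of _ 1])
  qed
  from choice[OF this] obtain \<gamma> where \<gamma>: "\<And>i. \<gamma> i > 0"
    "\<And>i p. i mod 3 = 2 \<Longrightarrow> dist p (base \<delta> i) < \<gamma> i \<Longrightarrow> \<exists>p'. Q i p p'" by blast
  define g where "g i p = (SOME p'. Q i p p')" for i p
  have g: "Q i p (g i p)" if "i mod 3 = 2" "dist p (base \<delta> i) < \<gamma> i" for i p
    unfolding g_def by (rule someI_ex[OF \<gamma>(2)[OF that]])
  \<comment> \<open>Position 0 has no predecessor and moves around position 1. Every other free
    position moves around its predecessor, which is 1 modulo 3 and hence fixed.\<close>
  define c where "c i = (if i = 0 then 1 else i - 1)" for i :: nat
  define t where "t i = (if i = 0 then \<delta> 0 else \<delta> (i - 1))" for i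
  have "\<forall>i. \<exists>S. finite S \<and> card S = N \<and> (\<forall>p\<in>S. dist p (base \<delta> (c i)) = t i \<and> dist p (base \<delta> i) < min \<eta> (\<gamma> i))"
  proof
    fix i
    have "dist (base \<delta> i) (base \<delta> (c i)) = t i"
      using dist_base_Suc[of \<delta> 0, OF \<delta>] dist_base_Suc[of \<delta> "i - 1", OF \<delta>] by (auto simp: c_def t_def dist_commute)
    moreover have "t i > 0" using \<delta> by (simp add: t_def)
    moreover have "min \<eta> (\<gamma> i) > 0" using \<eta> \<gamma>(1) by simp
    ultimately show "\<exists>S. finite S \<and> card S = N \<and> (\<forall>p\<in>S. dist p (base \<delta> (c i)) = t i \<and> dist p (base \<delta> i) < min \<eta> (\<gamma> i))"
      by (rule circle_points)
  qed
  from choice[OF this] obtain S where S0: "\<forall>i. finite (S i) \<and> card (S i) = N \<and> (\<forall>p\<in>S i. dist p (base \<delta> (c i)) = t i \<and> dist p (base \<delta> i) < min \<eta> (\<gamma> i))" ..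
  have S: "\<And>i. finite (S i)" "\<And>i. card (S i) = N"
    "\<And>i p. p \<in> S i \<Longrightarrow> dist p (base \<delta> (c i)) = t i" "\<And>i p. p \<in> S i \<Longrightarrow> dist p (base \<delta> i) < \<eta>"
    "\<And>i p. p \<in> S i \<Longrightarrow> dist p (base \<delta> i) < \<gamma> i"
    using S0 by simp_all
  define Fr where "Fr = {i. i \<le> k \<and> (i = 0 \<or> i mod 3 = 2)}"
  define I where "I = PiE Fr S"
  define p where "p x i = (if i mod 3 = 1 then base \<delta> i else if i = 0 \<or> i mod 3 = 2 then x i else g (i - 1) (x (i - 1)))"
    for x :: "nat \<Rightarrow> point2" and i
  define W where "W i = (if i mod 3 = 1 then {base \<delta> i} else if i = 0 \<or> i mod 3 = 2 then S i else g (i - 1) ` S (i - 1))" for i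
  have finFr: "finite Fr" by (simp add: Fr_def)
  have inS: "x i \<in> S i" if "x \<in> I" "i \<in> Fr" for x i using that by (auto simp: I_def)
  have pred: "i - 1 \<in> Fr \<and> (i - 1) mod 3 = 2 \<and> Suc (i - 1) = i" if i: "i \<le> k" "i mod 3 \<noteq> 1" "\<not> (i = 0 \<or> i mod 3 = 2)" for i
  proof -
    obtain l where l: "i = Suc l" using i(3) by (cases i) auto
    have "Suc l mod 3 \<noteq> 1" "Suc l mod 3 \<noteq> 2" using i(2,3) unfolding l by auto
    then have "l mod 3 = 2" by presburger
    then show ?thesis using i(1) unfolding l by (simp add: Fr_def)
  qed
  show thesis
  proof (rule that[of I W p])
    show "card I = N ^ (1 + (k + 1) div 3)"
    proof -
      have "card Fr = 1 + (k + 1) div 3" unfolding Fr_def by (rule card_free_positions)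
      moreover have "card I = N ^ card Fr" unfolding I_def using finFr by (simp add: card_PiE S(2))
      ultimately show ?thesis by (simp only:)
    qed
    have "card (g (i - 1) ` S (i - 1)) \<le> N" for i using card_image_le[OF S(1)] S(2) by metis
    then show "\<forall>i. finite (W i) \<and> card (W i) \<le> N" using S(1,2) N by (simp add: W_def)
    show "\<forall>x\<in>I. \<forall>i\<le>k. p x i \<in> W i \<and> dist (p x i) (base \<delta> i) < \<eta>"
    proof (intro ballI allI impI)
      fix x i assume x: "x \<in> I" and i: "i \<le> k"
      consider "i mod 3 = 1" | "i mod 3 \<noteq> 1" "i = 0 \<or> i mod 3 = 2" | "i mod 3 \<noteq> 1" "\<not> (i = 0 \<or> i mod 3 = 2)" by blast
      then show "p x i \<in> W i \<and> dist (p x i) (base \<delta> i) < \<eta>"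
      proof cases
        case 1
        then show ?thesis using \<eta> by (simp add: p_def W_def)
      next
        case 2
        then have "x i \<in> S i" using inS[OF x, of i] i by (simp add: Fr_def)
        then show ?thesis using 2 S(4) by (simp add: p_def W_def)
      next
        case 3
        note pr = pred[OF i 3]
        then have xs: "x (i - 1) \<in> S (i - 1)" using inS[OF x] by blast
        then have "Q (i - 1) (x (i - 1)) (g (i - 1) (x (i - 1)))" using g pr S(5) by blast
        then have "dist (g (i - 1) (x (i - 1))) (base \<delta> i) < \<eta>" using pr by (simp add: Q_def)
        then show ?thesis using 3 xs by (simp add: p_def W_def)
      qed
    qed
    show "\<forall>x\<in>I. \<forall>i<k. dist (p x i) (p x (Suc i)) = \<delta> i"
    proof (intro ballI allI impI)
      fix x i assume x: "x \<in> I" and i: "i < k"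
      consider "i = 0" | "i mod 3 = 1" | "i mod 3 = 2" | "i mod 3 = 0" "i \<noteq> 0" by linarith
      then show "dist (p x i) (p x (Suc i)) = \<delta> i"
      proof cases
        case 1
        then have "x 0 \<in> S 0" using inS[OF x, of 0] by (simp add: Fr_def)
        then show ?thesis using S(3)[of "x 0" 0] 1 by (simp add: p_def c_def t_def)
      next
        case 2
        then have m: "Suc i mod 3 = 2" by presburger
        then have "x (Suc i) \<in> S (Suc i)" using inS[OF x, of "Suc i"] i by (simp add: Fr_def)
        then show ?thesis using S(3)[of "x (Suc i)" "Suc i"] 2 m by (simp add: p_def c_def t_def dist_commute)
      next
        case 3
        then have m: "Suc i mod 3 = 0" by presburger
        have "x i \<in> S i" using inS[OF x, of i] i 3 by (simp add: Fr_def)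
        then have "Q i (x i) (g i (x i))" using g 3 S(5) by blast
        then show ?thesis using 3 m by (simp add: p_def Q_def)
      next
        case 4
        then have m: "Suc i mod 3 = 1" "i mod 3 \<noteq> 1" "\<not> (i = 0 \<or> i mod 3 = 2)" by presburger+
        note pr = pred[OF less_imp_le[OF i] m(2,3)]
        then have "x (i - 1) \<in> S (i - 1)" using inS[OF x] by blast
        then have "Q (i - 1) (x (i - 1)) (g (i - 1) (x (i - 1)))" using g pr S(5) by blast
        then have "dist (g (i - 1) (x (i - 1))) (base \<delta> (Suc i)) = \<delta> i" using pr by (simp add: Q_def)
        then show ?thesis using m by (simp add: p_def)
      qed
    qed
    show "\<forall>x\<in>I. \<forall>y\<in>I. (\<forall>i\<le>k. p x i = p y i) \<longrightarrow> x = y"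
    proof (intro ballI impI)
      fix x y assume xy: "x \<in> I" "y \<in> I" and eq: "\<forall>i\<le>k. p x i = p y i"
      show "x = y"
      proof (rule PiE_ext[OF xy[unfolded I_def]])
        fix i assume i: "i \<in> Fr"
        then have "p x i = p y i" "i = 0 \<or> i mod 3 = 2" using eq by (auto simp: Fr_def)
        then show "x i = y i" by (auto simp: p_def)
      qed
    qed
    show "\<forall>x\<in>I. \<forall>i\<le>k. i mod 3 = 1 \<longrightarrow> p x i = base \<delta> i" by (simp add: p_def)
  qed
qed

lemma C2_lower_zigzag:
  assumes \<delta>: "\<And>j. \<delta> j > 0" and n: "(k + 1) * N \<le> n"
  shows "N ^ (1 + (k + 1) div 3) \<le> C2 \<delta> k n"
proof (cases "N = 0")
  case False
  then have N: "N \<ge> 1" by simp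
  obtain \<eta> where \<eta>: "\<eta> > 0" "\<And>i j. i \<le> k \<Longrightarrow> j \<le> k \<Longrightarrow> i \<noteq> j \<Longrightarrow> 2 * \<eta> \<le> dist (base \<delta> i) (base \<delta> j)"
    using base_separated[of \<delta> k, OF \<delta>] by blast
  obtain I :: "(nat \<Rightarrow> point2) set" and p W where I:
    "card I = N ^ (1 + (k + 1) div 3)" "\<forall>i. finite (W i) \<and> card (W i) \<le> N"
    "\<forall>x\<in>I. \<forall>i\<le>k. p x i \<in> W i \<and> dist (p x i) (base \<delta> i) < \<eta>"
    "\<forall>x\<in>I. \<forall>i<k. dist (p x i) (p x (Suc i)) = \<delta> i"
    "\<forall>x\<in>I. \<forall>y\<in>I. (\<forall>i\<le>k. p x i = p y i) \<longrightarrow> x = y"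
    by (rule zigzag_family[of \<delta> \<eta> N k, OF \<delta> \<eta>(1) N])
  show ?thesis unfolding I(1)[symmetric]
  proof (rule C2_lower_of_family[where W = W and p = p and z = "base \<delta>" and \<eta> = \<eta> and N = N])
    show "finite (W i) \<and> card (W i) \<le> N" for i using I(2) by blast
    show "p x i \<in> W i \<and> dist (p x i) (base \<delta> i) < \<eta>" if "x \<in> I" "i \<le> k" for x i using I(3) that by blast
    show "dist (p x i) (p x (Suc i)) = \<delta> i" if "x \<in> I" "i < k" for x i using I(4) that by blast
    show "x = y" if "x \<in> I" "y \<in> I" "\<And>i. i \<le> k \<Longrightarrow> p x i = p y i" for x y using I(5) that by blast
  qed (fact \<eta>(2) n)+
qed simp

text \<open>Positions up to \<open>3 * l + 1\<close> form a zigzag with \<open>l + 1\<close> free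
  positions that ends in a fixed point. Positions \<open>3 * l + 3\<close> and
  \<open>3 * l + 4\<close> carry a scaled local unit configuration, and position
  \<open>3 * l + 2\<close> is the joint connecting both.\<close>

lemma C2_lower_unit:
  assumes \<delta>: "\<And>j. \<delta> j > 0" and k: "k = 3 * l + 4"
  obtains C :: nat where "C > 0"
    "\<And>n. n \<ge> 4 * (k + 1) \<Longrightarrow> (n div (k + 1)) ^ (l + 1) * u2 n \<le> C * C2 \<delta> k n"
proof -
  obtain \<eta> where \<eta>: "\<eta> > 0" "\<And>i j. i \<le> k \<Longrightarrow> j \<le> k \<Longrightarrow> i \<noteq> j \<Longrightarrow> 2 * \<eta> \<le> dist (base \<delta> i) (base \<delta> j)"
    using base_separated[of \<delta> k, OF \<delta>] by blast
  let ?m = "3 * l + 1"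
  have idx: "Suc ?m mod 3 = 2" by presburger
  obtain \<gamma> where \<gamma>: "\<gamma> > 0" "\<And>p. dist p (base \<delta> (Suc (Suc ?m))) < \<gamma> \<Longrightarrow>
     \<exists>p'. dist p' (base \<delta> (Suc ?m)) < \<eta> \<and> dist p p' = \<delta> (Suc ?m) \<and> dist p' (base \<delta> ?m) = \<delta> ?m"
    using base_linkage_down[of \<delta>, OF \<delta> idx \<eta>(1)] by blast
  define h where "h p = (SOME p'. dist p' (base \<delta> (Suc ?m)) < \<eta> \<and> dist p p' = \<delta> (Suc ?m) \<and> dist p' (base \<delta> ?m) = \<delta> ?m)" for p
  have h: "dist (h p) (base \<delta> (Suc ?m)) < \<eta> \<and> dist p (h p) = \<delta> (Suc ?m) \<and> dist (h p) (base \<delta> ?m) = \<delta> ?m"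
    if "dist p (base \<delta> (Suc (Suc ?m))) < \<gamma>" for p
    unfolding h_def by (rule someI_ex[OF \<gamma>(2)[OF that]])
  define d where "d = \<delta> (Suc (Suc ?m))"
  have d: "d > 0" using \<delta> by (simp add: d_def)
  \<comment> \<open>The last edge has direction \<open>e1\<close>, so this map sends
    \<open>0\<close> and \<open>e1\<close> to the last two base points, and unit distances to the
    required length \<open>d\<close>.\<close>
  define \<alpha> where "\<alpha> p = base \<delta> (Suc (Suc ?m)) + d *\<^sub>R p" for p
  have \<alpha>dist: "dist (\<alpha> p) (\<alpha> q) = d * dist p q" for p q
    using d by (simp add: \<alpha>_def dist_norm flip: scaleR_diff_right)
  have \<alpha>0: "\<alpha> 0 = base \<delta> (Suc (Suc ?m))" by (simp add: \<alpha>_def)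
  have "Suc (Suc ?m) mod 3 \<noteq> 2" by presburger
  then have \<alpha>1: "\<alpha> e1 = base \<delta> (Suc (Suc (Suc ?m)))" by (simp add: \<alpha>_def d_def base_Suc dir_def)
  \<comment> \<open>After scaling by \<open>d\<close>, the points then stay within
    \<open>\<eta>\<close> of their base points and within the range \<open>\<gamma>\<close> in which
    the joint can follow.\<close>
  define \<mu> where "\<mu> = min \<eta> \<gamma> / d"
  have \<mu>: "\<mu> > 0" using \<eta>(1) \<gamma>(1) d by (simp add: \<mu>_def)
  have K: "k + 1 \<ge> 1" by simp
  obtain C where C: "C > 0" "\<And>n. n \<ge> 4 * (k + 1) \<Longrightarrow> \<exists>A B. finite A \<and> finite B \<and> card A + card B \<le> n div (k + 1) \<and>
     (\<forall>a\<in>A. dist a 0 < \<mu>) \<and> (\<forall>b\<in>B. dist b e1 < \<mu>) \<and> u2 n \<le> C * inc 1 A B"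
    using local_unit_configuration[OF \<mu> K] by blast
  have "(n div (k + 1)) ^ (l + 1) * u2 n \<le> C * C2 \<delta> k n" if n: "n \<ge> 4 * (k + 1)" for n
  proof -
    define N where "N = n div (k + 1)"
    have N: "N \<ge> 1" using n unfolding N_def by (simp add: Suc_le_eq div_greater_zero_iff)
    have Nn: "(k + 1) * N \<le> n" unfolding N_def by (rule times_div_less_eq_dividend)
    obtain A B where AB: "finite A" "finite B" "card A + card B \<le> N" "\<forall>a\<in>A. dist a 0 < \<mu>" "\<forall>b\<in>B. dist b e1 < \<mu>"
      "u2 n \<le> C * inc 1 A B" using C(2)[OF n] unfolding N_def by blast
    define E where "E = {(a, b). a \<in> A \<and> b \<in> B \<and> dist a b = 1}"
    have finE: "finite E" by (rule finite_subset[of _ "A \<times> B"]) (use AB in \<open>auto simp: E_def\<close>)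
    obtain I :: "(nat \<Rightarrow> point2) set" and p W where I:
      "card I = N ^ (1 + (?m + 1) div 3)" "\<forall>i. finite (W i) \<and> card (W i) \<le> N"
      "\<forall>x\<in>I. \<forall>i\<le>?m. p x i \<in> W i \<and> dist (p x i) (base \<delta> i) < \<eta>"
      "\<forall>x\<in>I. \<forall>i<?m. dist (p x i) (p x (Suc i)) = \<delta> i"
      "\<forall>x\<in>I. \<forall>y\<in>I. (\<forall>i\<le>?m. p x i = p y i) \<longrightarrow> x = y"
      "\<forall>x\<in>I. \<forall>i\<le>?m. i mod 3 = 1 \<longrightarrow> p x i = base \<delta> i"
      by (rule zigzag_family[of \<delta> \<eta> N ?m, OF \<delta> \<eta>(1) N])
    define p' where "p' x i = (if i \<le> ?m then p (fst x) i else if i = Suc ?m then h (\<alpha> (fst (snd x)))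
       else if i = Suc (Suc ?m) then \<alpha> (fst (snd x)) else \<alpha> (snd (snd x)))" for x i
    define W' where "W' i = (if i \<le> ?m then W i else if i = Suc ?m then h ` \<alpha> ` A
       else if i = Suc (Suc ?m) then \<alpha> ` A else \<alpha> ` B)" for i
    have pos: "p' x i = p (fst x) i" if "i \<le> ?m" for x i using that by (simp add: p'_def)
    have pos1: "p' x (Suc ?m) = h (\<alpha> (fst (snd x)))" "p' x (Suc (Suc ?m)) = \<alpha> (fst (snd x))"
      "p' x (Suc (Suc (Suc ?m))) = \<alpha> (snd (snd x))" for x by (simp_all add: p'_def)
    have k': "k = Suc (Suc (Suc ?m))" using k by simp
    have near: "dist (\<alpha> a) (base \<delta> (Suc (Suc ?m))) < min \<eta> \<gamma>" if "a \<in> A" for a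
    proof -
      have "d * dist a 0 < d * \<mu>" using AB(4) that d by (intro mult_strict_left_mono) auto
      then show ?thesis using \<alpha>dist[of a 0] d unfolding \<alpha>0 by (simp add: \<mu>_def)
    qed
    have near': "dist (\<alpha> b) (base \<delta> (Suc (Suc (Suc ?m)))) < min \<eta> \<gamma>" if "b \<in> B" for b
    proof -
      have "d * dist b e1 < d * \<mu>" using AB(5) that d by (intro mult_strict_left_mono) auto
      then show ?thesis using \<alpha>dist[of b e1] d unfolding \<alpha>1 by (simp add: \<mu>_def)
    qed
    have EAB: "fst e \<in> A" "snd e \<in> B" "dist (fst e) (snd e) = 1" if "e \<in> E" for e using that by (auto simp: E_def)
    have "card (I \<times> E) \<le> C2 \<delta> k n"
    proof (rule C2_lower_of_family[where W = W' and p = p' and z = "base \<delta>" and \<eta> = \<eta> and N = N])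
      fix i assume "i \<le> k"
      have cA: "card (\<alpha> ` A) \<le> N" "card (\<alpha> ` B) \<le> N"
        using card_image_le[OF AB(1), of \<alpha>] card_image_le[OF AB(2), of \<alpha>] AB(3) by linarith+
      moreover have "card (h ` \<alpha> ` A) \<le> N" using card_image_le[of "\<alpha> ` A" h] AB(1) cA by simp
      ultimately show "finite (W' i) \<and> card (W' i) \<le> N" using I(2) AB(1,2) by (simp add: W'_def)
    next
      fix x i assume x: "x \<in> I \<times> E" and i: "i \<le> k"
      have e: "fst x \<in> I" "fst (snd x) \<in> A" "snd (snd x) \<in> B" using x EAB by auto
      consider "i \<le> ?m" | "i = Suc ?m" | "i = Suc (Suc ?m)" | "i = Suc (Suc (Suc ?m))" using i k' by linarith
      then show "p' x i \<in> W' i \<and> dist (p' x i) (base \<delta> i) < \<eta>"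
      proof cases
        case 1
        then show ?thesis using I(3) e by (simp add: p'_def W'_def)
      next
        case 2
        then show ?thesis using h[of "\<alpha> (fst (snd x))"] near[OF e(2)] e(2) by (simp add: p'_def W'_def)
      next
        case 3
        then show ?thesis using near[OF e(2)] e(2) by (simp add: p'_def W'_def)
      next
        case 4
        then show ?thesis using near'[OF e(3)] e(3) by (simp add: p'_def W'_def)
      qed
    next
      fix x i assume x: "x \<in> I \<times> E" and i: "i < k"
      have e: "fst x \<in> I" "fst (snd x) \<in> A" "dist (fst (snd x)) (snd (snd x)) = 1" using x EAB by auto
      consider "i < ?m" | "i = ?m" | "i = Suc ?m" | "i = Suc (Suc ?m)" using i k' by linarith
      then show "dist (p' x i) (p' x (Suc i)) = \<delta> i"
      proof cases
        case 1
        then show ?thesis using I(4) e pos by simp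
      next
        case 2
        have "?m mod 3 = 1" by presburger
        then have "p (fst x) ?m = base \<delta> ?m" using I(6) e(1) by blast
        then show ?thesis unfolding 2 pos1 pos[OF order_refl]
          using h[of "\<alpha> (fst (snd x))"] near[OF e(2)] by (simp add: dist_commute)
      next
        case 3
        then show ?thesis unfolding 3 pos1 using h[of "\<alpha> (fst (snd x))"] near[OF e(2)] by (simp add: dist_commute)
      next
        case 4
        then show ?thesis unfolding 4 pos1 \<alpha>dist e(3) by (simp add: d_def)
      qed
    next
      fix i j assume "i \<le> k" "j \<le> k" "i \<noteq> j"
      then show "2 * \<eta> \<le> dist (base \<delta> i) (base \<delta> j)" by (rule \<eta>(2))
    next
      fix x y assume xy: "x \<in> I \<times> E" "y \<in> I \<times> E" and eq: "\<And>i. i \<le> k \<Longrightarrow> p' x i = p' y i"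
      have "\<forall>i\<le>?m. p (fst x) i = p (fst y) i"
      proof (intro allI impI)
        fix i assume "i \<le> ?m"
        then show "p (fst x) i = p (fst y) i" using eq[of i] pos[of i x] pos[of i y] k' by simp
      qed
      moreover have "fst x \<in> I" "fst y \<in> I" using xy by auto
      ultimately have "fst x = fst y" using I(5) by blast
      moreover have "\<alpha> (fst (snd x)) = \<alpha> (fst (snd y))" "\<alpha> (snd (snd x)) = \<alpha> (snd (snd y))"
        using eq[of "Suc (Suc ?m)"] eq[of "Suc (Suc (Suc ?m))"] unfolding pos1 using k' by auto
      then have "fst (snd x) = fst (snd y)" "snd (snd x) = snd (snd y)" using d by (simp_all add: \<alpha>_def)
      ultimately show "x = y" by (simp add: prod_eq_iff)
    qed (fact Nn)
    moreover have "(?m + 1) div 3 = l" by presburger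
    moreover have "card E = inc 1 A B" by (simp add: E_def inc_def)
    ultimately have "N ^ (1 + l) * inc 1 A B \<le> C2 \<delta> k n" by (simp add: card_cartesian_product I(1))
    then have "C * (N ^ (1 + l) * inc 1 A B) \<le> C * C2 \<delta> k n" by (rule mult_le_mono2)
    moreover have "N ^ (1 + l) * u2 n \<le> C * (N ^ (1 + l) * inc 1 A B)"
      unfolding mult.left_commute[of C] using AB(6) by (rule mult_le_mono2)
    ultimately show ?thesis unfolding N_def add.commute[of l 1] by linarith
  qed
  then show thesis using that C(1) by blast
qed

text \<open>The case \<open>k = 1\<close> is separate because the construction of
  \<open>C2_lower_unit\<close> starts at \<open>k = 4\<close>. Scaling the whole configuration
  suffices.\<close>

lemma u2_le_C2_one:
  assumes "\<delta> 0 > 0"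
  shows "u2 n \<le> C2 \<delta> 1 n"
proof -
  obtain P :: "point2 set" where P: "finite P" "card P = n" "u2 n \<le> inc 1 P P" by (rule u2_attained)
  define sc where "sc p = \<delta> 0 *\<^sub>R p" for p :: point2
  have inj: "sc p = sc q \<longleftrightarrow> p = q" for p q using assms by (simp add: sc_def)
  have d: "dist (sc p) (sc q) = \<delta> 0 * dist p q" for p q
    using assms by (simp add: sc_def dist_norm flip: scaleR_diff_right)
  have "inc 1 P P \<le> card (chains \<delta> 1 (sc ` P))"
    unfolding inc_def
  proof (rule card_inj_on_le[of "\<lambda>(a, b). [sc a, sc b]"])
    show "inj_on (\<lambda>(a, b). [sc a, sc b]) {(a, b). a \<in> P \<and> b \<in> P \<and> dist a b = 1}"
      by (auto simp: inj_on_def inj)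
    show "(\<lambda>(a, b). [sc a, sc b]) ` {(a, b). a \<in> P \<and> b \<in> P \<and> dist a b = 1} \<subseteq> chains \<delta> 1 (sc ` P)"
      by (auto simp: chains_def inj d)
    show "finite (chains \<delta> 1 (sc ` P))" using P by (intro finite_chains) simp
  qed
  also have "\<dots> \<le> C2 \<delta> 1 n"
    using P card_image_le[OF P(1), of sc] by (intro card_chains_le_C2) auto
  finally show ?thesis using P(3) by simp
qed

section \<open>Translation into asymptotic notation\<close>

lemma le_twice_div:
  fixes n K :: nat
  assumes "K \<ge> 1" "n \<ge> K"
  shows "n \<le> 2 * K * (n div K)"
proof -
  have "n = K * (n div K) + n mod K" by simp
  moreover have "n mod K < K" using assms by simp
  moreover have "K \<le> K * (n div K)" using assms by (simp add: Suc_le_eq div_greater_zero_iff)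
  ultimately show ?thesis unfolding mult.assoc by linarith
qed

lemma ln_ge_1: "3 \<le> n \<Longrightarrow> 1 \<le> ln (real n)"
  using exp_le by (subst ln_ge_iff) auto

lemma soft_O_of_bigo_ln_power:
  assumes "\<And>n. n \<ge> 3 \<Longrightarrow> f n \<le> (3 * ln (real n)) ^ c * g n" "\<And>n. n \<ge> 3 \<Longrightarrow> g n > 0"
  shows "soft_O f g"
  unfolding soft_O_def
\<comment> \<open>\<open>Suc c\<close> replaces \<open>c\<close> because \<open>soft_O\<close> asks
  for a positive exponent.\<close>
proof (rule exI[of _ "real (Suc c)"], rule exI[of _ "3 ^ Suc c"], intro conjI)
  show "\<forall>\<^sub>F n in at_top. f n / g n \<le> 3 ^ Suc c * ln (real n) powr real (Suc c)"
    using eventually_ge_at_top[of 3]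
  proof eventually_elim
    case (elim n)
    have l: "1 \<le> ln (real n)" by (rule ln_ge_1[OF elim])
    have "f n / g n \<le> (3 * ln (real n)) ^ c"
      using assms[OF elim] by (simp add: pos_divide_le_eq)
    also have "\<dots> \<le> (3 * ln (real n)) ^ Suc c"
      by (rule power_increasing) (use l in auto)
    also have "\<dots> = 3 ^ Suc c * ln (real n) powr real (Suc c)"
      using l by (simp only: power_mult_distrib, subst powr_realpow) auto
    finally show ?case .
  qed
qed auto

lemma soft_O_of_le:
  assumes "\<And>n. n \<ge> m \<Longrightarrow> f n \<le> D * g n" "D > 0" "\<And>n. g n \<ge> 0"
  shows "soft_O f g"
  unfolding soft_O_def
proof (rule exI[of _ 1], rule exI[of _ D], intro conjI)
  show "\<forall>\<^sub>F n in at_top. f n / g n \<le> D * ln (real n) powr 1"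
    using eventually_ge_at_top[of "max 3 m"]
  proof eventually_elim
    case (elim n)
    then have n: "n \<ge> 3" "n \<ge> m" by auto
    \<comment> \<open>For \<open>g n = 0\<close> the quotient is 0 by the convention on
      division.\<close>
    have "f n / g n \<le> D"
      using assms(1)[OF n(2)] assms(2) assms(3)[of n] by (cases "g n = 0") (auto simp: divide_le_eq)
    also have "\<dots> \<le> D * ln (real n) powr 1"
      using ln_ge_1[OF n(1)] assms(2) by simp
    finally show ?case .
  qed
qed (use assms in auto)

theorem theorem1p3:
  fixes \<delta> :: "nat \<Rightarrow> real" and k :: nat
  assumes "k \<ge> 1"
    and "\<And>j. j < k \<Longrightarrow> \<delta> j > 0"
  shows "((k mod 3 = 0 \<or> k mod 3 = 2) \<longrightarrow>
           soft_Theta (\<lambda>n. real (C2 \<delta> k n)) (\<lambda>n. real n ^ ((k + 1) div 3 + 1))) \<and>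
         (k mod 3 = 1 \<longrightarrow>
           (\<lambda>n. real (C2 \<delta> k n)) \<in> \<Omega>(\<lambda>n. real n powr ((real k - 1) / 3) * real (u2 n))) \<and>
         (k mod 3 = 1 \<longrightarrow> (\<forall>\<epsilon>>0.
           (\<lambda>n. real (C2 \<delta> k n)) \<in> O(\<lambda>n. real n powr ((real k - 1) / 3 + \<epsilon>) * real (u2 n))))"
proof -
  define \<delta>' where "\<delta>' j = (if j < k then \<delta> j else 1)" for j
  have eq: "C2 \<delta> k = C2 \<delta>' k" by (rule C2_cong) (simp add: \<delta>'_def)
  have pos: "\<delta>' j > 0" for j using assms(2) by (simp add: \<delta>'_def)
  obtain c where upper: "\<And>n. n \<ge> 3 \<Longrightarrow> real (C2 \<delta> k n) \<le> (3 * ln (real n)) ^ c *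
    real (if k mod 3 = 1 then n ^ (k div 3) * u2 n else n ^ ((k + 1) div 3 + 1))"
    using C2_upper[of k \<delta>, OF assms(2) assms(1)] by blast
  have exponent: "(real k - 1) / 3 = real (k div 3)" if "k mod 3 = 1"
  proof -
    have "k = 3 * (k div 3) + 1" using that by presburger
    then have "real k = 3 * real (k div 3) + 1" by linarith
    then show ?thesis by simp
  qed
  have part1: "soft_Theta (\<lambda>n. real (C2 \<delta> k n)) (\<lambda>n. real n ^ ((k + 1) div 3 + 1))"
    if k: "k mod 3 = 0 \<or> k mod 3 = 2"
    unfolding soft_Theta_def
  proof
    have "k mod 3 \<noteq> 1" using k by auto
    then show "soft_O (\<lambda>n. real (C2 \<delta> k n)) (\<lambda>n. real n ^ ((k + 1) div 3 + 1))"
      using upper by (intro soft_O_of_bigo_ln_power[of _ c]) auto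
    let ?f = "(k + 1) div 3 + 1"
    show "soft_O (\<lambda>n. real n ^ ?f) (\<lambda>n. real (C2 \<delta> k n))"
    \<comment> \<open>The constant pays for the passage from \<open>n\<close> to
      \<open>n div (k + 1)\<close>, the number of points available at each position.\<close>
    proof (rule soft_O_of_le[of "k + 1" _ "real ((2 * (k + 1)) ^ ?f)"])
      fix n assume n: "k + 1 \<le> n"
      have "n ^ ?f \<le> (2 * (k + 1) * (n div (k + 1))) ^ ?f"
        by (intro power_mono le_twice_div) (use n in auto)
      also have "\<dots> = (2 * (k + 1)) ^ ?f * (n div (k + 1)) ^ (1 + (k + 1) div 3)"
        by (simp only: power_mult_distrib add.commute[of 1])
      also have "\<dots> \<le> (2 * (k + 1)) ^ ?f * C2 \<delta> k n" unfolding eq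
        by (intro mult_le_mono2 C2_lower_zigzag[of \<delta>', OF pos] times_div_less_eq_dividend)
      finally show "real n ^ ?f \<le> real ((2 * (k + 1)) ^ ?f) * real (C2 \<delta> k n)"
        by (simp only: of_nat_mult[symmetric] of_nat_power[symmetric] of_nat_le_iff)
    next
      show "0 < real ((2 * (k + 1)) ^ ?f)" by (subst of_nat_0_less_iff, rule zero_less_power) simp
    qed simp
  qed
  have part2: "(\<lambda>n. real (C2 \<delta> k n)) \<in> \<Omega>(\<lambda>n. real n powr ((real k - 1) / 3) * real (u2 n))"
    if k: "k mod 3 = 1"
  proof -
    have "\<exists>D m. D > 0 \<and> (\<forall>n\<ge>m. n ^ (k div 3) * u2 n \<le> D * C2 \<delta> k n)"
    proof (cases "k = 1")
      case True
      have "u2 n \<le> C2 \<delta> 1 n" for n by (rule u2_le_C2_one) (use assms in auto)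
      then show ?thesis unfolding True by (intro exI[of _ 1]) simp
    next
      case False
      define l where "l = k div 3 - 1"
      have "k = 3 * (k div 3) + 1" using k by presburger
      then have l: "k = 3 * l + 4" "k div 3 = l + 1" using False unfolding l_def by linarith+
      obtain C :: nat where C: "C > 0" "\<And>n. n \<ge> 4 * (k + 1) \<Longrightarrow> (n div (k + 1)) ^ (l + 1) * u2 n \<le> C * C2 \<delta>' k n"
        using C2_lower_unit[of \<delta>' k l, OF pos l(1)] by blast
      let ?D = "(2 * (k + 1)) ^ (l + 1) * C"
      have "n ^ (k div 3) * u2 n \<le> ?D * C2 \<delta> k n" if n: "n \<ge> 4 * (k + 1)" for n
      proof -
        have "n ^ (l + 1) \<le> (2 * (k + 1) * (n div (k + 1))) ^ (l + 1)"
          by (intro power_mono le_twice_div) (use n in auto)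
        then have "n ^ (l + 1) * u2 n \<le> (2 * (k + 1)) ^ (l + 1) * ((n div (k + 1)) ^ (l + 1) * u2 n)"
          unfolding power_mult_distrib[of "2 * (k + 1)"] mult.assoc[symmetric] by (rule mult_le_mono1)
        also have "\<dots> \<le> (2 * (k + 1)) ^ (l + 1) * (C * C2 \<delta>' k n)" by (rule mult_le_mono2[OF C(2)[OF n]])
        finally show ?thesis unfolding l(2) eq by (simp only: mult.assoc)
      qed
      moreover have "?D > 0" using C(1) by simp
      ultimately show ?thesis by blast
    qed
    then obtain D m where D: "D > 0" "\<And>n. n \<ge> m \<Longrightarrow> n ^ (k div 3) * u2 n \<le> D * C2 \<delta> k n" by blast
    have "\<forall>\<^sub>F n in at_top. norm (real (C2 \<delta> k n)) \<ge> 1 / real D * norm (real n powr ((real k - 1) / 3) * real (u2 n))"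
      using eventually_ge_at_top[of "max 1 m"]
    proof eventually_elim
      case (elim n)
      then have n: "n > 0" "n \<ge> m" by auto
      have "real (n ^ (k div 3) * u2 n) \<le> real (D * C2 \<delta> k n)" using D(2)[OF n(2)] by (simp only: of_nat_le_iff)
      then have "real n powr ((real k - 1) / 3) * real (u2 n) \<le> real D * real (C2 \<delta> k n)"
        unfolding exponent[OF k] using n(1) by (simp add: powr_realpow)
      then show ?case using D(1) by (simp add: field_simps)
    qed
    then show ?thesis using D(1) by (intro landau_omega.bigI[of "1 / real D"]) auto
  qed
  have part3: "(\<lambda>n. real (C2 \<delta> k n)) \<in> O(\<lambda>n. real n powr ((real k - 1) / 3 + \<epsilon>) * real (u2 n))"
    if k: "k mod 3 = 1" and \<epsilon>: "\<epsilon> > 0" for \<epsilon> :: real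
  proof -
    have "\<forall>\<^sub>F n in at_top. norm (real (C2 \<delta> k n)) \<le> 1 * norm ((3 * ln (real n)) ^ c * (real n ^ (k div 3) * real (u2 n)))"
      using eventually_ge_at_top[of 3]
    proof eventually_elim
      case (elim n)
      have "real (C2 \<delta> k n) \<le> (3 * ln (real n)) ^ c * (real n ^ (k div 3) * real (u2 n))" using upper[OF elim] k by simp
      then show ?case by simp
    qed
    then have "(\<lambda>n. real (C2 \<delta> k n)) \<in> O(\<lambda>n. (3 * ln (real n)) ^ c * (real n ^ (k div 3) * real (u2 n)))"
      by (rule bigoI)
    also have "(\<lambda>n. (3 * ln (real n)) ^ c * (real n ^ (k div 3) * real (u2 n))) \<in>
        O(\<lambda>n. real n powr \<epsilon> * (real n ^ (k div 3) * real (u2 n)))"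
      by (rule landau_o.big.mult_right[OF ln_power_bigo_powr[OF \<epsilon>]])
    also have "(\<lambda>n. real n powr \<epsilon> * (real n ^ (k div 3) * real (u2 n))) \<in> \<Theta>(\<lambda>n. real n powr ((real k - 1) / 3 + \<epsilon>) * real (u2 n))"
    proof (rule bigthetaI_cong)
      show "\<forall>\<^sub>F n in at_top. real n powr \<epsilon> * (real n ^ (k div 3) * real (u2 n)) = real n powr ((real k - 1) / 3 + \<epsilon>) * real (u2 n)"
        using eventually_gt_at_top[of 0]
        by eventually_elim (simp add: exponent[OF k] powr_add powr_realpow)
    qed
    finally show ?thesis .
  qed
  show ?thesis using part1 part2 part3 by blast
qed

end
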